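(* Let $K$ be a finite prime field. Let $P$ be a polynomial representation over $K$ of degree $d>0$, let $R$ be an irreducible subobject of $P_{>d-1}$, let $\pi:P\to P/R=:P'$ be the projection, let $X$ be a subset of $P$, and let $X'$ be the subset of $P'$ given by $X'(V):=\pi(X(V))$. Let $V$ be a finite-dimensional $K$-vector space and let $f\in I_X(V)\setminus K[P(V)]\cdot I_{X'}(V)$. Then there exist a finite-dimensional $K$-vector space $U$ and a function $h\in K[P(U)]$ of degree strictly smaller than that of $f$, such that $h$ does not vanish identically on $\pi^{-1}(X'(U))$ and such that the projection $\mathrm{Sh}_U P\to(\mathrm{Sh}_U P)/R$ restricts to an injective map on $(\mathrm{Sh}_U X)[1/h]$.
   Context: Let $\mathbf{Vec}$ be the category of finite-dimensional $K$-vector spaces. For $V\in\mathbf{Vec}$, $K[V]$ is the $K$-algebra of all functions $V\to K$, and $K[V]_{\le e}$ is the subspace of functions given by a polynomial of degree at most $e$ in linear coordinates ($K[V]_{\le-1}=\{0\}$); the degree of $f\in K[V]$ is the minimal $e$ with $f\in K[V]_{\le e}$. A polynomial representation is a functor $P:\mathbf{Vec}\to\mathbf{Vec}$ for which there is a $d$ such that for all $U,V$ the map $P:\mathrm{Hom}(U,V)\to\mathrm{Hom}(P(U),P(V))$ lies in $K[\mathrm{Hom}(U,V)]_{\le d}\otimes\mathrm{Hom}(P(U),P(V))$; the minimal such $d\in\mathbb{Z}_{\ge-1}$ is the degree of $P$. Polynomial representations form an abelian category with natural transformations as morphisms; irreducible means nonzero with no proper nonzero subobjects. For $e\in\mathbb{Z}_{\ge-1}$,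 $P_{>e}$ denotes the unique inclusionwise minimal subrepresentation $Q$ of $P$ such that $P/Q$ has degree $\le e$. A subset $X$ of $P$ is the data of a subset $X(V)\subseteq P(V)$ for every $V\in\mathbf{Vec}$ with $P(\phi)X(V)\subseteq X(W)$ for all $\phi\in\mathrm{Hom}(V,W)$. $I_X(V)\subseteq K[P(V)]$ is the ideal of all functions vanishing identically on $X(V)$; similarly $I_{X'}(V)\subseteq K[P'(V)]$, and $K[P'(V)]$ is regarded as a subalgebra of $K[P(V)]$ via pullback along $\pi$, so that $K[P(V)]\cdot I_{X'}(V)$ is the ideal of $K[P(V)]$ generated by $I_{X'}(V)$. For $U\in\mathbf{Vec}$ the shift $\mathrm{Sh}_UP$ is the polynomial representation $(\mathrm{Sh}_UP)(W)=P(U\oplus W)$, $(\mathrm{Sh}_UP)(\phi)=P(\mathrm{id}_U\oplus\phi)$, and $(\mathrm{Sh}_UX)(W)=X(U\oplus W)$. The maps $P(\iota_W):P(W)\to P(U\oplus W)$, with $\iota_W:W\to U\oplus W$ the inclusion, embed $P$, and hence $R$, as a subobject of $\mathrm{Sh}_UP$; this is how $(\mathrm{Sh}_UP)/R$ is understood. For $h\in K[P(U)]$, view $h$ as a function on $P(U\oplus W)$ by pullback along $P(\mathrm{pr}_U):P(U\oplus W)\to P(U)$, with $\mathrm{pr}_U$ the projection onto $U$; then $(\mathrm{Sh}_UX)[1/h](W):=\{p\in X(U\oplus W): h(p)\ne0\}$. Injectivity is meant for every $W\in\mathbf{Vec}$. (The set $(\mathrm{Sh}_UX)[1/h](W)$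 is allowed to be empty.) *)

theory Defs
  imports
    "HOL-Algebra.Module"
    "HOL-Algebra.AbelCoset"
    "HOL-Algebra.Ideal"
    "HOL-Computational_Algebra.Primes"
begin

section \<open>Finite-dimensional vector spaces\<close>

text \<open>
  A vector space over a field \<open>K\<close> is a \<^locale>\<open>module\<close> over \<open>K\<close>. The record type of modules
  extends that of rings; the fields \<^const>\<open>monoid.mult\<close> and \<^const>\<open>one\<close> of a vector space
  carry no meaning, so a vector space may occur as several, canonically isomorphic, objects.
\<close>

definition lin_comb ::
    "('k, 'v) module \<Rightarrow> nat \<Rightarrow> (nat \<Rightarrow> 'v) \<Rightarrow> (nat \<Rightarrow> 'k) \<Rightarrow> 'v" where
  "lin_comb V n b t = (\<Oplus>\<^bsub>V\<^esub>i\<in>{..<n}. t i \<odot>\<^bsub>V\<^esub> b i)"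

definition is_basis ::
    "('k, 'm) ring_scheme \<Rightarrow> ('k, 'v) module \<Rightarrow> nat \<Rightarrow> (nat \<Rightarrow> 'v) \<Rightarrow> bool" where
  "is_basis K V n b \<longleftrightarrow>
     (\<forall>i<n. b i \<in> carrier V) \<and>
     bij_betw (lin_comb V n b) ({..<n} \<rightarrow>\<^sub>E carrier K) (carrier V)"

definition Vec :: "('k, 'm) ring_scheme \<Rightarrow> ('k, 'v) module set" where
  "Vec K = {V. module K V \<and> (\<exists>n b. is_basis K V n b)}"

definition Hom ::
    "('k, 'm) ring_scheme \<Rightarrow> ('k, 'v) module \<Rightarrow> ('k, 'w) module \<Rightarrow> ('v \<Rightarrow> 'w) set" where
  "Hom K V W = {\<phi> \<in> carrier V \<rightarrow>\<^sub>E carrier W.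
     (\<forall>x\<in>carrier V. \<forall>y\<in>carrier V. \<phi> (x \<oplus>\<^bsub>V\<^esub> y) = \<phi> x \<oplus>\<^bsub>W\<^esub> \<phi> y) \<and>
     (\<forall>a\<in>carrier K. \<forall>x\<in>carrier V. \<phi> (a \<odot>\<^bsub>V\<^esub> x) = a \<odot>\<^bsub>W\<^esub> \<phi> x)}"

definition hom_space ::
    "('k, 'm) ring_scheme \<Rightarrow> ('k, 'v) module \<Rightarrow> ('k, 'w) module \<Rightarrow> ('k, 'v \<Rightarrow> 'w) module" where
  "hom_space K V W =
     \<lparr> carrier = Hom K V W, monoid.mult = undefined, one = undefined,
       zero = (\<lambda>x\<in>carrier V. \<zero>\<^bsub>W\<^esub>),
       add = (\<lambda>\<phi> \<psi>. \<lambda>x\<in>carrier V. \<phi> x \<oplus>\<^bsub>W\<^esub> \<psi> x),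
       smult = (\<lambda>a \<phi>. \<lambda>x\<in>carrier V. a \<odot>\<^bsub>W\<^esub> \<phi> x) \<rparr>"

definition quot_proj :: "('k, 'v) module \<Rightarrow> 'v set \<Rightarrow> 'v \<Rightarrow> 'v set" where
  "quot_proj V N x = N +>\<^bsub>V\<^esub> x"

definition quot_space :: "('k, 'v) module \<Rightarrow> 'v set \<Rightarrow> ('k, 'v set) module" where
  "quot_space V N =
     \<lparr> carrier = a_rcosets\<^bsub>V\<^esub> N, monoid.mult = undefined, one = undefined,
       zero = N,
       add = (\<lambda>A B. A <+>\<^bsub>V\<^esub> B),
       smult = (\<lambda>a A. \<Union>x\<in>A. quot_proj V N (a \<odot>\<^bsub>V\<^esub> x)) \<rparr>"

text \<open>
  The objects of the category on which functors are defined are the finite-dimensional vector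
  spaces whose elements are drawn from the following type, for an arbitrary type of atoms.
  It is infinite, hence contains a copy of every finite set, and it is closed under pairing, so
  that direct sums of objects are again objects.
\<close>

datatype 'a elem = Atom 'a | Duo (lpart: "'a elem") (rpart: "'a elem")

definition dsum ::
    "('k, 'a elem) module \<Rightarrow> ('k, 'a elem) module \<Rightarrow> ('k, 'a elem) module" where
  "dsum U W =
     \<lparr> carrier = {Duo u w | u w. u \<in> carrier U \<and> w \<in> carrier W},
       monoid.mult = undefined, one = undefined,
       zero = Duo \<zero>\<^bsub>U\<^esub> \<zero>\<^bsub>W\<^esub>,
       add = (\<lambda>x y. Duo (lpart x \<oplus>\<^bsub>U\<^esub> lpart y) (rpart x \<oplus>\<^bsub>W\<^esub> rpart y)),
       smult = (\<lambda>a x. Duo (a \<odot>\<^bsub>U\<^esub> lpart x) (a \<odot>\<^bsub>W\<^esub> rpart x)) \<rparr>"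

definition dsum_map ::
    "('k, 'a elem) module \<Rightarrow> ('k, 'a elem) module \<Rightarrow> ('a elem \<Rightarrow> 'a elem) \<Rightarrow> 'a elem \<Rightarrow> 'a elem"
  where
  "dsum_map U W \<phi> = (\<lambda>x\<in>carrier (dsum U W). Duo (lpart x) (\<phi> (rpart x)))"

definition dsum_fst ::
    "('k, 'a elem) module \<Rightarrow> ('k, 'a elem) module \<Rightarrow> 'a elem \<Rightarrow> 'a elem" where
  "dsum_fst U W = (\<lambda>x\<in>carrier (dsum U W). lpart x)"

definition dsum_inr ::
    "('k, 'a elem) module \<Rightarrow> ('k, 'a elem) module \<Rightarrow> 'a elem \<Rightarrow> 'a elem" where
  "dsum_inr U W = (\<lambda>w\<in>carrier W. Duo \<zero>\<^bsub>U\<^esub> w)"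

section \<open>Functions on a vector space\<close>

definition fun_ring :: "('k, 'm) ring_scheme \<Rightarrow> ('k, 'v) module \<Rightarrow> ('v \<Rightarrow> 'k) ring" where
  "fun_ring K V =
     \<lparr> carrier = carrier V \<rightarrow>\<^sub>E carrier K,
       monoid.mult = (\<lambda>f g. \<lambda>x\<in>carrier V. f x \<otimes>\<^bsub>K\<^esub> g x),
       one = (\<lambda>x\<in>carrier V. \<one>\<^bsub>K\<^esub>),
       zero = (\<lambda>x\<in>carrier V. \<zero>\<^bsub>K\<^esub>),
       add = (\<lambda>f g. \<lambda>x\<in>carrier V. f x \<oplus>\<^bsub>K\<^esub> g x) \<rparr>"

text \<open>
  In the coordinates \<open>t\<close> with respect to some basis, the function is the sum of the monomials
  \<open>c a * t 0 ^ a 0 * \<dots> * t (n - 1) ^ a (n - 1)\<close> over finitely many exponent vectors \<open>a\<close> of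
  total degree at most \<open>e\<close>. For \<open>e = -1\<close> there are none, so only the zero function remains.
\<close>

definition fun_le ::
    "('k, 'm) ring_scheme \<Rightarrow> ('k, 'v) module \<Rightarrow> int \<Rightarrow> ('v \<Rightarrow> 'k) set" where
  "fun_le K V e = {f \<in> carrier (fun_ring K V).
     \<exists>n b A c. is_basis K V n b \<and>
       finite A \<and> (\<forall>a\<in>A. int (\<Sum>i<n. a i) \<le> e) \<and> c \<in> A \<rightarrow> carrier K \<and>
       (\<forall>t\<in>{..<n} \<rightarrow>\<^sub>E carrier K.
          f (lin_comb V n b t) =
            (\<Oplus>\<^bsub>K\<^esub>a\<in>A. c a \<otimes>\<^bsub>K\<^esub> (\<Otimes>\<^bsub>K\<^esub>i\<in>{..<n}. t i [^]\<^bsub>K\<^esub> (a i :: nat))))}"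

definition fun_degree ::
    "('k, 'm) ring_scheme \<Rightarrow> ('k, 'v) module \<Rightarrow> ('v \<Rightarrow> 'k) \<Rightarrow> int" where
  "fun_degree K V f = (LEAST e. -1 \<le> e \<and> f \<in> fun_le K V e)"

text \<open>The maps \<open>V \<rightarrow> W\<close> that lie in the tensor product of \<^term>\<open>fun_le K V e\<close> with \<open>W\<close>.\<close>

definition map_le ::
    "('k, 'm) ring_scheme \<Rightarrow> ('k, 'v) module \<Rightarrow> ('k, 'w) module \<Rightarrow> int \<Rightarrow> ('v \<Rightarrow> 'w) set" where
  "map_le K V W e = {F \<in> carrier V \<rightarrow> carrier W.
     \<exists>r f w. (\<forall>j<r. f j \<in> fun_le K V e \<and> w j \<in> carrier W) \<and>
       (\<forall>x\<in>carrier V. F x = (\<Oplus>\<^bsub>W\<^esub>j\<in>{..<r::nat}. f j x \<odot>\<^bsub>W\<^esub> w j))}"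

definition vanishing_ideal ::
    "('k, 'm) ring_scheme \<Rightarrow> ('k, 'v) module \<Rightarrow> 'v set \<Rightarrow> ('v \<Rightarrow> 'k) set" where
  "vanishing_ideal K V S = {f \<in> carrier (fun_ring K V). \<forall>x\<in>S. f x = \<zero>\<^bsub>K\<^esub>}"

section \<open>Polynomial representations\<close>

record ('k, 'a, 'b) rep =
  obj :: "('k, 'a elem) module \<Rightarrow> ('k, 'b) module"
  mor :: "('k, 'a elem) module \<Rightarrow> ('k, 'a elem) module \<Rightarrow> ('a elem \<Rightarrow> 'a elem) \<Rightarrow> 'b \<Rightarrow> 'b"

definition is_functor :: "('k, 'm) ring_scheme \<Rightarrow> ('k, 'a, 'b) rep \<Rightarrow> bool" where
  "is_functor K P \<longleftrightarrow>
     (\<forall>V\<in>Vec K. obj P V \<in> Vec K) \<and>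
     (\<forall>V\<in>Vec K. \<forall>W\<in>Vec K. \<forall>\<phi>\<in>Hom K V W. mor P V W \<phi> \<in> Hom K (obj P V) (obj P W)) \<and>
     (\<forall>V\<in>Vec K. mor P V V (\<lambda>x\<in>carrier V. x) = (\<lambda>p\<in>carrier (obj P V). p)) \<and>
     (\<forall>U\<in>Vec K. \<forall>V\<in>Vec K. \<forall>W\<in>Vec K. \<forall>\<phi>\<in>Hom K U V. \<forall>\<psi>\<in>Hom K V W.
        mor P U W (compose (carrier U) \<psi> \<phi>) =
          compose (carrier (obj P U)) (mor P V W \<psi>) (mor P U V \<phi>))"

definition rep_le :: "('k, 'm) ring_scheme \<Rightarrow> ('k, 'a, 'b) rep \<Rightarrow> int \<Rightarrow> bool" where
  "rep_le K P d \<longleftrightarrow>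
     (\<forall>U\<in>Vec K. \<forall>V\<in>Vec K.
        mor P U V \<in> map_le K (hom_space K U V) (hom_space K (obj P U) (obj P V)) d)"

definition poly_rep :: "('k, 'm) ring_scheme \<Rightarrow> ('k, 'a, 'b) rep \<Rightarrow> bool" where
  "poly_rep K P \<longleftrightarrow> is_functor K P \<and> (\<exists>d. rep_le K P d)"

definition rep_degree :: "('k, 'm) ring_scheme \<Rightarrow> ('k, 'a, 'b) rep \<Rightarrow> int" where
  "rep_degree K P = (LEAST d. -1 \<le> d \<and> rep_le K P d)"

text \<open>
  Subobjects and subsets of \<open>P\<close> are families of subsets of the spaces \<open>P(V)\<close>; their values at
  arguments outside \<^term>\<open>Vec K\<close> are irrelevant.
\<close>

type_synonym ('k, 'a, 'b) family = "('k, 'a elem) module \<Rightarrow> 'b set"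

definition is_subset ::
    "('k, 'm) ring_scheme \<Rightarrow> ('k, 'a, 'b) rep \<Rightarrow> ('k, 'a, 'b) family \<Rightarrow> bool" where
  "is_subset K P X \<longleftrightarrow>
     (\<forall>V\<in>Vec K. X V \<subseteq> carrier (obj P V)) \<and>
     (\<forall>V\<in>Vec K. \<forall>W\<in>Vec K. \<forall>\<phi>\<in>Hom K V W. mor P V W \<phi> ` X V \<subseteq> X W)"

definition is_subrep ::
    "('k, 'm) ring_scheme \<Rightarrow> ('k, 'a, 'b) rep \<Rightarrow> ('k, 'a, 'b) family \<Rightarrow> bool" where
  "is_subrep K P Q \<longleftrightarrow> is_subset K P Q \<and> (\<forall>V\<in>Vec K. submodule (Q V) K (obj P V))"

definition sub_rep ::
    "('k, 'a, 'b) rep \<Rightarrow> ('k, 'a, 'b) family \<Rightarrow> ('k, 'a, 'b) rep" where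
  "sub_rep P Q =
     \<lparr> obj = (\<lambda>V. (obj P V)\<lparr>carrier := Q V\<rparr>),
       mor = (\<lambda>V W \<phi>. restrict (mor P V W \<phi>) (Q V)) \<rparr>"

text \<open>A coset in \<open>P(V)/Q(V)\<close> is sent to the coset containing the image of its elements.\<close>

definition quot_rep ::
    "('k, 'a, 'b) rep \<Rightarrow> ('k, 'a, 'b) family \<Rightarrow> ('k, 'a, 'b set) rep" where
  "quot_rep P Q =
     \<lparr> obj = (\<lambda>V. quot_space (obj P V) (Q V)),
       mor = (\<lambda>V W \<phi>. \<lambda>A\<in>carrier (quot_space (obj P V) (Q V)).
                \<Union>p\<in>A. quot_proj (obj P W) (Q W) (mor P V W \<phi> p)) \<rparr>"

definition irreducible_rep :: "('k, 'm) ring_scheme \<Rightarrow> ('k, 'a, 'b) rep \<Rightarrow> bool" where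
  "irreducible_rep K P \<longleftrightarrow>
     \<not> (\<forall>V\<in>Vec K. carrier (obj P V) = {\<zero>\<^bsub>obj P V\<^esub>}) \<and>
     (\<forall>Q. is_subrep K P Q \<longrightarrow>
        (\<forall>V\<in>Vec K. Q V = {\<zero>\<^bsub>obj P V\<^esub>}) \<or> (\<forall>V\<in>Vec K. Q V = carrier (obj P V)))"

text \<open>
  \<open>Q\<close> is \<open>P\<^bsub>>e\<^esub>\<close>: inclusionwise minimal among the subobjects with quotient of degree at most
  \<open>e\<close>. Uniqueness of such a \<open>Q\<close> is a fact about polynomial representations and not part of
  the definition.
\<close>

definition is_gt_part ::
    "('k, 'm) ring_scheme \<Rightarrow> ('k, 'a, 'b) rep \<Rightarrow> int \<Rightarrow> ('k, 'a, 'b) family \<Rightarrow> bool" where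
  "is_gt_part K P e Q \<longleftrightarrow>
     is_subrep K P Q \<and> rep_degree K (quot_rep P Q) \<le> e \<and>
     (\<forall>Q'. is_subrep K P Q' \<and> rep_degree K (quot_rep P Q') \<le> e \<and> (\<forall>V\<in>Vec K. Q' V \<subseteq> Q V)
        \<longrightarrow> (\<forall>V\<in>Vec K. Q' V = Q V))"

definition quot_family ::
    "('k, 'a, 'b) rep \<Rightarrow> ('k, 'a, 'b) family \<Rightarrow> ('k, 'a, 'b) family \<Rightarrow> ('k, 'a, 'b set) family"
  where
  "quot_family P R X V = quot_proj (obj P V) (R V) ` X V"

text \<open>The ideal of \<open>K[P(V)]\<close> generated by the pullbacks of the functions vanishing on \<open>X'(V)\<close>.\<close>

definition pulled_back_ideal ::
    "('k, 'm) ring_scheme \<Rightarrow> ('k, 'a, 'b) rep \<Rightarrow> ('k, 'a, 'b) family \<Rightarrow> ('k, 'a, 'b set) family \<Rightarrow>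
     ('k, 'a elem) module \<Rightarrow> ('b \<Rightarrow> 'k) set" where
  "pulled_back_ideal K P R X' V =
     Idl\<^bsub>fun_ring K (obj P V)\<^esub>
       ((\<lambda>g. \<lambda>p\<in>carrier (obj P V). g (quot_proj (obj P V) (R V) p)) `
          vanishing_ideal K (obj (quot_rep P R) V) (X' V))"

section \<open>Shifts\<close>

definition shift_rep ::
    "('k, 'a elem) module \<Rightarrow> ('k, 'a, 'b) rep \<Rightarrow> ('k, 'a, 'b) rep" where
  "shift_rep U P =
     \<lparr> obj = (\<lambda>W. obj P (dsum U W)),
       mor = (\<lambda>W W' \<phi>. mor P (dsum U W) (dsum U W') (dsum_map U W \<phi>)) \<rparr>"

definition shift_family ::
    "('k, 'a elem) module \<Rightarrow> ('k, 'a, 'b) family \<Rightarrow> ('k, 'a, 'b) family" where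
  "shift_family U X W = X (dsum U W)"

definition shift_embed ::
    "('k, 'a elem) module \<Rightarrow> ('k, 'a, 'b) rep \<Rightarrow> ('k, 'a, 'b) family \<Rightarrow> ('k, 'a, 'b) family" where
  "shift_embed U P R W = mor P W (dsum U W) (dsum_inr U W) ` R W"

definition localized_family ::
    "('k, 'm) ring_scheme \<Rightarrow> ('k, 'a elem) module \<Rightarrow> ('k, 'a, 'b) rep \<Rightarrow> ('b \<Rightarrow> 'k) \<Rightarrow>
     ('k, 'a, 'b) family \<Rightarrow> ('k, 'a, 'b) family" where
  "localized_family K U P h X W =
     {p \<in> shift_family U X W. h (mor P (dsum U W) U (dsum_fst U W) p) \<noteq> \<zero>\<^bsub>K\<^esub>}"

end

theory Submission
imports Defs
begin

text \<open>
  Replacing \<open>f(y)\<close> by \<open>f(y + s) - f(y)\<close> lowers the degree of a polynomial function. Some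
  \<open>q \<in> X(V)\<close> and \<open>s \<in> R(V)\<close> satisfy \<open>f(q) = 0 \<noteq> f(q + s)\<close>, because a function vanishing on
  \<open>\<pi>\<inverse>(X'(V))\<close> lies in the ideal generated by \<open>I\<^sub>X\<^sub>'(V)\<close>. Put \<open>f\<^sub>s(y) = f(y + s) - f(y)\<close>, of smaller
  degree than \<open>f\<close>, and let \<open>k\<close> be maximal such that for some \<open>U\<close>, \<open>x \<in> X(U)\<close> and \<open>s \<in> R(V)\<close> a
  \<open>k\<close>-fold difference of \<open>\<phi> \<mapsto> f\<^sub>s(P(\<phi>)x)\<close> on \<open>Hom(U, V)\<close> is nonzero; it exists because \<open>P\<close> and \<open>f\<close>
  are polynomial. That difference, as a function of \<open>x\<close>, is \<open>h = h\<^sub>s\<close>.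

  Let \<open>p\<close> and \<open>p' = p + r\<close> be points of \<open>X(U \<oplus> W)\<close> with \<open>r \<in> R(W)\<close>, and let \<open>z\<close> be the component of
  \<open>p\<close> in \<open>P(U)\<close>. Here \<open>z\<close> is also the component of \<open>p'\<close>, because \<open>P(0)\<close> kills \<open>P\<^sub>>\<^sub>d\<^sub>-\<^sub>1\<close>, hence \<open>R\<close>. By maximality of
  \<open>k\<close> the \<open>k\<close>-fold differences for \<open>p\<close> and \<open>p'\<close> do not depend on the base point, so \<open>h\<^sub>s(z)\<close> may be
  computed at \<open>(\<phi>, \<psi>)\<close> for any \<open>\<psi> : W \<rightarrow> V\<close>, from \<open>p\<close> or from \<open>p'\<close>. As \<open>f\<close> vanishes on \<open>X\<close>,
  comparing the two gives \<open>h\<^sub>t(z) = h\<^sub>t\<^sub>'(z)\<close> for \<open>t' = t + P(\<psi>)r\<close>. If \<open>r \<noteq> 0\<close>, the elements \<open>P(\<psi>)r\<close>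
  additively generate \<open>R(V)\<close> (irreducibility and primality of the field), hence
  \<open>h\<^sub>s(z) = h\<^sub>0(z) = 0\<close>.
\<close>

section \<open>Linear maps and polynomial functions\<close>

text \<open>Differences replace derivatives because K[V] consists of functions: over a field with q
  elements x^q and x are the same function, so a formal derivative is not defined on K[V], whereas a
  difference is and still lowers the degree. The obstacle is that passing from p to p' changes a
  point of P(U \<oplus> W), while h may look only at its component in P(U). Differencing in \<phi>
  removes the rest: after k steps the expression no longer notices which \<psi> accompanies \<phi>,
  and \<psi> = 0 gives h. For this, k must be maximal over all U, x and s at once, since maximality
  is applied to U \<oplus> W, to p and p', and to every translation in R(V). The maximum exists
  because the degree in \<phi> is bounded independently of U, x and s. In the comparison P(\<psi>)r
  passes from the point into the translation: f(P(\<phi>,\<psi>)p' + t) = f(P(\<phi>,\<psi>)p + t').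
  The translations found to leave h unchanged are closed under addition, but scalar multiples are
  not evident: on a homogeneous P of degree d, P(c\<psi>)r is c^d P(\<psi>)r, and the powers c^d
  need not generate a larger field additively. In a prime field every scalar is a multiple of
  1.\<close>

definition linear_map ::
    "('k, 'm) ring_scheme \<Rightarrow> ('k, 'v) module \<Rightarrow> ('k, 'w) module \<Rightarrow> ('v \<Rightarrow> 'w) \<Rightarrow> bool" where
  "linear_map K V W T \<longleftrightarrow>
     (\<forall>x\<in>carrier V. T x \<in> carrier W) \<and>
     (\<forall>x\<in>carrier V. \<forall>y\<in>carrier V. T (x \<oplus>\<^bsub>V\<^esub> y) = T x \<oplus>\<^bsub>W\<^esub> T y) \<and>
     (\<forall>a\<in>carrier K. \<forall>x\<in>carrier V. T (a \<odot>\<^bsub>V\<^esub> x) = a \<odot>\<^bsub>W\<^esub> T x)"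

text \<open>Separate from \<open>linear_map\<close> because \<open>K\<close> is a ring record and
  not a module over itself. Unlike \<open>Hom\<close>, both predicates leave the values outside the
  carrier free, so composites and pointwise expressions qualify without
  \<open>restrict\<close>.\<close>

definition linear_form ::
    "('k, 'm) ring_scheme \<Rightarrow> ('k, 'v) module \<Rightarrow> ('v \<Rightarrow> 'k) \<Rightarrow> bool" where
  "linear_form K V l \<longleftrightarrow>
     (\<forall>x\<in>carrier V. l x \<in> carrier K) \<and>
     (\<forall>x\<in>carrier V. \<forall>y\<in>carrier V. l (x \<oplus>\<^bsub>V\<^esub> y) = l x \<oplus>\<^bsub>K\<^esub> l y) \<and>
     (\<forall>a\<in>carrier K. \<forall>x\<in>carrier V. l (a \<odot>\<^bsub>V\<^esub> x) = a \<otimes>\<^bsub>K\<^esub> l x)"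

text \<open>Degree less than \<open>n\<close>: on extensional functions this is \<^term>\<open>fun_le K V (int n - 1)\<close>.\<close>

inductive poly_lt ::
    "('k, 'm) ring_scheme \<Rightarrow> ('k, 'v) module \<Rightarrow> nat \<Rightarrow> ('v \<Rightarrow> 'k) \<Rightarrow> bool" for K V where
  zero: "(\<And>x. x \<in> carrier V \<Longrightarrow> g x = \<zero>\<^bsub>K\<^esub>) \<Longrightarrow> poly_lt K V n g"
| const: "c \<in> carrier K \<Longrightarrow> (\<And>x. x \<in> carrier V \<Longrightarrow> g x = c) \<Longrightarrow> poly_lt K V (Suc n) g"
| add: "poly_lt K V n f \<Longrightarrow> poly_lt K V n g \<Longrightarrow>
    (\<And>x. x \<in> carrier V \<Longrightarrow> h x = f x \<oplus>\<^bsub>K\<^esub> g x) \<Longrightarrow> poly_lt K V n h"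
| mult: "poly_lt K V n f \<Longrightarrow> linear_form K V l \<Longrightarrow>
    (\<And>x. x \<in> carrier V \<Longrightarrow> h x = f x \<otimes>\<^bsub>K\<^esub> l x) \<Longrightarrow> poly_lt K V (Suc n) h"

lemma Hom_linear_map: "\<phi> \<in> Hom K V W \<Longrightarrow> linear_map K V W \<phi>"
  by (auto simp: Hom_def linear_map_def)

lemma restrict_in_Hom:
  assumes "module K V" "linear_map K V W T"
  shows "restrict T (carrier V) \<in> Hom K V W"
proof -
  interpret V: module K V by fact
  show ?thesis using assms(2) by (auto simp: Hom_def linear_map_def)
qed

lemma linear_map_closed: "linear_map K V W T \<Longrightarrow> x \<in> carrier V \<Longrightarrow> T x \<in> carrier W"
  by (simp add: linear_map_def)

lemma linear_map_add:
  "linear_map K V W T \<Longrightarrow> x \<in> carrier V \<Longrightarrow> y \<in> carrier V \<Longrightarrow> T (x \<oplus>\<^bsub>V\<^esub> y) = T x \<oplus>\<^bsub>W\<^esub> T y"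
  by (simp add: linear_map_def)

lemma linear_map_smult:
  "linear_map K V W T \<Longrightarrow> a \<in> carrier K \<Longrightarrow> x \<in> carrier V \<Longrightarrow> T (a \<odot>\<^bsub>V\<^esub> x) = a \<odot>\<^bsub>W\<^esub> T x"
  by (simp add: linear_map_def)

lemma linear_map_zero:
  assumes "module K V" "module K W" "linear_map K V W T"
  shows "T \<zero>\<^bsub>V\<^esub> = \<zero>\<^bsub>W\<^esub>"
proof -
  interpret V: module K V by fact
  interpret W: module K W by fact
  have "T \<zero>\<^bsub>V\<^esub> = T (\<zero>\<^bsub>K\<^esub> \<odot>\<^bsub>V\<^esub> \<zero>\<^bsub>V\<^esub>)" by simp
  also have "\<dots> = \<zero>\<^bsub>K\<^esub> \<odot>\<^bsub>W\<^esub> T \<zero>\<^bsub>V\<^esub>"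
    using assms(3) by (simp add: linear_map_smult del: V.smult_l_null V.smult_r_null)
  finally show ?thesis using linear_map_closed[OF assms(3), of "\<zero>\<^bsub>V\<^esub>"] by simp
qed

lemma linear_map_neg:
  assumes "module K V" "module K W" "linear_map K V W T" "x \<in> carrier V"
  shows "T (\<ominus>\<^bsub>V\<^esub> x) = \<ominus>\<^bsub>W\<^esub> T x"
proof -
  interpret V: module K V by fact
  interpret W: module K W by fact
  have "T (\<ominus>\<^bsub>V\<^esub> x) \<oplus>\<^bsub>W\<^esub> T x = \<zero>\<^bsub>W\<^esub>"
    using assms by (simp add: linear_map_add[symmetric] V.l_neg linear_map_zero)
  then show ?thesis using assms linear_map_closed[OF assms(3)]
    by (metis V.add.inv_closed W.minus_equality)
qed

lemma linear_map_diff: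
  assumes "module K V" "module K W" "linear_map K V W T" "x \<in> carrier V" "y \<in> carrier V"
  shows "T (x \<ominus>\<^bsub>V\<^esub> y) = T x \<ominus>\<^bsub>W\<^esub> T y"
proof -
  interpret V: module K V by fact
  interpret W: module K W by fact
  show ?thesis
    using assms by (simp add: V.minus_eq W.minus_eq linear_map_add linear_map_neg)
qed

lemma linear_map_finsum:
  assumes "module K V" "module K W" "linear_map K V W T" "finite A" "g \<in> A \<rightarrow> carrier V"
  shows "T (\<Oplus>\<^bsub>V\<^esub>i\<in>A. g i) = (\<Oplus>\<^bsub>W\<^esub>i\<in>A. T (g i))"
proof -
  interpret V: module K V by fact
  interpret W: module K W by fact
  show ?thesis using assms(4,5)
  proof (induction A)
    case empty then show ?case using assms by (simp add: linear_map_zero)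
  next
    case (insert a A)
    then have "(\<lambda>i. T (g i)) \<in> A \<rightarrow> carrier W" "T (g a) \<in> carrier W" "g \<in> A \<rightarrow> carrier V" "g a \<in> carrier V"
      using assms(3) by (auto simp: linear_map_def)
    then show ?case using insert assms
      by (simp add: linear_map_add)
  qed
qed

lemma linear_form_closed: "linear_form K V l \<Longrightarrow> x \<in> carrier V \<Longrightarrow> l x \<in> carrier K"
  by (simp add: linear_form_def)

lemma linear_form_add:
  "linear_form K V l \<Longrightarrow> x \<in> carrier V \<Longrightarrow> y \<in> carrier V \<Longrightarrow> l (x \<oplus>\<^bsub>V\<^esub> y) = l x \<oplus>\<^bsub>K\<^esub> l y"
  by (simp add: linear_form_def)

lemma linear_form_smult:
  "linear_form K V l \<Longrightarrow> a \<in> carrier K \<Longrightarrow> x \<in> carrier V \<Longrightarrow> l (a \<odot>\<^bsub>V\<^esub> x) = a \<otimes>\<^bsub>K\<^esub> l x"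
  by (simp add: linear_form_def)

lemma linear_form_comp:
  "linear_map K V W T \<Longrightarrow> linear_form K W l \<Longrightarrow> linear_form K V (\<lambda>x. l (T x))"
  by (simp add: linear_form_def linear_map_def)

lemma linear_form_zero:
  assumes "module K V" "linear_form K V l"
  shows "l \<zero>\<^bsub>V\<^esub> = \<zero>\<^bsub>K\<^esub>"
proof -
  interpret V: module K V by fact
  have "l \<zero>\<^bsub>V\<^esub> = l (\<zero>\<^bsub>K\<^esub> \<odot>\<^bsub>V\<^esub> \<zero>\<^bsub>V\<^esub>)" by simp
  also have "\<dots> = \<zero>\<^bsub>K\<^esub> \<otimes>\<^bsub>K\<^esub> l \<zero>\<^bsub>V\<^esub>"
    using assms(2) by (simp add: linear_form_smult del: V.smult_l_null V.smult_r_null)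
  finally show ?thesis using linear_form_closed[OF assms(2), of "\<zero>\<^bsub>V\<^esub>"] by simp
qed

lemma linear_form_finsum:
  assumes "module K V" "linear_form K V l" "finite A" "g \<in> A \<rightarrow> carrier V"
  shows "l (\<Oplus>\<^bsub>V\<^esub>i\<in>A. g i) = (\<Oplus>\<^bsub>K\<^esub>i\<in>A. l (g i))"
proof -
  interpret V: module K V by fact
  show ?thesis using assms(3,4)
  proof (induction A)
    case empty then show ?case using assms by (simp add: linear_form_zero)
  next
    case (insert a A)
    then have "(\<lambda>i. l (g i)) \<in> A \<rightarrow> carrier K" "l (g a) \<in> carrier K" "g \<in> A \<rightarrow> carrier V" "g a \<in> carrier V"
      using assms(2) by (auto simp: linear_form_def)
    then show ?case using insert assms
      by (simp add: linear_form_add)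
  qed
qed

section \<open>Polynomial functions under algebraic operations, translation and composition\<close>

lemma poly_lt_closed:
  assumes "module K V" "poly_lt K V n f" "x \<in> carrier V"
  shows "f x \<in> carrier K"
proof -
  interpret V: module K V by fact
  show ?thesis using assms(2,3)
    by (induction) (auto dest: linear_form_closed)
qed

lemma poly_lt_0: 
  assumes "module K V" "poly_lt K V 0 f" "x \<in> carrier V"
  shows "f x = \<zero>\<^bsub>K\<^esub>"
proof -
  interpret V: module K V by fact
  have "n = 0 \<Longrightarrow> x \<in> carrier V \<Longrightarrow> f x = \<zero>\<^bsub>K\<^esub>" if "poly_lt K V n f" for n f
    using that by induction auto
  then show ?thesis using assms by blast
qed

lemma poly_lt_cong:
  assumes "poly_lt K V n f" "\<And>x. x \<in> carrier V \<Longrightarrow> g x = f x"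
  shows "poly_lt K V n g"
  using assms
proof induction
  case (zero h n) then show ?case by (intro poly_lt.zero) simp
next
  case (const c h n) then show ?case by (intro poly_lt.const[of c]) simp_all
next
  case (add n f f' h) then show ?case by - (rule poly_lt.add[of K V n f f'], simp_all)
next
  case (mult n f l h) then show ?case by - (rule poly_lt.mult[of K V n f l], simp_all)
qed

lemma poly_lt_mono:
  assumes "poly_lt K V n f" "n \<le> m"
  shows "poly_lt K V m f"
  using assms
proof (induction arbitrary: m)
  case (zero g n) then show ?case by (intro poly_lt.zero) simp
next
  case (const c g n) then show ?case by (cases m) (auto intro: poly_lt.const)
next
  case (add n f g h) then show ?case by - (rule poly_lt.add[of K V m f g], simp_all)
next
  case (mult n f l h) then show ?case by (cases m) (auto intro: poly_lt.mult[of K V _ f l])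
qed

lemma poly_lt_comp_linear:
  assumes "poly_lt K W n f" "linear_map K V W T"
  shows "poly_lt K V n (\<lambda>x. f (T x))"
  using assms(1)
proof induction
  case (zero g n) then show ?case by (intro poly_lt.zero) (use assms(2) in \<open>auto simp: linear_map_def\<close>)
next
  case (const c g n) then show ?case
    by (intro poly_lt.const[of c]) (use assms(2) in \<open>auto simp: linear_map_def\<close>)
next
  case (add n f g h)
  show ?case by (rule poly_lt.add[OF add.IH]) (use assms(2) add in \<open>auto simp: linear_map_def\<close>)
next
  case (mult n f l h)
  show ?case
    by (rule poly_lt.mult[OF mult.IH linear_form_comp[OF assms(2) mult.hyps(2)]])
      (use assms(2) mult in \<open>auto simp: linear_map_def\<close>)
qed

lemma poly_lt_smult:
  assumes "module K V" "poly_lt K V n f" "c \<in> carrier K"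
  shows "poly_lt K V n (\<lambda>x. c \<otimes>\<^bsub>K\<^esub> f x)"
proof -
  interpret V: module K V by fact
  show ?thesis using assms(2)
  proof induction
    case (zero g n) then show ?case by (intro poly_lt.zero) (use assms(3) in auto)
  next
    case (const d g n)
    then show ?case by (intro poly_lt.const[of "c \<otimes>\<^bsub>K\<^esub> d"]) (use assms(3) in auto)
  next
    case (add n f g h)
    show ?case by (rule poly_lt.add[OF add.IH])
       (use assms(3) add poly_lt_closed[OF assms(1) add.hyps(1)] poly_lt_closed[OF assms(1) add.hyps(2)] in \<open>auto simp: V.R.r_distr\<close>)
  next
    case (mult n f l h)
    show ?case by (rule poly_lt.mult[OF mult.IH mult.hyps(2)])
       (use assms(3) mult.hyps(3) poly_lt_closed[OF assms(1) mult.hyps(1)] linear_form_closed[OF mult.hyps(2)] in \<open>auto simp: V.R.m_assoc\<close>)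
  qed
qed

lemma poly_lt_minus:
  assumes "module K V" "poly_lt K V n f" "poly_lt K V n g"
  shows "poly_lt K V n (\<lambda>x. f x \<ominus>\<^bsub>K\<^esub> g x)"
proof -
  interpret V: module K V by fact
  have "poly_lt K V n (\<lambda>x. (\<ominus>\<^bsub>K\<^esub> \<one>\<^bsub>K\<^esub>) \<otimes>\<^bsub>K\<^esub> g x)"
    using assms by (intro poly_lt_smult) auto
  from poly_lt.add[OF assms(2) this] show ?thesis
    by (rule poly_lt_cong)
      (use poly_lt_closed[OF assms(1,2)] poly_lt_closed[OF assms(1,3)] in
        \<open>auto simp: V.R.minus_eq V.R.l_minus\<close>)
qed

lemma poly_lt_shift:
  assumes "module K V" "poly_lt K V n f" "s \<in> carrier V"
  shows "poly_lt K V n (\<lambda>x. f (x \<oplus>\<^bsub>V\<^esub> s))"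
proof -
  interpret V: module K V by fact
  show ?thesis using assms(2)
  proof induction
    case (zero g n) then show ?case by (intro poly_lt.zero) (use assms(3) in auto)
  next
    case (const d g n)
    then show ?case by (intro poly_lt.const[of d]) (use assms(3) in auto)
  next
    case (add n f g h)
    show ?case by (rule poly_lt.add[OF add.IH]) (use assms(3) add in auto)
  next
    case (mult n f l h)
    have ls: "l s \<in> carrier K" by (rule linear_form_closed[OF mult.hyps(2) assms(3)])
    have 1: "poly_lt K V (Suc n) (\<lambda>x. f (x \<oplus>\<^bsub>V\<^esub> s) \<otimes>\<^bsub>K\<^esub> l x)"
      by (rule poly_lt.mult[OF mult.IH mult.hyps(2)]) simp
    have 2: "poly_lt K V (Suc n) (\<lambda>x. l s \<otimes>\<^bsub>K\<^esub> f (x \<oplus>\<^bsub>V\<^esub> s))"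
      by (rule poly_lt_mono[OF poly_lt_smult[OF assms(1) mult.IH ls]]) simp
    show ?case
      by (rule poly_lt.add[OF 1 2])
        (use mult.hyps(3) assms(3) ls poly_lt_closed[OF assms(1) mult.IH]
          linear_form_closed[OF mult.hyps(2)] in
          \<open>auto simp: linear_form_add[OF mult.hyps(2)] V.R.r_distr V.R.m_comm\<close>)
  qed
qed

text \<open>Discrete Leibniz rule: f(x + s) l(x + s) - f(x) l(x) = (f(x + s) - f(x)) l(x) + l(s) f(x
  + s), and both summands have lost a degree.\<close>

lemma poly_lt_diff:
  assumes "module K V" "poly_lt K V n f" "s \<in> carrier V"
  shows "poly_lt K V (n - 1) (\<lambda>x. f (x \<oplus>\<^bsub>V\<^esub> s) \<ominus>\<^bsub>K\<^esub> f x)"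
proof -
  interpret V: module K V by fact
  show ?thesis using assms(2)
  proof induction
    case (zero g n) then show ?case
      by (intro poly_lt.zero) (use assms(3) in \<open>auto simp: V.R.minus_eq\<close>)
  next
    case (const d g n)
    then show ?case by (intro poly_lt.zero) (use assms(3) in \<open>auto simp: V.R.minus_eq V.R.r_neg\<close>)
  next
    case (add n f g h)
    show ?case
    proof (rule poly_lt.add[OF add.IH])
      fix x assume x: "x \<in> carrier V"
      have "f x \<in> carrier K" "g x \<in> carrier K" "f (x \<oplus>\<^bsub>V\<^esub> s) \<in> carrier K" "g (x \<oplus>\<^bsub>V\<^esub> s) \<in> carrier K"
        using poly_lt_closed[OF assms(1) add.hyps(1)] poly_lt_closed[OF assms(1) add.hyps(2)] x assms(3) by auto
      then show "h (x \<oplus>\<^bsub>V\<^esub> s) \<ominus>\<^bsub>K\<^esub> h x =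
         f (x \<oplus>\<^bsub>V\<^esub> s) \<ominus>\<^bsub>K\<^esub> f x \<oplus>\<^bsub>K\<^esub> (g (x \<oplus>\<^bsub>V\<^esub> s) \<ominus>\<^bsub>K\<^esub> g x)"
        using x assms(3) add.hyps(3) by (simp) algebra
    qed
  next
    case (mult n f l h)
    have ls: "l s \<in> carrier K" by (rule linear_form_closed[OF mult.hyps(2) assms(3)])
    show ?case
    proof (cases n)
      \<comment> \<open>Truncated subtraction: the induction hypothesis gives index 0 for the
        difference of \<open>f\<close>, and multiplication by \<open>l\<close> would raise it to 1,
        whereas 0 is required. Here \<open>f\<close> is zero outright.\<close>
      case 0
      then have "f x = \<zero>\<^bsub>K\<^esub>" if "x \<in> carrier V" for x 
        using mult.hyps poly_lt_0[OF assms(1)] that by auto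
      then show ?thesis using mult.hyps assms(3)
        by (intro poly_lt.zero) (auto simp: linear_form_closed[OF mult.hyps(2)] V.R.minus_eq)
    next
      case (Suc m)
      have 1: "poly_lt K V n (\<lambda>x. (f (x \<oplus>\<^bsub>V\<^esub> s) \<ominus>\<^bsub>K\<^esub> f x) \<otimes>\<^bsub>K\<^esub> l x)"
        using mult.IH Suc by (auto intro: poly_lt.mult[OF _ mult.hyps(2)])
      have 2: "poly_lt K V n (\<lambda>x. l s \<otimes>\<^bsub>K\<^esub> f (x \<oplus>\<^bsub>V\<^esub> s))"
        by (rule poly_lt_smult[OF assms(1) poly_lt_shift[OF assms(1) mult.hyps(1) assms(3)] ls])
      show ?thesis
      proof (simp, rule poly_lt.add[OF 1 2])
        fix x assume x: "x \<in> carrier V"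
        have "f x \<in> carrier K" "l x \<in> carrier K" "f (x \<oplus>\<^bsub>V\<^esub> s) \<in> carrier K"
          using poly_lt_closed[OF assms(1) mult.hyps(1)] x assms(3) linear_form_closed[OF mult.hyps(2)] by auto
        then show "h (x \<oplus>\<^bsub>V\<^esub> s) \<ominus>\<^bsub>K\<^esub> h x =
           (f (x \<oplus>\<^bsub>V\<^esub> s) \<ominus>\<^bsub>K\<^esub> f x) \<otimes>\<^bsub>K\<^esub> l x \<oplus>\<^bsub>K\<^esub> l s \<otimes>\<^bsub>K\<^esub> f (x \<oplus>\<^bsub>V\<^esub> s)"
          using x assms(3) mult.hyps(3) ls by (simp add: linear_form_add[OF mult.hyps(2)]) algebra
      qed
    qed
  qed
qed

text \<open>One bound is strict and the other, \<open>Suc m\<close>, means degree at most m; the sum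
  n + m is then again a strict bound, also for n = 0.\<close>

lemma poly_lt_prod:
  assumes "module K V" "poly_lt K V n f" "poly_lt K V (Suc m) g"
  shows "poly_lt K V (n + m) (\<lambda>x. f x \<otimes>\<^bsub>K\<^esub> g x)"
proof -
  interpret V: module K V by fact
  note cl = poly_lt_closed[OF assms(1)]
  show ?thesis using assms(2)
  proof induction
    case (zero f n) then show ?case
      by (intro poly_lt.zero) (use assms(3) cl[OF assms(3)] in auto)
  next
    case (const d f n)
    have "poly_lt K V (Suc m) (\<lambda>x. d \<otimes>\<^bsub>K\<^esub> g x)" by (rule poly_lt_smult) fact+
    then have "poly_lt K V (Suc n + m) (\<lambda>x. d \<otimes>\<^bsub>K\<^esub> g x)" by (rule poly_lt_mono) simp
    then show ?case by (rule poly_lt_cong) (use const in simp)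
  next
    case (add n f f' h)
    show ?case by (rule poly_lt.add[OF add.IH])
       (use assms(3) add.hyps(3) cl[OF assms(3)] cl[OF add.hyps(1)] cl[OF add.hyps(2)] in \<open>auto simp: V.R.l_distr\<close>)
  next
    case (mult n f l h)
    show ?case unfolding add_Suc
    proof (rule poly_lt.mult[OF mult.IH mult.hyps(2)])
      fix x assume x: "x \<in> carrier V"
      have "f x \<in> carrier K" "l x \<in> carrier K" "g x \<in> carrier K"
        using x cl[OF assms(3)] cl[OF mult.hyps(1)] linear_form_closed[OF mult.hyps(2)] by auto
      then show "h x \<otimes>\<^bsub>K\<^esub> g x = f x \<otimes>\<^bsub>K\<^esub> g x \<otimes>\<^bsub>K\<^esub> l x"
        using mult.hyps x by (simp add: V.R.m_ac)
    qed
  qed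
qed

text \<open>A polynomial map is described without coordinates, by asking for a degree bound on
  \<open>l\<close> composed with \<open>T\<close> for every linear form \<open>l\<close>. The
  product bound is crude, but it depends on \<open>n\<close> and \<open>d\<close> only.\<close>

lemma poly_lt_comp:
  assumes "module K V" "module K W" "poly_lt K W n f"
    and "\<And>x. x \<in> carrier V \<Longrightarrow> T x \<in> carrier W"
    and "\<And>l. linear_form K W l \<Longrightarrow> poly_lt K V (Suc d) (\<lambda>x. l (T x))"
  shows "poly_lt K V (n * Suc d) (\<lambda>x. f (T x))"
proof -
  interpret V: module K V by fact
  show ?thesis using assms(3)
  proof induction
    case (zero f n) then show ?case
      by (intro poly_lt.zero) (use assms(4) in auto)
  next
    case (const c f n)
    then show ?case unfolding mult_Suc add_Suc by (intro poly_lt.const[of c]) (use assms(4) in auto)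
  next
    case (add n f f' h)
    show ?case by (rule poly_lt.add[OF add.IH]) (use assms(4) add in auto)
  next
    case (mult n f l h)
    have "poly_lt K V (n * Suc d + d) (\<lambda>x. f (T x) \<otimes>\<^bsub>K\<^esub> l (T x))"
      by (rule poly_lt_prod[OF assms(1) mult.IH assms(5)[OF mult.hyps(2)]])
    then have "poly_lt K V (Suc n * Suc d) (\<lambda>x. f (T x) \<otimes>\<^bsub>K\<^esub> l (T x))"
      by (rule poly_lt_mono) simp
    then show ?case by (rule poly_lt_cong) (use mult assms(4) in auto)
  qed
qed

lemma poly_lt_sum:
  assumes "module K V" "finite A" "\<And>a. a \<in> A \<Longrightarrow> poly_lt K V n (g a)"
  shows "poly_lt K V n (\<lambda>x. \<Oplus>\<^bsub>K\<^esub>a\<in>A. g a x)"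
proof -
  interpret V: module K V by fact
  show ?thesis using assms(2,3)
  proof (induction A)
    case empty then show ?case by (intro poly_lt.zero) simp
  next
    case (insert a A)
    have 1: "poly_lt K V n (g a)" "poly_lt K V n (\<lambda>x. \<Oplus>\<^bsub>K\<^esub>a\<in>A. g a x)" using insert by auto
    show ?case
      by (rule poly_lt.add[OF 1])
        (use insert.hyps poly_lt_closed[OF assms(1) insert.prems] in \<open>auto intro!: V.R.finsum_insert\<close>)
  qed
qed

lemma poly_lt_finprod:
  assumes "module K V" "finite A" "\<And>a. a \<in> A \<Longrightarrow> poly_lt K V (Suc (d a)) (g a)"
  shows "poly_lt K V (Suc (\<Sum>a\<in>A. d a)) (\<lambda>x. \<Otimes>\<^bsub>K\<^esub>a\<in>A. g a x)"
proof -
  interpret V: module K V by fact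
  show ?thesis using assms(2,3)
  proof (induction A)
    case empty then show ?case by (intro poly_lt.const[of "\<one>\<^bsub>K\<^esub>"]) simp_all
  next
    case (insert a A)
    have 1: "poly_lt K V (Suc (\<Sum>a\<in>A. d a) + d a) (\<lambda>x. (\<Otimes>\<^bsub>K\<^esub>a\<in>A. g a x) \<otimes>\<^bsub>K\<^esub> g a x)"
      by (rule poly_lt_prod[OF assms(1)]) (use insert in auto)
    show ?case
    proof (rule poly_lt_cong)
      show "poly_lt K V (Suc (\<Sum>a\<in>insert a A. d a)) (\<lambda>x. (\<Otimes>\<^bsub>K\<^esub>a\<in>A. g a x) \<otimes>\<^bsub>K\<^esub> g a x)"
        using 1 insert by (simp add: add.commute)
      fix x assume x: "x \<in> carrier V"
      have *: "g b x \<in> carrier K" if "b \<in> insert a A" for b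
        using poly_lt_closed[OF assms(1) insert.prems[OF that] x] .
      have "(\<Otimes>\<^bsub>K\<^esub>a\<in>insert a A. g a x) = g a x \<otimes>\<^bsub>K\<^esub> (\<Otimes>\<^bsub>K\<^esub>a\<in>A. g a x)"
        using insert * by (intro V.R.finprod_insert) auto
      then show "(\<Otimes>\<^bsub>K\<^esub>a\<in>insert a A. g a x) = (\<Otimes>\<^bsub>K\<^esub>a\<in>A. g a x) \<otimes>\<^bsub>K\<^esub> g a x"
        using * by (simp add: V.R.m_comm V.R.finprod_closed)
    qed
  qed
qed

lemma poly_lt_pow:
  assumes "module K V" "linear_form K V l"
  shows "poly_lt K V (Suc n) (\<lambda>x. l x [^]\<^bsub>K\<^esub> (n::nat))"
proof -
  interpret V: module K V by fact
  show ?thesis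
  proof (induction n)
    case 0 show ?case by (intro poly_lt.const[of "\<one>\<^bsub>K\<^esub>"]) simp_all
  next
    case (Suc n) show ?case by (rule poly_lt.mult[OF Suc assms(2)]) simp
  qed
qed

section \<open>Linear combinations, bases and coordinates\<close>

lemma (in abelian_group) add_minus_add_cancel_right:
  assumes "a \<in> carrier G" "b \<in> carrier G" "c \<in> carrier G"
  shows "(a \<oplus> c) \<ominus> (b \<oplus> c) = a \<ominus> b"
proof -
  have "(a \<oplus> c) \<ominus> (b \<oplus> c) = a \<oplus> (c \<oplus> (\<ominus> c \<oplus> \<ominus> b))"
    using assms by (simp add: minus_eq minus_add a_assoc a_comm[of b c])
  also have "\<dots> = a \<ominus> b"
    using assms by (simp add: minus_eq r_neg2)
  finally show ?thesis .
qed

lemma (in abelian_group) minus_eq_zeroD: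
  assumes "a \<in> carrier G" "b \<in> carrier G" "a \<ominus> b = \<zero>"
  shows "a = b"
  using assms by (metis a_inv_closed minus_eq minus_equality minus_minus)

lemma lin_comb_cong:
  assumes "module K V" "\<And>i. i < n \<Longrightarrow> b i \<in> carrier V" "\<And>i. i < n \<Longrightarrow> t i \<in> carrier K"
    "\<And>i. i < n \<Longrightarrow> t' i = t i" "\<And>i. i < n \<Longrightarrow> b' i = b i"
  shows "lin_comb V n b' t' = lin_comb V n b t"
proof -
  interpret V: module K V by fact
  show ?thesis unfolding lin_comb_def
    by (rule V.M.finsum_cong') (use assms in auto)
qed

lemma lin_comb_closed:
  assumes "module K V" "\<And>i. i < n \<Longrightarrow> b i \<in> carrier V" "\<And>i. i < n \<Longrightarrow> t i \<in> carrier K"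
  shows "lin_comb V n b t \<in> carrier V"
proof -
  interpret V: module K V by fact
  show ?thesis unfolding lin_comb_def
    by (rule V.M.finsum_closed) (use assms in auto)
qed

lemma lin_comb_add:
  assumes "module K V" "\<And>i. i < n \<Longrightarrow> b i \<in> carrier V" "\<And>i. i < n \<Longrightarrow> t i \<in> carrier K"
    "\<And>i. i < n \<Longrightarrow> t' i \<in> carrier K"
  shows "lin_comb V n b (\<lambda>i. t i \<oplus>\<^bsub>K\<^esub> t' i) = lin_comb V n b t \<oplus>\<^bsub>V\<^esub> lin_comb V n b t'"
proof -
  interpret V: module K V by fact
  have "lin_comb V n b (\<lambda>i. t i \<oplus>\<^bsub>K\<^esub> t' i) = (\<Oplus>\<^bsub>V\<^esub>i\<in>{..<n}. t i \<odot>\<^bsub>V\<^esub> b i \<oplus>\<^bsub>V\<^esub> t' i \<odot>\<^bsub>V\<^esub> b i)"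
    unfolding lin_comb_def
    by (rule V.M.finsum_cong') (use assms in \<open>auto simp: V.smult_l_distr\<close>)
  also have "\<dots> = lin_comb V n b t \<oplus>\<^bsub>V\<^esub> lin_comb V n b t'"
    unfolding lin_comb_def by (rule V.M.finsum_addf) (use assms in auto)
  finally show ?thesis .
qed

lemma lin_comb_smult:
  assumes "module K V" "\<And>i. i < n \<Longrightarrow> b i \<in> carrier V" "\<And>i. i < n \<Longrightarrow> t i \<in> carrier K"
    "a \<in> carrier K"
  shows "lin_comb V n b (\<lambda>i. a \<otimes>\<^bsub>K\<^esub> t i) = a \<odot>\<^bsub>V\<^esub> lin_comb V n b t"
proof -
  interpret V: module K V by fact
  have "lin_comb V n b (\<lambda>i. a \<otimes>\<^bsub>K\<^esub> t i) = (\<Oplus>\<^bsub>V\<^esub>i\<in>{..<n}. a \<odot>\<^bsub>V\<^esub> (t i \<odot>\<^bsub>V\<^esub> b i))"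
    unfolding lin_comb_def
    by (rule V.M.finsum_cong') (use assms in \<open>auto simp: V.smult_assoc1\<close>)
  also have "\<dots> = a \<odot>\<^bsub>V\<^esub> lin_comb V n b t"
    unfolding lin_comb_def by (rule V.finsum_smult_ldistr[symmetric]) (use assms in auto)
  finally show ?thesis .
qed

lemma lin_comb_Suc:
  assumes "module K V" "\<And>i. i < Suc n \<Longrightarrow> b i \<in> carrier V" "\<And>i. i < Suc n \<Longrightarrow> t i \<in> carrier K"
  shows "lin_comb V (Suc n) b t = t n \<odot>\<^bsub>V\<^esub> b n \<oplus>\<^bsub>V\<^esub> lin_comb V n b t"
proof -
  interpret V: module K V by fact
  show ?thesis unfolding lin_comb_def lessThan_Suc
    by (rule V.M.finsum_insert) (use assms in auto)
qed

lemma lin_comb_minus: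
  assumes "module K V" "\<And>i. i < n \<Longrightarrow> b i \<in> carrier V" "\<And>i. i < n \<Longrightarrow> t i \<in> carrier K"
    "\<And>i. i < n \<Longrightarrow> t' i \<in> carrier K"
  shows "lin_comb V n b (\<lambda>i. t i \<ominus>\<^bsub>K\<^esub> t' i) = lin_comb V n b t \<ominus>\<^bsub>V\<^esub> lin_comb V n b t'"
proof -
  interpret V: module K V by fact
  let ?m = "\<ominus>\<^bsub>K\<^esub> \<one>\<^bsub>K\<^esub>"
  have "lin_comb V n b (\<lambda>i. t i \<ominus>\<^bsub>K\<^esub> t' i) = lin_comb V n b (\<lambda>i. t i \<oplus>\<^bsub>K\<^esub> ?m \<otimes>\<^bsub>K\<^esub> t' i)"
    using assms by (intro lin_comb_cong[OF assms(1)]) (auto simp: V.R.minus_eq V.R.l_minus)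
  also have "\<dots> = lin_comb V n b t \<oplus>\<^bsub>V\<^esub> lin_comb V n b (\<lambda>i. ?m \<otimes>\<^bsub>K\<^esub> t' i)"
    using assms by (intro lin_comb_add) auto
  also have "lin_comb V n b (\<lambda>i. ?m \<otimes>\<^bsub>K\<^esub> t' i) = ?m \<odot>\<^bsub>V\<^esub> lin_comb V n b t'"
    using assms by (intro lin_comb_smult) auto
  also have "\<dots> = \<ominus>\<^bsub>V\<^esub> lin_comb V n b t'"
    using lin_comb_closed[OF assms(1,2,4)] by (simp add: V.smult_l_minus)
  finally show ?thesis by (simp add: V.M.minus_eq)
qed

text \<open>A longest independent family spans. Independence is injectivity of
  \<open>lin_comb\<close>, and n < 2^n \<le> card(K)^n \<le> card(V) bounds the length.\<close>

lemma finite_module_basis: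
  assumes "field K" "finite (carrier K)" "module K V" "finite (carrier V)"
  shows "\<exists>n b. is_basis K V n b"
proof -
  interpret K: field K by fact
  interpret V: module K V by fact
  let ?E = "\<lambda>n. {..<n::nat} \<rightarrow>\<^sub>E carrier K"
  define good where "good n b \<longleftrightarrow> (\<forall>i<n. b i \<in> carrier V) \<and> inj_on (lin_comb V n b) (?E n)"
    for n :: nat and b
  have bound: "n < card (carrier V)" if "good n b" for n b
  proof -
    have "card (?E n) = card (carrier K) ^ n" by (simp add: card_PiE)
    moreover have "lin_comb V n b ` ?E n \<subseteq> carrier V"
      using that by (auto simp: good_def intro!: lin_comb_closed[OF assms(3)])
    then have "card (?E n) \<le> card (carrier V)"
      using that assms(4) by (intro card_inj_on_le) (auto simp: good_def)
    moreover have "2 \<le> card (carrier K)"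
    proof -
      have "card {\<zero>\<^bsub>K\<^esub>, \<one>\<^bsub>K\<^esub>} \<le> card (carrier K)" using assms(2) by (intro card_mono) auto
      then show ?thesis by simp
    qed
    then have "2 ^ n \<le> card (carrier K) ^ n" by (intro power_mono) auto
    ultimately show ?thesis using less_exp[of n] by linarith
  qed
  have "good 0 (\<lambda>_. \<zero>\<^bsub>V\<^esub>)" by (simp add: good_def)
  then obtain n where n: "\<exists>b. good n b" "\<And>m b. good m b \<Longrightarrow> m \<le> n"
    using GreatestI_nat[of "\<lambda>n. \<exists>b. good n b" 0 "card (carrier V)"]
      Greatest_le_nat[of "\<lambda>n. \<exists>b. good n b" _ "card (carrier V)"] bound
    by (metis less_imp_le)
  then obtain b where b: "good n b" by blast
  then have bV: "i < n \<Longrightarrow> b i \<in> carrier V" for i by (simp add: good_def)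
  have "lin_comb V n b ` ?E n = carrier V"
  proof
    show "lin_comb V n b ` ?E n \<subseteq> carrier V"
      using bV by (auto intro!: lin_comb_closed[OF assms(3)])
    show "carrier V \<subseteq> lin_comb V n b ` ?E n"
    proof (rule ccontr)
      assume "\<not> carrier V \<subseteq> lin_comb V n b ` ?E n"
      then obtain v where v: "v \<in> carrier V" "v \<notin> lin_comb V n b ` ?E n" by blast
      let ?b = "b(n := v)"
      have b'V: "i < Suc n \<Longrightarrow> ?b i \<in> carrier V" for i using v bV by (auto simp: less_Suc_eq)
      \<comment> \<open>A vector outside the span can be appended without losing independence,
        against the maximality of \<open>n\<close>.\<close>
      have "good (Suc n) ?b" unfolding good_def
      proof (intro conjI allI impI inj_onI)
        show "?b i \<in> carrier V" if "i < Suc n" for i by (rule b'V[OF that])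
        fix s t assume s: "s \<in> ?E (Suc n)" and t: "t \<in> ?E (Suc n)"
          and eq: "lin_comb V (Suc n) ?b s = lin_comb V (Suc n) ?b t"
        have sK: "i < Suc n \<Longrightarrow> s i \<in> carrier K" and tK: "i < Suc n \<Longrightarrow> t i \<in> carrier K" for i
          using s t by auto
        have L: "lin_comb V n ?b r = lin_comb V n b r" if "\<And>i. i < n \<Longrightarrow> r i \<in> carrier K" for r
          by (rule lin_comb_cong[OF assms(3)]) (use that bV in auto)
        have e1: "lin_comb V (Suc n) ?b r = r n \<odot>\<^bsub>V\<^esub> v \<oplus>\<^bsub>V\<^esub> lin_comb V n b r"
          if r: "\<And>i. i < Suc n \<Longrightarrow> r i \<in> carrier K" for r
        proof -
          have "lin_comb V (Suc n) ?b r = r n \<odot>\<^bsub>V\<^esub> ?b n \<oplus>\<^bsub>V\<^esub> lin_comb V n ?b r"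
            by (rule lin_comb_Suc[OF assms(3)]) (fact b'V, fact r)
          moreover have "lin_comb V n ?b r = lin_comb V n b r" by (rule L) (simp add: r)
          ultimately show ?thesis by simp
        qed
        let ?Ls = "lin_comb V n b s" and ?Lt = "lin_comb V n b t"
        have cl: "?Ls \<in> carrier V" "?Lt \<in> carrier V" "s n \<in> carrier K" "t n \<in> carrier K"
          using sK tK bV by (auto intro!: lin_comb_closed[OF assms(3)])
        have eq': "s n \<odot>\<^bsub>V\<^esub> v \<oplus>\<^bsub>V\<^esub> ?Ls = t n \<odot>\<^bsub>V\<^esub> v \<oplus>\<^bsub>V\<^esub> ?Lt"
          using eq e1[of s] e1[of t] sK tK by metis
        have n_eq: "s n = t n"
        proof (rule ccontr)
          assume ne: "s n \<noteq> t n"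
          \<comment> \<open>If the coefficients of \<open>v\<close> differ, dividing by their
            difference expresses \<open>v\<close> through the family.\<close>
          let ?d = "s n \<ominus>\<^bsub>K\<^esub> t n"
          have d: "?d \<in> carrier K" "?d \<noteq> \<zero>\<^bsub>K\<^esub>" using cl ne by (auto dest: K.minus_eq_zeroD)
          then have iK: "inv\<^bsub>K\<^esub> ?d \<in> carrier K" "inv\<^bsub>K\<^esub> ?d \<otimes>\<^bsub>K\<^esub> ?d = \<one>\<^bsub>K\<^esub>"
            by (auto simp: K.field_Units)
          have "?d \<odot>\<^bsub>V\<^esub> v = s n \<odot>\<^bsub>V\<^esub> v \<ominus>\<^bsub>V\<^esub> t n \<odot>\<^bsub>V\<^esub> v"
            using cl v by (simp add: K.minus_eq V.M.minus_eq V.smult_l_distr V.smult_l_minus)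
          also have "\<dots> = (s n \<odot>\<^bsub>V\<^esub> v \<oplus>\<^bsub>V\<^esub> ?Ls) \<ominus>\<^bsub>V\<^esub> (t n \<odot>\<^bsub>V\<^esub> v \<oplus>\<^bsub>V\<^esub> ?Ls)"
            using cl v by (simp add: V.M.add_minus_add_cancel_right)
          also have "\<dots> = (t n \<odot>\<^bsub>V\<^esub> v \<oplus>\<^bsub>V\<^esub> ?Lt) \<ominus>\<^bsub>V\<^esub> (t n \<odot>\<^bsub>V\<^esub> v \<oplus>\<^bsub>V\<^esub> ?Ls)"
            by (simp add: eq')
          also have "\<dots> = ?Lt \<ominus>\<^bsub>V\<^esub> ?Ls"
            using cl v by (simp add: V.M.a_comm[of _ "?Lt"] V.M.a_comm[of _ "?Ls"] V.M.add_minus_add_cancel_right)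
          also have "\<dots> = lin_comb V n b (\<lambda>i. t i \<ominus>\<^bsub>K\<^esub> s i)"
            using bV sK tK by (simp add: lin_comb_minus[OF assms(3)])
          finally have "inv\<^bsub>K\<^esub> ?d \<odot>\<^bsub>V\<^esub> (?d \<odot>\<^bsub>V\<^esub> v) = inv\<^bsub>K\<^esub> ?d \<odot>\<^bsub>V\<^esub> lin_comb V n b (\<lambda>i. t i \<ominus>\<^bsub>K\<^esub> s i)"
            by simp
          also have "\<dots> = lin_comb V n b (\<lambda>i. inv\<^bsub>K\<^esub> ?d \<otimes>\<^bsub>K\<^esub> (t i \<ominus>\<^bsub>K\<^esub> s i))"
            using bV sK tK iK by (simp add: lin_comb_smult[OF assms(3)])
          also have "\<dots> = lin_comb V n b (\<lambda>i\<in>{..<n}. inv\<^bsub>K\<^esub> ?d \<otimes>\<^bsub>K\<^esub> (t i \<ominus>\<^bsub>K\<^esub> s i))"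
            using bV sK tK iK by (intro lin_comb_cong[OF assms(3)]) auto
          also have "inv\<^bsub>K\<^esub> ?d \<odot>\<^bsub>V\<^esub> (?d \<odot>\<^bsub>V\<^esub> v) = v"
            using d iK v by (simp add: V.smult_assoc1[symmetric])
          finally have "v = lin_comb V n b (\<lambda>i\<in>{..<n}. inv\<^bsub>K\<^esub> ?d \<otimes>\<^bsub>K\<^esub> (t i \<ominus>\<^bsub>K\<^esub> s i))" .
          moreover have "(\<lambda>i\<in>{..<n}. inv\<^bsub>K\<^esub> ?d \<otimes>\<^bsub>K\<^esub> (t i \<ominus>\<^bsub>K\<^esub> s i)) \<in> ?E n"
            using sK tK iK by auto
          ultimately have "v \<in> lin_comb V n b ` ?E n"
            by (rule image_eqI)
          then show False using v by simp
        qed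
        then have "?Ls = ?Lt" using eq' cl v by simp
        moreover have "?Ls = lin_comb V n b (restrict s {..<n})" "?Lt = lin_comb V n b (restrict t {..<n})"
          using bV sK tK by (auto intro!: lin_comb_cong[OF assms(3)])
        ultimately have "restrict s {..<n} = restrict t {..<n}"
          using b sK tK by (auto simp: good_def dest!: inj_onD)
        then have "s i = t i" if "i < n" for i
          using that by (metis lessThan_iff restrict_apply)
        then show "s = t" using n_eq s t by (intro PiE_ext[OF s t]) (auto simp: less_Suc_eq)
      qed
      then show False using n(2) by fastforce
    qed
  qed
  then have "is_basis K V n b"
    using b by (auto simp: good_def is_basis_def bij_betw_def)
  then show ?thesis by blast
qed

lemma basis_coordinates:
  assumes "module K V" "is_basis K V n b"
  shows "\<exists>co. (\<forall>i<n. linear_form K V (co i)) \<and>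
    (\<forall>t\<in>{..<n} \<rightarrow>\<^sub>E carrier K. \<forall>i<n. co i (lin_comb V n b t) = t i) \<and>
    (\<forall>x\<in>carrier V. lin_comb V n b (\<lambda>i\<in>{..<n}. co i x) = x)"
proof -
  interpret V: module K V by fact
  let ?E = "{..<n} \<rightarrow>\<^sub>E carrier K" and ?L = "lin_comb V n b"
  define dec where "dec = inv_into ?E ?L"
  have bV: "i < n \<Longrightarrow> b i \<in> carrier V" for i using assms(2) by (simp add: is_basis_def)
  have bij: "bij_betw ?L ?E (carrier V)" using assms(2) by (simp add: is_basis_def)
  have dE: "dec x \<in> ?E" if "x \<in> carrier V" for x
    unfolding dec_def using bij that by (metis bij_betw_def inv_into_into)
  have dK: "dec x i \<in> carrier K" if "x \<in> carrier V" "i < n" for x i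
    using dE[OF that(1)] that(2) by auto
  have Ld: "?L (dec x) = x" if "x \<in> carrier V" for x
    unfolding dec_def using bij that by (metis bij_betw_inv_into_right)
  have dL: "dec (?L t) = t" if "t \<in> ?E" for t
    unfolding dec_def using bij that by (metis bij_betw_inv_into_left)
  show ?thesis
  proof (intro exI[of _ "\<lambda>i x. dec x i"] conjI ballI allI impI)
    show "dec (?L t) i = t i" if "t \<in> ?E" "i < n" for t i using dL that by simp
    show "?L (\<lambda>i\<in>{..<n}. dec x i) = x" if "x \<in> carrier V" for x
    proof -
      have "(\<lambda>i\<in>{..<n}. dec x i) = dec x" using dE[OF that] by (simp add: PiE_restrict)
      then show ?thesis using Ld that by simp
    qed
    fix i assume i: "i < n"
    have "dec (x \<oplus>\<^bsub>V\<^esub> y) i = dec x i \<oplus>\<^bsub>K\<^esub> dec y i" if "x \<in> carrier V" "y \<in> carrier V" for x y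
    proof -
      have "?L (\<lambda>i\<in>{..<n}. dec x i \<oplus>\<^bsub>K\<^esub> dec y i) = ?L (\<lambda>i. dec x i \<oplus>\<^bsub>K\<^esub> dec y i)"
        using dK that bV by (intro lin_comb_cong[OF assms(1)]) auto
      also have "\<dots> = x \<oplus>\<^bsub>V\<^esub> y"
        using that dK bV by (simp add: lin_comb_add[OF assms(1)] Ld)
      finally have "dec (x \<oplus>\<^bsub>V\<^esub> y) = (\<lambda>i\<in>{..<n}. dec x i \<oplus>\<^bsub>K\<^esub> dec y i)"
        using dL[of "\<lambda>i\<in>{..<n}. dec x i \<oplus>\<^bsub>K\<^esub> dec y i"] that dK by auto
      then show ?thesis using i by simp
    qed
    moreover have "dec (a \<odot>\<^bsub>V\<^esub> x) i = a \<otimes>\<^bsub>K\<^esub> dec x i" if "a \<in> carrier K" "x \<in> carrier V" for x a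
    proof -
      have "?L (\<lambda>i\<in>{..<n}. a \<otimes>\<^bsub>K\<^esub> dec x i) = ?L (\<lambda>i. a \<otimes>\<^bsub>K\<^esub> dec x i)"
        using dK that bV by (intro lin_comb_cong[OF assms(1)]) auto
      also have "\<dots> = a \<odot>\<^bsub>V\<^esub> x"
        using that dK bV by (simp add: lin_comb_smult[OF assms(1)] Ld)
      finally have "dec (a \<odot>\<^bsub>V\<^esub> x) = (\<lambda>i\<in>{..<n}. a \<otimes>\<^bsub>K\<^esub> dec x i)"
        using dL[of "\<lambda>i\<in>{..<n}. a \<otimes>\<^bsub>K\<^esub> dec x i"] that dK by auto
      then show ?thesis using i by simp
    qed
    ultimately show "linear_form K V (\<lambda>x. dec x i)"
      using dK i by (simp add: linear_form_def)
  qed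
qed

section \<open>Agreement of the inductive notion of degree with the one by coordinates\<close>

lemma fun_le_poly_lt:
  assumes "module K V" "f \<in> fun_le K V e"
  shows "poly_lt K V (nat (e + 1)) f"
proof -
  interpret V: module K V by fact
  have "\<exists>n b A c. is_basis K V n b \<and>
       finite A \<and> (\<forall>a\<in>A. int (\<Sum>i<n. a i) \<le> e) \<and> c \<in> A \<rightarrow> carrier K \<and>
       (\<forall>t\<in>{..<n} \<rightarrow>\<^sub>E carrier K.
          f (lin_comb V n b t) =
            (\<Oplus>\<^bsub>K\<^esub>a\<in>A. c a \<otimes>\<^bsub>K\<^esub> (\<Otimes>\<^bsub>K\<^esub>i\<in>{..<n}. t i [^]\<^bsub>K\<^esub> (a i :: nat))))"
    using assms(2) unfolding fun_le_def mem_Collect_eq by (rule conjunct2)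
  then obtain n b A c where *: "is_basis K V n b \<and>
       finite A \<and> (\<forall>a\<in>A. int (\<Sum>i<n. a i) \<le> e) \<and> c \<in> A \<rightarrow> carrier K \<and>
       (\<forall>t\<in>{..<n} \<rightarrow>\<^sub>E carrier K.
          f (lin_comb V n b t) =
            (\<Oplus>\<^bsub>K\<^esub>a\<in>A. c a \<otimes>\<^bsub>K\<^esub> (\<Otimes>\<^bsub>K\<^esub>i\<in>{..<n}. t i [^]\<^bsub>K\<^esub> (a i :: nat))))"
    by (elim exE)
  from * have b: "is_basis K V n b" and A: "finite A" "\<And>a. a \<in> A \<Longrightarrow> int (\<Sum>i<n. a i) \<le> e"
    and c: "c \<in> A \<rightarrow> carrier K"
    by simp_all
  from * have f: "\<And>t. t \<in> {..<n} \<rightarrow>\<^sub>E carrier K \<Longrightarrow>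
      f (lin_comb V n b t) = (\<Oplus>\<^bsub>K\<^esub>a\<in>A. c a \<otimes>\<^bsub>K\<^esub> (\<Otimes>\<^bsub>K\<^esub>i\<in>{..<n}. t i [^]\<^bsub>K\<^esub> (a i :: nat)))"
    by (elim conjE) (erule bspec)
  obtain co where co': "(\<forall>i<n. linear_form K V (co i)) \<and>
    (\<forall>t\<in>{..<n} \<rightarrow>\<^sub>E carrier K. \<forall>i<n. co i (lin_comb V n b t) = t i) \<and>
    (\<forall>x\<in>carrier V. lin_comb V n b (\<lambda>i\<in>{..<n}. co i x) = x)"
    using basis_coordinates[OF assms(1) b] by (elim exE)
  then have co: "\<And>i. i < n \<Longrightarrow> linear_form K V (co i)"
      "\<And>x. x \<in> carrier V \<Longrightarrow> lin_comb V n b (\<lambda>i\<in>{..<n}. co i x) = x"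
    by blast+
  have "poly_lt K V (nat (e + 1)) (\<lambda>x. \<Oplus>\<^bsub>K\<^esub>a\<in>A. c a \<otimes>\<^bsub>K\<^esub> (\<Otimes>\<^bsub>K\<^esub>i\<in>{..<n}. co i x [^]\<^bsub>K\<^esub> a i))"
  proof (rule poly_lt_sum[OF assms(1) A(1)])
    fix a assume a: "a \<in> A"
    have "poly_lt K V (Suc (\<Sum>i<n. a i)) (\<lambda>x. \<Otimes>\<^bsub>K\<^esub>i\<in>{..<n}. co i x [^]\<^bsub>K\<^esub> a i)"
      by (rule poly_lt_finprod[OF assms(1)]) (use co in \<open>auto intro: poly_lt_pow[OF assms(1)]\<close>)
    moreover have "Suc (\<Sum>i<n. a i) \<le> nat (e + 1)" using A(2)[OF a] by linarith
    ultimately show "poly_lt K V (nat (e + 1)) (\<lambda>x. c a \<otimes>\<^bsub>K\<^esub> (\<Otimes>\<^bsub>K\<^esub>i\<in>{..<n}. co i x [^]\<^bsub>K\<^esub> a i))"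
      using a c by (intro poly_lt_smult[OF assms(1)]) (auto intro: poly_lt_mono)
  qed
  then show ?thesis
  proof (rule poly_lt_cong)
    fix x assume x: "x \<in> carrier V"
    let ?t = "\<lambda>i\<in>{..<n}. co i x"
    have t: "co i x \<in> carrier K" if "i < n" for i by (rule linear_form_closed[OF co(1)[OF that] x])
    have "f x = f (lin_comb V n b ?t)" by (simp add: co(2)[OF x])
    also have "\<dots> = (\<Oplus>\<^bsub>K\<^esub>a\<in>A. c a \<otimes>\<^bsub>K\<^esub> (\<Otimes>\<^bsub>K\<^esub>i\<in>{..<n}. ?t i [^]\<^bsub>K\<^esub> a i))"
      using t by (intro f) auto
    also have "\<dots> = (\<Oplus>\<^bsub>K\<^esub>a\<in>A. c a \<otimes>\<^bsub>K\<^esub> (\<Otimes>\<^bsub>K\<^esub>i\<in>{..<n}. co i x [^]\<^bsub>K\<^esub> a i))"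
    proof (rule V.R.finsum_cong'[OF refl])
      have *: "(\<Otimes>\<^bsub>K\<^esub>i\<in>{..<n}. co i x [^]\<^bsub>K\<^esub> a i) \<in> carrier K" for a :: "nat \<Rightarrow> nat"
        using t by (intro V.R.finprod_closed) (auto intro!: V.R.nat_pow_closed)
      show "(\<lambda>a. c a \<otimes>\<^bsub>K\<^esub> (\<Otimes>\<^bsub>K\<^esub>i\<in>{..<n}. co i x [^]\<^bsub>K\<^esub> a i)) \<in> A \<rightarrow> carrier K"
        using c * by auto
      fix a :: "nat \<Rightarrow> nat"
      have "(\<Otimes>\<^bsub>K\<^esub>i\<in>{..<n}. ?t i [^]\<^bsub>K\<^esub> a i) = (\<Otimes>\<^bsub>K\<^esub>i\<in>{..<n}. co i x [^]\<^bsub>K\<^esub> a i)"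
        using t by (intro V.R.finprod_cong') (auto intro!: V.R.nat_pow_closed)
      then show "c a \<otimes>\<^bsub>K\<^esub> (\<Otimes>\<^bsub>K\<^esub>i\<in>{..<n}. ?t i [^]\<^bsub>K\<^esub> a i) = c a \<otimes>\<^bsub>K\<^esub> (\<Otimes>\<^bsub>K\<^esub>i\<in>{..<n}. co i x [^]\<^bsub>K\<^esub> a i)"
        by simp
    qed
    finally show "f x = (\<Oplus>\<^bsub>K\<^esub>a\<in>A. c a \<otimes>\<^bsub>K\<^esub> (\<Otimes>\<^bsub>K\<^esub>i\<in>{..<n}. co i x [^]\<^bsub>K\<^esub> a i))" .
  qed
qed

definition monom_sum ::
    "('k, 'm) ring_scheme \<Rightarrow> nat \<Rightarrow> (nat \<Rightarrow> nat) set \<Rightarrow> ((nat \<Rightarrow> nat) \<Rightarrow> 'k) \<Rightarrow> (nat \<Rightarrow> 'k) \<Rightarrow> 'k" where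
  "monom_sum K n A c t = (\<Oplus>\<^bsub>K\<^esub>a\<in>A. c a \<otimes>\<^bsub>K\<^esub> (\<Otimes>\<^bsub>K\<^esub>i\<in>{..<n}. t i [^]\<^bsub>K\<^esub> (a i :: nat)))"

text \<open>The literal shape of \<open>fun_le\<close>, with a strict bound, for a function of the
  coordinates. Exponents beyond \<open>n\<close> are unconstrained, so one monomial may have several
  exponent vectors; only the existence of coefficients matters.\<close>

definition coord_poly_lt ::
    "('k, 'm) ring_scheme \<Rightarrow> nat \<Rightarrow> nat \<Rightarrow> ((nat \<Rightarrow> 'k) \<Rightarrow> 'k) \<Rightarrow> bool" where
  "coord_poly_lt K n e g \<longleftrightarrow> (\<exists>A c. finite A \<and> (\<forall>a\<in>A. (\<Sum>i<n. a i) < e) \<and> c \<in> A \<rightarrow> carrier K \<and>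
     (\<forall>t\<in>{..<n} \<rightarrow>\<^sub>E carrier K. g t = monom_sum K n A c t))"

context field
begin

lemma monom_closed:
  "t \<in> {..<n::nat} \<rightarrow>\<^sub>E carrier R \<Longrightarrow> (\<Otimes>i\<in>{..<n}. t i [^] (a i :: nat)) \<in> carrier R"
  by (intro finprod_closed) (auto intro!: nat_pow_closed)

lemma coord_poly_lt_zero:
  "(\<And>t. t \<in> {..<n} \<rightarrow>\<^sub>E carrier R \<Longrightarrow> g t = \<zero>) \<Longrightarrow> coord_poly_lt R n e g"
  unfolding coord_poly_lt_def by (intro exI[of _ "{}"]) (simp add: monom_sum_def)

lemma coord_poly_lt_const:
  assumes "d \<in> carrier R" "\<And>t. t \<in> {..<n} \<rightarrow>\<^sub>E carrier R \<Longrightarrow> g t = d"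
  shows "coord_poly_lt R n (Suc e) g"
  unfolding coord_poly_lt_def
proof (intro exI conjI ballI)
  fix t assume t: "t \<in> {..<n} \<rightarrow>\<^sub>E carrier R"
  show "g t = monom_sum R n {\<lambda>_. 0} (\<lambda>_. d) t"
    using assms t by (simp add: monom_sum_def)
qed (use assms in auto)

text \<open>Padding with zero coefficients lets two sums run over a common set of exponent
  vectors.\<close>

lemma monom_sum_extend:
  assumes "finite B" "A \<subseteq> B" "c \<in> A \<rightarrow> carrier R" "t \<in> {..<n} \<rightarrow>\<^sub>E carrier R"
  shows "monom_sum R n B (\<lambda>a. if a \<in> A then c a else \<zero>) t = monom_sum R n A c t"
proof -
  have "monom_sum R n B (\<lambda>a. if a \<in> A then c a else \<zero>) t =
      monom_sum R n A (\<lambda>a. if a \<in> A then c a else \<zero>) t"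
    unfolding monom_sum_def
    by (rule add.finprod_mono_neutral_cong_left[OF assms(1,2), symmetric])
      (use assms monom_closed[OF assms(4)] in \<open>auto simp: Pi_iff\<close>)
  also have "\<dots> = monom_sum R n A c t"
    unfolding monom_sum_def
    by (rule finsum_cong') (use assms monom_closed[OF assms(4)] in \<open>auto simp: Pi_iff\<close>)
  finally show ?thesis .
qed

lemma coord_poly_lt_add:
  assumes "coord_poly_lt R n e f" "coord_poly_lt R n e g"
    "\<And>t. t \<in> {..<n} \<rightarrow>\<^sub>E carrier R \<Longrightarrow> h t = f t \<oplus> g t"
  shows "coord_poly_lt R n e h"
proof -
  obtain A c where A: "finite A" "\<forall>a\<in>A. (\<Sum>i<n. a i) < e" "c \<in> A \<rightarrow> carrier R"
    "\<forall>t\<in>{..<n} \<rightarrow>\<^sub>E carrier R. f t = monom_sum R n A c t"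
    using assms(1) unfolding coord_poly_lt_def by (elim exE conjE)
  obtain B d where B: "finite B" "\<forall>a\<in>B. (\<Sum>i<n. a i) < e" "d \<in> B \<rightarrow> carrier R"
    "\<forall>t\<in>{..<n} \<rightarrow>\<^sub>E carrier R. g t = monom_sum R n B d t"
    using assms(2) unfolding coord_poly_lt_def by (elim exE conjE)
  let ?c = "\<lambda>a. if a \<in> A then c a else \<zero>" and ?d = "\<lambda>a. if a \<in> B then d a else \<zero>"
  have cK: "?c a \<in> carrier R" and dK: "?d a \<in> carrier R" for a using A B by auto
  show ?thesis unfolding coord_poly_lt_def
  proof (intro exI conjI ballI)
    show "finite (A \<union> B)" using A B by simp
    show "(\<Sum>i<n. a i) < e" if "a \<in> A \<union> B" for a using that A B by auto
    show cd: "(\<lambda>a. ?c a \<oplus> ?d a) \<in> A \<union> B \<rightarrow> carrier R" by (intro Pi_I a_closed cK dK)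
    fix t assume t: "t \<in> {..<n} \<rightarrow>\<^sub>E carrier R"
    note m = monom_closed[OF t]
    have "monom_sum R n (A \<union> B) (\<lambda>a. ?c a \<oplus> ?d a) t =
        (\<Oplus>a\<in>A \<union> B. ?c a \<otimes> (\<Otimes>i\<in>{..<n}. t i [^] (a i :: nat)) \<oplus> ?d a \<otimes> (\<Otimes>i\<in>{..<n}. t i [^] (a i :: nat)))"
      unfolding monom_sum_def
      by (rule finsum_cong') (use cK dK m in \<open>auto simp only: l_distr Pi_iff intro!: a_closed m_closed\<close>)
    also have "\<dots> = monom_sum R n (A \<union> B) ?c t \<oplus> monom_sum R n (A \<union> B) ?d t"
      unfolding monom_sum_def
      by (rule finsum_addf) (use cK dK m in \<open>auto simp only: Pi_iff intro!: m_closed\<close>)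
    also have "monom_sum R n (A \<union> B) ?c t = monom_sum R n A c t"
      by (rule monom_sum_extend) (use A B t in auto)
    also have "monom_sum R n (A \<union> B) ?d t = monom_sum R n B d t"
      by (rule monom_sum_extend) (use A B t in auto)
    finally show "h t = monom_sum R n (A \<union> B) (\<lambda>a. ?c a \<oplus> ?d a) t"
      using A B t assms(3) by simp
  qed
qed

lemma coord_poly_lt_smult:
  assumes "coord_poly_lt R n e f" "d \<in> carrier R"
    "\<And>t. t \<in> {..<n} \<rightarrow>\<^sub>E carrier R \<Longrightarrow> h t = d \<otimes> f t"
  shows "coord_poly_lt R n e h"
proof -
  obtain A c where A: "finite A" "\<forall>a\<in>A. (\<Sum>i<n. a i) < e" "c \<in> A \<rightarrow> carrier R"
    "\<forall>t\<in>{..<n} \<rightarrow>\<^sub>E carrier R. f t = monom_sum R n A c t"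
    using assms(1) unfolding coord_poly_lt_def by (elim exE conjE)
  show ?thesis unfolding coord_poly_lt_def
  proof (intro exI conjI ballI)
    show "finite A" "\<And>a. a \<in> A \<Longrightarrow> (\<Sum>i<n. a i) < e" using A by auto
    show "(\<lambda>a. d \<otimes> c a) \<in> A \<rightarrow> carrier R" using A assms by auto
    fix t assume t: "t \<in> {..<n} \<rightarrow>\<^sub>E carrier R"
    have "d \<otimes> monom_sum R n A c t = (\<Oplus>a\<in>A. d \<otimes> (c a \<otimes> (\<Otimes>i\<in>{..<n}. t i [^] (a i :: nat))))"
      unfolding monom_sum_def
      by (rule finsum_rdistr) (use A assms monom_closed[OF t] in \<open>auto simp: Pi_iff\<close>)
    also have "\<dots> = monom_sum R n A (\<lambda>a. d \<otimes> c a) t"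
      unfolding monom_sum_def
      by (rule finsum_cong') (use A assms monom_closed[OF t] in \<open>auto simp: m_assoc Pi_iff\<close>)
    finally show "h t = monom_sum R n A (\<lambda>a. d \<otimes> c a) t"
      using A t assms(3) by simp
  qed
qed

lemma monom_times_var:
  fixes a :: "nat \<Rightarrow> nat"
  assumes t: "t \<in> {..<n} \<rightarrow>\<^sub>E carrier R" and i: "i < n"
  shows "(\<Otimes>j\<in>{..<n}. t j [^] ((a(i := Suc (a i))) j)) = (\<Otimes>j\<in>{..<n}. t j [^] a j) \<otimes> t i"
proof -
  let ?S = "{..<n} - {i}"
  have ins: "{..<n} = insert i ?S" using i by auto
  have tK: "t j \<in> carrier R" if "j < n" for j using t that by auto
  have 1: "(\<Otimes>j\<in>{..<n}. t j [^] f j) = t i [^] f i \<otimes> (\<Otimes>j\<in>?S. t j [^] f j)"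
    and 2: "(\<Otimes>j\<in>?S. t j [^] f j) \<in> carrier R" for f :: "nat \<Rightarrow> nat"
  proof -
    show "(\<Otimes>j\<in>{..<n}. t j [^] f j) = t i [^] f i \<otimes> (\<Otimes>j\<in>?S. t j [^] f j)"
      by (subst ins, rule finprod_insert) (use tK i in \<open>auto intro!: nat_pow_closed\<close>)
    show "(\<Otimes>j\<in>?S. t j [^] f j) \<in> carrier R"
      by (rule finprod_closed) (use tK in \<open>auto intro!: nat_pow_closed\<close>)
  qed
  have "(\<Otimes>j\<in>?S. t j [^] ((a(i := Suc (a i))) j)) = (\<Otimes>j\<in>?S. t j [^] a j)"
    by (rule finprod_cong') (use tK in \<open>auto intro!: nat_pow_closed\<close>)
  then show ?thesis
    unfolding 1 using 2[of a] tK[OF i] by (simp add: m_ac)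
qed

lemma coord_poly_lt_var:
  assumes "coord_poly_lt R n e f" "i < n"
    "\<And>t. t \<in> {..<n} \<rightarrow>\<^sub>E carrier R \<Longrightarrow> h t = f t \<otimes> t i"
  shows "coord_poly_lt R n (Suc e) h"
proof -
  obtain A c where A: "finite A" "\<forall>a\<in>A. (\<Sum>i<n. a i) < e" "c \<in> A \<rightarrow> carrier R"
    "\<forall>t\<in>{..<n} \<rightarrow>\<^sub>E carrier R. f t = monom_sum R n A c t"
    using assms(1) unfolding coord_poly_lt_def by (elim exE conjE)
  \<comment> \<open>Multiplication by the variable reindexes the exponents by \<open>?u\<close>. The
    truncated subtraction in \<open>?v\<close> is harmless, since every vector in the image of
    \<open>?u\<close> is positive at \<open>i\<close>.\<close>
  let ?u = "\<lambda>a::nat \<Rightarrow> nat. a(i := Suc (a i))" and ?v = "\<lambda>a::nat \<Rightarrow> nat. a(i := a i - 1)"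
  have vu: "?v (?u a) = a" for a by simp
  have inj: "inj_on ?u A" by (rule inj_on_inverseI[of _ ?v]) (rule vu)
  show ?thesis unfolding coord_poly_lt_def
  proof (intro exI conjI ballI)
    show "finite (?u ` A)" using A by simp
    show "(\<Sum>j<n. a j) < Suc e" if "a \<in> ?u ` A" for a
    proof -
      from that obtain b where b: "b \<in> A" "a = ?u b" by blast
      have ins: "{..<n} = insert i ({..<n} - {i})" using assms(2) by auto
      have "(\<Sum>j<n. a j) = Suc (b i) + (\<Sum>j\<in>{..<n} - {i}. b j)"
        by (subst ins, subst sum.insert) (auto simp: b(2))
      also have "\<dots> = Suc (\<Sum>j<n. b j)"
        by (subst (2) ins, subst sum.insert) auto
      finally show ?thesis using A b by auto
    qed
    show "(\<lambda>a. c (?v a)) \<in> ?u ` A \<rightarrow> carrier R"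
    proof
      fix a assume "a \<in> ?u ` A"
      then obtain b where b: "b \<in> A" "a = ?u b" by blast
      show "c (?v a) \<in> carrier R" unfolding b(2) vu using b(1) A by auto
    qed
    fix t assume t: "t \<in> {..<n} \<rightarrow>\<^sub>E carrier R"
    note m = monom_closed[OF t]
    have ti: "t i \<in> carrier R" using t assms(2) by auto
    have "monom_sum R n (?u ` A) (\<lambda>a. c (?v a)) t =
       (\<Oplus>a\<in>A. c (?v (?u a)) \<otimes> (\<Otimes>j\<in>{..<n}. t j [^] (?u a j)))"
      unfolding monom_sum_def
    proof (rule finsum_reindex[OF _ inj])
      show "(\<lambda>a. c (?v a) \<otimes> (\<Otimes>i\<in>{..<n}. t i [^] a i)) \<in> ?u ` A \<rightarrow> carrier R"
      proof
        fix a assume "a \<in> ?u ` A"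
        then obtain b where b: "b \<in> A" "a = ?u b" by blast
        have "c (?v a) \<in> carrier R" unfolding b(2) vu using b(1) A by auto
        then show "c (?v a) \<otimes> (\<Otimes>i\<in>{..<n}. t i [^] a i) \<in> carrier R" using m by blast
      qed
    qed
    also have "\<dots> = (\<Oplus>a\<in>A. c a \<otimes> (\<Otimes>j\<in>{..<n}. t j [^] a j) \<otimes> t i)"
    proof (rule finsum_cong'[OF refl])
      show "(\<lambda>a. c a \<otimes> (\<Otimes>j\<in>{..<n}. t j [^] a j) \<otimes> t i) \<in> A \<rightarrow> carrier R" using A m ti by (auto simp: Pi_iff)
      fix a assume "a \<in> A"
      then have ca: "c a \<in> carrier R" using A by auto
      show "c (?v (?u a)) \<otimes> (\<Otimes>j\<in>{..<n}. t j [^] (?u a j)) = c a \<otimes> (\<Otimes>j\<in>{..<n}. t j [^] a j) \<otimes> t i"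
        unfolding vu monom_times_var[OF t assms(2)] using ca m[of a] ti by (simp only: m_assoc)
    qed
    also have "\<dots> = monom_sum R n A c t \<otimes> t i"
      unfolding monom_sum_def
      by (rule finsum_ldistr[symmetric]) (use A m ti in \<open>auto simp: Pi_iff\<close>)
    finally show "h t = monom_sum R n (?u ` A) (\<lambda>a. c (?v a)) t"
      using A t assms(3) by simp
  qed
qed

lemma coord_poly_lt_finsum:
  assumes "finite I" "\<And>i. i \<in> I \<Longrightarrow> coord_poly_lt R n e (g i)"
    "\<And>i t. i \<in> I \<Longrightarrow> t \<in> {..<n} \<rightarrow>\<^sub>E carrier R \<Longrightarrow> g i t \<in> carrier R"
    "\<And>t. t \<in> {..<n} \<rightarrow>\<^sub>E carrier R \<Longrightarrow> h t = (\<Oplus>i\<in>I. g i t)"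
  shows "coord_poly_lt R n e h"
  using assms
proof (induction I arbitrary: h)
  case empty
  show ?case by (rule coord_poly_lt_zero) (simp add: empty.prems(3))
next
  case (insert i I)
  have 1: "coord_poly_lt R n e (\<lambda>t. \<Oplus>i\<in>I. g i t)"
    by (rule insert.IH) (simp_all add: insert.prems(1,2))
  have 2: "coord_poly_lt R n e (g i)" by (simp add: insert.prems(1))
  show ?case
  proof (rule coord_poly_lt_add[OF 2 1])
    fix t assume t: "t \<in> {..<n} \<rightarrow>\<^sub>E carrier R"
    have "(\<Oplus>i\<in>insert i I. g i t) = g i t \<oplus> (\<Oplus>i\<in>I. g i t)"
      by (rule finsum_insert) (use insert.hyps in \<open>auto intro!: insert.prems(2) t\<close>)
    then show "h t = g i t \<oplus> (\<Oplus>i\<in>I. g i t)" using insert.prems(3)[OF t] by simp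
  qed
qed

end

text \<open>In a basis a linear form is a combination of the coordinates, so the rule
  \<open>mult\<close> becomes a sum of multiplications by single variables, each of which raises one
  exponent. Subtracting 1 undoes the strictness of the index; m = 0 gives -1, the zero
  function.\<close>

lemma poly_lt_fun_le:
  assumes "field K" "module K V" "\<exists>n b. is_basis K V n b" "poly_lt K V m f"
  shows "restrict f (carrier V) \<in> fun_le K V (int m - 1)"
proof -
  interpret K: field K by fact
  interpret V: module K V by fact
  obtain n b where b: "is_basis K V n b" using assms(3) by blast
  have bV: "i < n \<Longrightarrow> b i \<in> carrier V" for i using b by (simp add: is_basis_def)
  have LV: "lin_comb V n b t \<in> carrier V" if "t \<in> {..<n} \<rightarrow>\<^sub>E carrier K" for t
    by (rule lin_comb_closed[OF assms(2)]) (use bV that in auto)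
  have "coord_poly_lt K n m (\<lambda>t. f (lin_comb V n b t))"
    using assms(4)
  proof induction
    case (zero g m)
    then show ?case by (intro K.coord_poly_lt_zero) (simp add: LV)
  next
    case (const c g m)
    then show ?case by (intro K.coord_poly_lt_const[of c]) (simp_all add: LV)
  next
    case (add m f g h)
    show ?case by (rule K.coord_poly_lt_add[OF add.IH]) (simp add: LV add.hyps)
  next
    case (mult m f l h)
    have lb: "l (b i) \<in> carrier K" if "i < n" for i
      by (rule linear_form_closed[OF mult.hyps(2) bV[OF that]])
    have fK: "f (lin_comb V n b t) \<in> carrier K" if "t \<in> {..<n} \<rightarrow>\<^sub>E carrier K" for t
      by (rule poly_lt_closed[OF assms(2) mult.hyps(1) LV[OF that]])
    show ?case
    proof (rule K.coord_poly_lt_finsum)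
      show "finite {..<n}" by simp
      show "coord_poly_lt K n (Suc m) (\<lambda>t. l (b i) \<otimes>\<^bsub>K\<^esub> (f (lin_comb V n b t) \<otimes>\<^bsub>K\<^esub> t i))"
        if "i \<in> {..<n}" for i
        by (rule K.coord_poly_lt_smult[OF K.coord_poly_lt_var[OF mult.IH]]) (use that lb in auto)
      fix t assume t: "t \<in> {..<n} \<rightarrow>\<^sub>E carrier K"
      have tK: "t i \<in> carrier K" if "i < n" for i using t that by auto
      show "l (b i) \<otimes>\<^bsub>K\<^esub> (f (lin_comb V n b t) \<otimes>\<^bsub>K\<^esub> t i) \<in> carrier K" if "i \<in> {..<n}" for i
        using that lb fK[OF t] tK by auto
      have "l (lin_comb V n b t) = (\<Oplus>\<^bsub>K\<^esub>i\<in>{..<n}. l (t i \<odot>\<^bsub>V\<^esub> b i))"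
        unfolding lin_comb_def
        by (rule linear_form_finsum[OF assms(2) mult.hyps(2)]) (use tK bV in auto)
      also have "\<dots> = (\<Oplus>\<^bsub>K\<^esub>i\<in>{..<n}. t i \<otimes>\<^bsub>K\<^esub> l (b i))"
        by (rule K.finsum_cong') (use tK bV lb in \<open>auto simp: linear_form_smult[OF mult.hyps(2)]\<close>)
      finally have "h (lin_comb V n b t) = f (lin_comb V n b t) \<otimes>\<^bsub>K\<^esub> (\<Oplus>\<^bsub>K\<^esub>i\<in>{..<n}. t i \<otimes>\<^bsub>K\<^esub> l (b i))"
        by (simp add: mult.hyps LV t)
      also have "\<dots> = (\<Oplus>\<^bsub>K\<^esub>i\<in>{..<n}. f (lin_comb V n b t) \<otimes>\<^bsub>K\<^esub> (t i \<otimes>\<^bsub>K\<^esub> l (b i)))"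
        by (rule K.finsum_rdistr) (use fK[OF t] tK lb in auto)
      also have "\<dots> = (\<Oplus>\<^bsub>K\<^esub>i\<in>{..<n}. l (b i) \<otimes>\<^bsub>K\<^esub> (f (lin_comb V n b t) \<otimes>\<^bsub>K\<^esub> t i))"
        by (rule K.finsum_cong') (use fK[OF t] tK lb in \<open>auto simp: K.m_ac\<close>)
      finally show "h (lin_comb V n b t) = (\<Oplus>\<^bsub>K\<^esub>i\<in>{..<n}. l (b i) \<otimes>\<^bsub>K\<^esub> (f (lin_comb V n b t) \<otimes>\<^bsub>K\<^esub> t i))" .
    qed
  qed
  then obtain A c where A: "finite A" "\<forall>a\<in>A. (\<Sum>i<n. a i) < m" "c \<in> A \<rightarrow> carrier K"
    "\<forall>t\<in>{..<n} \<rightarrow>\<^sub>E carrier K. f (lin_comb V n b t) = monom_sum K n A c t"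
    unfolding coord_poly_lt_def by (elim exE conjE)
  show ?thesis
    unfolding fun_le_def mem_Collect_eq
  proof (intro conjI exI)
    show "restrict f (carrier V) \<in> carrier (fun_ring K V)"
      by (auto simp: fun_ring_def intro!: poly_lt_closed[OF assms(2,4)])
    show "is_basis K V n b" by fact
    show "finite A" by fact
    show "c \<in> A \<rightarrow> carrier K" by fact
    have "int (\<Sum>i<n. a i) \<le> int m - 1" if "a \<in> A" for a
    proof -
      have "(\<Sum>i<n. a i) < m" using that A by blast
      then show ?thesis by linarith
    qed
    then show "\<forall>a\<in>A. int (\<Sum>i<n. a i) \<le> int m - 1" by blast
    show "\<forall>t\<in>{..<n} \<rightarrow>\<^sub>E carrier K. restrict f (carrier V) (lin_comb V n b t) =
            (\<Oplus>\<^bsub>K\<^esub>a\<in>A. c a \<otimes>\<^bsub>K\<^esub> (\<Otimes>\<^bsub>K\<^esub>i\<in>{..<n}. t i [^]\<^bsub>K\<^esub> (a i :: nat)))"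
      using A(4) by (simp add: LV monom_sum_def)
  qed
qed

section \<open>Every function on a finite vector space is polynomial\<close>

lemma linear_form_minus_const:
  assumes "field K" "module K V" "linear_form K V l" "c \<in> carrier K" "d \<in> carrier K"
  shows "poly_lt K V 2 (\<lambda>x. d \<otimes>\<^bsub>K\<^esub> (l x \<ominus>\<^bsub>K\<^esub> c))"
proof -
  interpret K: field K by fact
  interpret V: module K V by fact
  have "poly_lt K V (Suc 0) (\<lambda>x. \<one>\<^bsub>K\<^esub>)" "poly_lt K V (Suc (Suc 0)) (\<lambda>x. c)"
    using assms by (auto intro: poly_lt.const)
  moreover from this(1) have "poly_lt K V (Suc (Suc 0)) l"
    by (rule poly_lt.mult[OF _ assms(3)]) (simp add: linear_form_closed[OF assms(3)])
  ultimately show ?thesis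
    unfolding numeral_2_eq_2 by (intro poly_lt_smult poly_lt_minus assms)
qed

text \<open>Lagrange interpolation, with a product of affine functions over all coordinates and all
  wrong values.\<close>

lemma indicator_poly_lt:
  assumes "field K" "finite (carrier K)" "module K V" "is_basis K V n b" "p \<in> carrier V"
  shows "\<exists>m. poly_lt K V m (\<lambda>x. if x = p then \<one>\<^bsub>K\<^esub> else \<zero>\<^bsub>K\<^esub>)"
proof -
  interpret K: field K by fact
  interpret V: module K V by fact
  obtain co where co': "(\<forall>i<n. linear_form K V (co i)) \<and>
    (\<forall>t\<in>{..<n} \<rightarrow>\<^sub>E carrier K. \<forall>i<n. co i (lin_comb V n b t) = t i) \<and>
    (\<forall>x\<in>carrier V. lin_comb V n b (\<lambda>i\<in>{..<n}. co i x) = x)"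
    using basis_coordinates[OF assms(3,4)] by (elim exE)
  then have co: "\<And>i. i < n \<Longrightarrow> linear_form K V (co i)"
      "\<And>x. x \<in> carrier V \<Longrightarrow> lin_comb V n b (\<lambda>i\<in>{..<n}. co i x) = x"
    by blast+
  have coK: "co i x \<in> carrier K" if "i < n" "x \<in> carrier V" for i x
    by (rule linear_form_closed[OF co(1)[OF that(1)] that(2)])
  \<comment> \<open>One factor for each coordinate \<open>i\<close> and each value \<open>c\<close>
    other than that of \<open>p\<close>. Every factor is 1 at \<open>p\<close>; a point
    \<open>x\<close> that differs from \<open>p\<close> in coordinate \<open>i\<close> is
    annihilated by the factor with \<open>c = co i x\<close>.\<close>
  define S where "S = (SIGMA i:{..<n}. carrier K - {co i p})"
  have finS: "finite S" using assms(2) by (simp add: S_def)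
  define u where "u = (\<lambda>(i, c) x. inv\<^bsub>K\<^esub> (co i p \<ominus>\<^bsub>K\<^esub> c) \<otimes>\<^bsub>K\<^esub> (co i x \<ominus>\<^bsub>K\<^esub> c))"
  have nz: "co i p \<ominus>\<^bsub>K\<^esub> c \<in> Units K" if "(i, c) \<in> S" for i c
    using that coK assms(5) K.minus_eq_zeroD[of "co i p" c]
    by (auto simp: S_def K.field_Units)
  have u: "poly_lt K V (Suc 1) (u s)" if "s \<in> S" for s
  proof -
    obtain i c where s: "s = (i, c)" by fastforce
    have "poly_lt K V 2 (\<lambda>x. inv\<^bsub>K\<^esub> (co i p \<ominus>\<^bsub>K\<^esub> c) \<otimes>\<^bsub>K\<^esub> (co i x \<ominus>\<^bsub>K\<^esub> c))"
      by (rule linear_form_minus_const[OF assms(1,3)])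
        (use that s nz[of i c] co(1) in \<open>auto simp: S_def\<close>)
    then show ?thesis by (simp add: u_def s numeral_2_eq_2)
  qed
  have "poly_lt K V (Suc (\<Sum>s\<in>S. 1)) (\<lambda>x. \<Otimes>\<^bsub>K\<^esub>s\<in>S. u s x)"
    by (rule poly_lt_finprod[OF assms(3) finS u])
  then have "poly_lt K V (Suc (\<Sum>s\<in>S. 1)) (\<lambda>x. if x = p then \<one>\<^bsub>K\<^esub> else \<zero>\<^bsub>K\<^esub>)"
  proof (rule poly_lt_cong)
    fix x assume x: "x \<in> carrier V"
    have uK: "u s x \<in> carrier K" if "s \<in> S" for s by (rule poly_lt_closed[OF assms(3) u[OF that] x])
    show "(if x = p then \<one>\<^bsub>K\<^esub> else \<zero>\<^bsub>K\<^esub>) = (\<Otimes>\<^bsub>K\<^esub>s\<in>S. u s x)"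
    proof (cases "x = p")
      case True
      have "(\<Otimes>\<^bsub>K\<^esub>s\<in>S. u s x) = (\<Otimes>\<^bsub>K\<^esub>s\<in>S. \<one>\<^bsub>K\<^esub>)"
        by (rule K.finprod_cong') (use True nz in \<open>auto simp: u_def\<close>)
      then show ?thesis using True by simp
    next
      case False
      have "\<exists>i<n. co i x \<noteq> co i p"
      proof (rule ccontr)
        assume "\<not> ?thesis"
        then have "(\<lambda>i\<in>{..<n}. co i x) = (\<lambda>i\<in>{..<n}. co i p)" by auto
        then show False using co(2)[OF x] co(2)[OF assms(5)] False by simp
      qed
      then obtain i where i: "i < n" "co i x \<noteq> co i p" by blast
      let ?s = "(i, co i x)"
      have s: "?s \<in> S" using i coK x by (simp add: S_def)
      have "u ?s x = \<zero>\<^bsub>K\<^esub>"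
        using nz[OF s] coK[OF i(1) x] by (simp add: u_def K.minus_eq K.r_neg)
      moreover have "S = insert ?s (S - {?s})" using s by auto
      then have "(\<Otimes>\<^bsub>K\<^esub>s\<in>S. u s x) = u ?s x \<otimes>\<^bsub>K\<^esub> (\<Otimes>\<^bsub>K\<^esub>s\<in>S - {?s}. u s x)"
        using K.finprod_insert[of "S - {?s}" ?s "\<lambda>s. u s x"] finS uK s by auto
      moreover have "(\<Otimes>\<^bsub>K\<^esub>s\<in>S - {?s}. u s x) \<in> carrier K"
        by (rule K.finprod_closed) (use uK in auto)
      ultimately show ?thesis using False by simp
    qed
  qed
  then show ?thesis by blast
qed

text \<open>A sum of indicators weighted by values. It makes \<open>fun_degree\<close> a minimum
  over a nonempty set, although K[V] is defined as the algebra of all functions.\<close>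

lemma function_poly_lt:
  assumes "field K" "finite (carrier K)" "module K V" "is_basis K V n b" "finite (carrier V)"
    "\<And>x. x \<in> carrier V \<Longrightarrow> f x \<in> carrier K"
  shows "\<exists>m. poly_lt K V m f"
proof -
  interpret K: field K by fact
  interpret V: module K V by fact
  have "\<exists>m. poly_lt K V m (\<lambda>x. if x \<in> S then f x else \<zero>\<^bsub>K\<^esub>)" if "S \<subseteq> carrier V" for S
    using finite_subset[OF that assms(5)] that
  proof (induction S)
    case empty
    then show ?case by (auto intro: poly_lt.zero)
  next
    case (insert p S)
    then obtain m where m: "poly_lt K V m (\<lambda>x. if x \<in> S then f x else \<zero>\<^bsub>K\<^esub>)" by auto
    have p: "p \<in> carrier V" "f p \<in> carrier K" using insert assms(6) by auto
    obtain m' where m': "poly_lt K V m' (\<lambda>x. if x = p then \<one>\<^bsub>K\<^esub> else \<zero>\<^bsub>K\<^esub>)"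
      using indicator_poly_lt[OF assms(1-4) p(1)] by blast
    have 1: "poly_lt K V (max m m') (\<lambda>x. if x \<in> S then f x else \<zero>\<^bsub>K\<^esub>)"
      by (rule poly_lt_mono[OF m]) simp
    have 2: "poly_lt K V (max m m') (\<lambda>x. f p \<otimes>\<^bsub>K\<^esub> (if x = p then \<one>\<^bsub>K\<^esub> else \<zero>\<^bsub>K\<^esub>))"
      by (rule poly_lt_smult[OF assms(3) poly_lt_mono[OF m'] p(2)]) simp
    have "poly_lt K V (max m m') (\<lambda>x. if x \<in> insert p S then f x else \<zero>\<^bsub>K\<^esub>)"
      by (rule poly_lt.add[OF 1 2]) (use insert.hyps p assms(6) in auto)
    then show ?case by blast
  qed
  from this[of "carrier V"] obtain m where "poly_lt K V m (\<lambda>x. if x \<in> carrier V then f x else \<zero>\<^bsub>K\<^esub>)"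
    by blast
  then have "poly_lt K V m f" by (rule poly_lt_cong) simp
  then show ?thesis ..
qed

section \<open>Spaces of homomorphisms, direct sums and complements\<close>

lemma Vec_module: "V \<in> Vec K \<Longrightarrow> module K V"
  by (simp add: Vec_def)

lemma Vec_finite:
  assumes "finite (carrier K)" "V \<in> Vec K"
  shows "finite (carrier V)"
proof -
  obtain n b where "is_basis K V n b" using assms(2) by (auto simp: Vec_def)
  then have "bij_betw (lin_comb V n b) ({..<n} \<rightarrow>\<^sub>E carrier K) (carrier V)"
    by (simp add: is_basis_def)
  moreover have "finite ({..<n} \<rightarrow>\<^sub>E carrier K)" using assms(1) by (intro finite_PiE) auto
  ultimately show ?thesis by (simp add: bij_betw_finite)
qed

text \<open>Over a finite field, finite-dimensional means finite. Hom spaces and direct sums thereby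
  enter \<open>Vec K\<close> by counting instead of by an explicit basis.\<close>

lemma VecI:
  assumes "field K" "finite (carrier K)" "module K V" "finite (carrier V)"
  shows "V \<in> Vec K"
  using finite_module_basis[OF assms] assms(3) by (simp add: Vec_def)

lemma HomD:
  assumes "\<phi> \<in> Hom K V W"
  shows "x \<in> carrier V \<Longrightarrow> \<phi> x \<in> carrier W"
    "x \<in> carrier V \<Longrightarrow> y \<in> carrier V \<Longrightarrow> \<phi> (x \<oplus>\<^bsub>V\<^esub> y) = \<phi> x \<oplus>\<^bsub>W\<^esub> \<phi> y"
    "a \<in> carrier K \<Longrightarrow> x \<in> carrier V \<Longrightarrow> \<phi> (a \<odot>\<^bsub>V\<^esub> x) = a \<odot>\<^bsub>W\<^esub> \<phi> x"
    "x \<notin> carrier V \<Longrightarrow> \<phi> x = undefined"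
  using assms by (simp_all add: Hom_def PiE_iff extensional_def)

lemma Hom_eqI:
  assumes "\<phi> \<in> Hom K V W" "\<psi> \<in> Hom K V W" "\<And>x. x \<in> carrier V \<Longrightarrow> \<phi> x = \<psi> x"
  shows "\<phi> = \<psi>"
proof
  fix x show "\<phi> x = \<psi> x" using assms(3) HomD(4)[OF assms(1)] HomD(4)[OF assms(2)] by (cases "x \<in> carrier V") auto
qed

lemma hom_space_simps:
  "carrier (hom_space K V W) = Hom K V W"
  "\<zero>\<^bsub>hom_space K V W\<^esub> = (\<lambda>x\<in>carrier V. \<zero>\<^bsub>W\<^esub>)"
  "\<phi> \<oplus>\<^bsub>hom_space K V W\<^esub> \<psi> = (\<lambda>x\<in>carrier V. \<phi> x \<oplus>\<^bsub>W\<^esub> \<psi> x)"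
  "a \<odot>\<^bsub>hom_space K V W\<^esub> \<phi> = (\<lambda>x\<in>carrier V. a \<odot>\<^bsub>W\<^esub> \<phi> x)"
  by (simp_all add: hom_space_def)

lemma zero_in_Hom:
  assumes "module K V" "module K W"
  shows "(\<lambda>x\<in>carrier V. \<zero>\<^bsub>W\<^esub>) \<in> Hom K V W"
proof -
  interpret V: module K V by fact
  interpret W: module K W by fact
  show ?thesis by (rule restrict_in_Hom[OF assms(1)]) (simp add: linear_map_def)
qed

lemma add_in_Hom:
  assumes "module K V" "module K W" "\<phi> \<in> Hom K V W" "\<psi> \<in> Hom K V W"
  shows "(\<lambda>x\<in>carrier V. \<phi> x \<oplus>\<^bsub>W\<^esub> \<psi> x) \<in> Hom K V W"
proof -
  interpret V: module K V by fact
  interpret W: module K W by fact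
  note p = HomD[OF assms(3)] and q = HomD[OF assms(4)]
  show ?thesis
    by (rule restrict_in_Hom[OF assms(1)])
      (use p(1) q(1) in \<open>auto simp: linear_map_def p(2,3) q(2,3) W.smult_r_distr W.a_ac\<close>)
qed

lemma smult_in_Hom:
  assumes "module K V" "module K W" "\<phi> \<in> Hom K V W" "a \<in> carrier K"
  shows "(\<lambda>x\<in>carrier V. a \<odot>\<^bsub>W\<^esub> \<phi> x) \<in> Hom K V W"
proof -
  interpret V: module K V by fact
  interpret W: module K W by fact
  note p = HomD[OF assms(3)]
  have "a \<odot>\<^bsub>W\<^esub> (b \<odot>\<^bsub>W\<^esub> \<phi> x) = b \<odot>\<^bsub>W\<^esub> (a \<odot>\<^bsub>W\<^esub> \<phi> x)" if "b \<in> carrier K" "x \<in> carrier V" for b x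
    using that assms(4) p(1) by (simp add: W.smult_assoc1[symmetric] V.R.m_comm)
  then show ?thesis
    by (intro restrict_in_Hom[OF assms(1)])
      (use p(1) assms(4) in \<open>auto simp: linear_map_def p(2,3) W.smult_r_distr\<close>)
qed

lemma module_hom_space:
  assumes "module K V" "module K W"
  shows "module K (hom_space K V W)"
proof -
  interpret V: module K V by fact
  interpret W: module K W by fact
  show ?thesis
  proof (rule moduleI)
    show "cring K" by (rule V.R.is_cring)
    show "abelian_group (hom_space K V W)"
    proof (rule abelian_groupI)
      fix \<phi> assume p: "\<phi> \<in> carrier (hom_space K V W)"
      then have p: "\<phi> \<in> Hom K V W" by (simp add: hom_space_simps)
      have "(\<lambda>x\<in>carrier V. (\<ominus>\<^bsub>K\<^esub> \<one>\<^bsub>K\<^esub>) \<odot>\<^bsub>W\<^esub> \<phi> x) \<in> Hom K V W"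
        by (rule smult_in_Hom[OF assms p]) simp
      moreover have "(\<ominus>\<^bsub>K\<^esub> \<one>\<^bsub>K\<^esub>) \<odot>\<^bsub>W\<^esub> \<phi> x \<oplus>\<^bsub>W\<^esub> \<phi> x = \<zero>\<^bsub>W\<^esub>" if "x \<in> carrier V" for x
        using HomD(1)[OF p that] by (simp add: W.smult_l_minus W.l_neg)
      ultimately show "\<exists>\<psi>\<in>carrier (hom_space K V W). \<psi> \<oplus>\<^bsub>hom_space K V W\<^esub> \<phi> = \<zero>\<^bsub>hom_space K V W\<^esub>"
        by (intro bexI[of _ "\<lambda>x\<in>carrier V. (\<ominus>\<^bsub>K\<^esub> \<one>\<^bsub>K\<^esub>) \<odot>\<^bsub>W\<^esub> \<phi> x"])
          (auto simp: hom_space_simps)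
      show "\<zero>\<^bsub>hom_space K V W\<^esub> \<oplus>\<^bsub>hom_space K V W\<^esub> \<phi> = \<phi>"
        by (rule Hom_eqI[OF _ p]) (use HomD(1)[OF p] add_in_Hom[OF assms zero_in_Hom[OF assms] p] in
          \<open>auto simp: hom_space_simps\<close>)
    next
      fix \<phi> \<psi> assume "\<phi> \<in> carrier (hom_space K V W)" "\<psi> \<in> carrier (hom_space K V W)"
      then have p: "\<phi> \<in> Hom K V W" "\<psi> \<in> Hom K V W" by (auto simp: hom_space_simps)
      show "\<phi> \<oplus>\<^bsub>hom_space K V W\<^esub> \<psi> \<in> carrier (hom_space K V W)"
        using add_in_Hom[OF assms p] by (simp add: hom_space_simps)
      show "\<phi> \<oplus>\<^bsub>hom_space K V W\<^esub> \<psi> = \<psi> \<oplus>\<^bsub>hom_space K V W\<^esub> \<phi>"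
        using HomD(1)[OF p(1)] HomD(1)[OF p(2)] by (auto simp: hom_space_simps W.a_comm)
      fix \<chi> assume "\<chi> \<in> carrier (hom_space K V W)"
      then have c: "\<chi> \<in> Hom K V W" by (simp add: hom_space_simps)
      show "\<phi> \<oplus>\<^bsub>hom_space K V W\<^esub> \<psi> \<oplus>\<^bsub>hom_space K V W\<^esub> \<chi> = \<phi> \<oplus>\<^bsub>hom_space K V W\<^esub> (\<psi> \<oplus>\<^bsub>hom_space K V W\<^esub> \<chi>)"
        using HomD(1)[OF p(1)] HomD(1)[OF p(2)] HomD(1)[OF c]
        by (auto simp: hom_space_simps W.a_assoc)
    next
      show "\<zero>\<^bsub>hom_space K V W\<^esub> \<in> carrier (hom_space K V W)"
        using zero_in_Hom[OF assms] by (simp add: hom_space_simps)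
    qed
  next
    fix \<phi> assume "\<phi> \<in> carrier (hom_space K V W)"
    then have p: "\<phi> \<in> Hom K V W" by (simp add: hom_space_simps)
    note pc = HomD(1)[OF p]
    show "\<one>\<^bsub>K\<^esub> \<odot>\<^bsub>hom_space K V W\<^esub> \<phi> = \<phi>"
      by (rule Hom_eqI[OF _ p])
        (use smult_in_Hom[OF assms p, of "\<one>\<^bsub>K\<^esub>"] pc in \<open>auto simp: hom_space_simps\<close>)
  next
    fix a \<phi> assume a: "a \<in> carrier K" and "\<phi> \<in> carrier (hom_space K V W)"
    then have p: "\<phi> \<in> Hom K V W" by (simp add: hom_space_simps)
    note pc = HomD(1)[OF p]
    show "a \<odot>\<^bsub>hom_space K V W\<^esub> \<phi> \<in> carrier (hom_space K V W)"
      using smult_in_Hom[OF assms p a] by (simp add: hom_space_simps)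
    {
      fix b assume b: "b \<in> carrier K"
      show "(a \<oplus>\<^bsub>K\<^esub> b) \<odot>\<^bsub>hom_space K V W\<^esub> \<phi> =
          a \<odot>\<^bsub>hom_space K V W\<^esub> \<phi> \<oplus>\<^bsub>hom_space K V W\<^esub> b \<odot>\<^bsub>hom_space K V W\<^esub> \<phi>"
        using a b pc by (auto simp: hom_space_simps W.smult_l_distr)
      show "(a \<otimes>\<^bsub>K\<^esub> b) \<odot>\<^bsub>hom_space K V W\<^esub> \<phi> = a \<odot>\<^bsub>hom_space K V W\<^esub> (b \<odot>\<^bsub>hom_space K V W\<^esub> \<phi>)"
        using a b pc by (auto simp: hom_space_simps W.smult_assoc1)
    }
    fix \<psi> assume "\<psi> \<in> carrier (hom_space K V W)"
    then have q: "\<psi> \<in> Hom K V W" by (simp add: hom_space_simps)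
    show "a \<odot>\<^bsub>hom_space K V W\<^esub> (\<phi> \<oplus>\<^bsub>hom_space K V W\<^esub> \<psi>) =
        a \<odot>\<^bsub>hom_space K V W\<^esub> \<phi> \<oplus>\<^bsub>hom_space K V W\<^esub> a \<odot>\<^bsub>hom_space K V W\<^esub> \<psi>"
      using a pc HomD(1)[OF q] by (auto simp: hom_space_simps W.smult_r_distr)
  qed
qed

lemma hom_space_finsum:
  assumes "module K V" "module K W" "finite A" "g \<in> A \<rightarrow> Hom K V W" "x \<in> carrier V"
  shows "(\<Oplus>\<^bsub>hom_space K V W\<^esub>i\<in>A. g i) x = (\<Oplus>\<^bsub>W\<^esub>i\<in>A. g i x)"
proof -
  have "linear_map K (hom_space K V W) W (\<lambda>\<phi>. \<phi> x)"
    using assms(5) by (auto simp: linear_map_def hom_space_simps HomD(1))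
  from linear_map_finsum[OF module_hom_space[OF assms(1,2)] assms(2) this assms(3)] assms(4)
  show ?thesis by (simp add: hom_space_simps)
qed

lemma Hom_finite:
  assumes "finite (carrier V)" "finite (carrier W)"
  shows "finite (Hom K V W)"
proof -
  have "finite (carrier V \<rightarrow>\<^sub>E carrier W)" using assms by (intro finite_PiE) auto
  then show ?thesis by (rule finite_subset[rotated]) (auto simp: Hom_def)
qed

lemma hom_space_Vec:
  assumes "field K" "finite (carrier K)" "V \<in> Vec K" "W \<in> Vec K"
  shows "hom_space K V W \<in> Vec K"
  by (rule VecI[OF assms(1,2)])
    (simp_all add: hom_space_simps(1) module_hom_space Hom_finite assms Vec_module[of _ K] Vec_finite[of K])

lemma compose_in_Hom:
  assumes "module K U" "\<phi> \<in> Hom K U V" "\<psi> \<in> Hom K V W"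
  shows "compose (carrier U) \<psi> \<phi> \<in> Hom K U W"
  unfolding compose_def
  by (rule restrict_in_Hom[OF assms(1)])
    (use HomD(1)[OF assms(2)] HomD(1)[OF assms(3)] in
      \<open>auto simp: linear_map_def HomD(2,3)[OF assms(2)] HomD(2,3)[OF assms(3)]\<close>)

lemma id_in_Hom: "module K V \<Longrightarrow> (\<lambda>x\<in>carrier V. x) \<in> Hom K V V"
  by (rule restrict_in_Hom) (auto simp: linear_map_def)

section \<open>Direct sums and maps out of them\<close>

lemma dsum_simps:
  "Duo u w \<in> carrier (dsum U W) \<longleftrightarrow> u \<in> carrier U \<and> w \<in> carrier W"
  "\<zero>\<^bsub>dsum U W\<^esub> = Duo \<zero>\<^bsub>U\<^esub> \<zero>\<^bsub>W\<^esub>"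
  "Duo u w \<oplus>\<^bsub>dsum U W\<^esub> Duo u' w' = Duo (u \<oplus>\<^bsub>U\<^esub> u') (w \<oplus>\<^bsub>W\<^esub> w')"
  "a \<odot>\<^bsub>dsum U W\<^esub> Duo u w = Duo (a \<odot>\<^bsub>U\<^esub> u) (a \<odot>\<^bsub>W\<^esub> w)"
  by (simp_all add: dsum_def)

lemma dsum_cases:
  assumes "x \<in> carrier (dsum U W)"
  obtains u w where "x = Duo u w" "u \<in> carrier U" "w \<in> carrier W"
  using assms by (auto simp: dsum_def)

lemma module_dsum:
  assumes "module K U" "module K W"
  shows "module K (dsum U W)"
proof -
  interpret U: module K U by fact
  interpret W: module K W by fact
  show ?thesis
  proof (rule moduleI)
    show "cring K" by (rule U.R.is_cring)
    show "abelian_group (dsum U W)"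
    proof (rule abelian_groupI)
      fix x assume "x \<in> carrier (dsum U W)"
      then obtain u w where x: "x = Duo u w" "u \<in> carrier U" "w \<in> carrier W" by (rule dsum_cases)
      then show "\<exists>y\<in>carrier (dsum U W). y \<oplus>\<^bsub>dsum U W\<^esub> x = \<zero>\<^bsub>dsum U W\<^esub>"
        by (intro bexI[of _ "Duo (\<ominus>\<^bsub>U\<^esub> u) (\<ominus>\<^bsub>W\<^esub> w)"]) (auto simp: dsum_simps U.l_neg W.l_neg)
    qed (auto elim!: dsum_cases simp: dsum_simps U.a_ac W.a_ac)
  qed (auto elim!: dsum_cases simp: dsum_simps U.smult_l_distr W.smult_l_distr
      U.smult_r_distr W.smult_r_distr U.smult_assoc1 W.smult_assoc1)
qed

lemma dsum_Vec:
  assumes "field K" "finite (carrier K)" "U \<in> Vec K" "W \<in> Vec K"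
  shows "dsum U W \<in> Vec K"
proof (rule VecI[OF assms(1,2)])
  show "module K (dsum U W)" using assms by (intro module_dsum Vec_module)
  have "carrier (dsum U W) = (\<lambda>(u, w). Duo u w) ` (carrier U \<times> carrier W)"
    by (auto simp: dsum_def)
  then show "finite (carrier (dsum U W))"
    using assms by (simp add: Vec_finite)
qed

lemma dsum_fst_Hom:
  assumes "module K U" "module K W"
  shows "dsum_fst U W \<in> Hom K (dsum U W) U"
  unfolding dsum_fst_def
  by (rule restrict_in_Hom[OF module_dsum[OF assms]])
    (auto simp: linear_map_def dsum_simps elim!: dsum_cases)

lemma dsum_inr_Hom:
  assumes "module K U" "module K W"
  shows "dsum_inr U W \<in> Hom K W (dsum U W)"
proof -
  interpret U: module K U by fact
  show ?thesis unfolding dsum_inr_def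
    by (rule restrict_in_Hom[OF assms(2)]) (auto simp: linear_map_def dsum_simps)
qed

text \<open>The pair (\<phi>, \<psi>) of the overview. For fixed \<open>\<psi>\<close>, varying
  \<open>\<phi>\<close> sweeps out an affine subspace of Hom(U \<oplus> W, V).\<close>

definition copair ::
    "('k, 'a elem) module \<Rightarrow> ('k, 'a elem) module \<Rightarrow> ('k, 'v) module \<Rightarrow>
     ('a elem \<Rightarrow> 'v) \<Rightarrow> ('a elem \<Rightarrow> 'v) \<Rightarrow> 'a elem \<Rightarrow> 'v" where
  "copair U W V \<phi> \<psi> = (\<lambda>x\<in>carrier (dsum U W). \<phi> (lpart x) \<oplus>\<^bsub>V\<^esub> \<psi> (rpart x))"

lemma copair_Hom:
  assumes "module K U" "module K W" "module K V" "\<phi> \<in> Hom K U V" "\<psi> \<in> Hom K W V"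
  shows "copair U W V \<phi> \<psi> \<in> Hom K (dsum U W) V"
proof -
  interpret V: module K V by fact
  note p = HomD[OF assms(4)] and q = HomD[OF assms(5)]
  show ?thesis unfolding copair_def
    by (rule restrict_in_Hom[OF module_dsum[OF assms(1,2)]])
      (use p(1) q(1) in \<open>auto simp: linear_map_def dsum_simps p(2,3) q(2,3) V.smult_r_distr V.a_ac
        elim!: dsum_cases\<close>)
qed

lemma dsum_fst_inr:
  assumes "module K U" "module K W"
  shows "compose (carrier W) (dsum_fst U W) (dsum_inr U W) = (\<lambda>x\<in>carrier W. \<zero>\<^bsub>U\<^esub>)"
proof -
  interpret U: module K U by fact
  show ?thesis by (auto simp: compose_def dsum_fst_def dsum_inr_def dsum_simps)
qed

lemma copair_inr:
  assumes "module K U" "module K W" "module K V" "\<phi> \<in> Hom K U V" "\<psi> \<in> Hom K W V"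
  shows "compose (carrier W) (copair U W V \<phi> \<psi>) (dsum_inr U W) = \<psi>"
proof (rule Hom_eqI)
  interpret U: module K U by fact
  interpret V: module K V by fact
  show "compose (carrier W) (copair U W V \<phi> \<psi>) (dsum_inr U W) \<in> Hom K W V"
    by (rule compose_in_Hom[OF assms(2) dsum_inr_Hom[OF assms(1,2)] copair_Hom[OF assms]])
  show "\<psi> \<in> Hom K W V" by fact
  have "\<phi> \<zero>\<^bsub>U\<^esub> = \<zero>\<^bsub>V\<^esub>" by (rule linear_map_zero[OF assms(1,3) Hom_linear_map[OF assms(4)]])
  then show "compose (carrier W) (copair U W V \<phi> \<psi>) (dsum_inr U W) x = \<psi> x" if "x \<in> carrier W" for x
    using that HomD(1)[OF assms(5) that]
    by (simp add: compose_def copair_def dsum_inr_def dsum_simps)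
qed

text \<open>At \<psi> = 0 the pair factors through U, so its effect on a point of P(U \<oplus> W)
  depends on the component in P(U) only.\<close>

lemma copair_zero:
  assumes "module K U" "module K W" "module K V" "\<phi> \<in> Hom K U V"
  shows "copair U W V \<phi> (\<lambda>x\<in>carrier W. \<zero>\<^bsub>V\<^esub>) = compose (carrier (dsum U W)) \<phi> (dsum_fst U W)"
proof -
  interpret V: module K V by fact
  show ?thesis
    unfolding compose_def copair_def dsum_fst_def
    by (rule restrict_ext) (auto simp: dsum_simps HomD(1)[OF assms(4)] elim!: dsum_cases)
qed

text \<open>A projection along \<open>N\<close>, found without extending a basis: among the linear
  maps congruent to the identity modulo \<open>N\<close>, one that kills the most elements of
  \<open>N\<close> kills all of \<open>N\<close>.\<close>

lemma complement_projection:
  assumes "field K" "finite (carrier K)" "V \<in> Vec K" "submodule N K V"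
  shows "\<exists>e. linear_map K V V e \<and> (\<forall>x\<in>N. e x = \<zero>\<^bsub>V\<^esub>) \<and> (\<forall>x\<in>carrier V. x \<ominus>\<^bsub>V\<^esub> e x \<in> N)"
proof -
  have mV: "module K V" by (rule Vec_module[OF assms(3)])
  interpret K: field K by fact
  interpret V: module K V by fact
  note N = V.submoduleE[OF assms(4)]
  have finN: "finite N" using N(1) Vec_finite[OF assms(2,3)] by (rule finite_subset)
  obtain n b where b: "is_basis K V n b" using assms(3) by (auto simp: Vec_def)
  obtain co where co': "(\<forall>i<n. linear_form K V (co i)) \<and>
    (\<forall>t\<in>{..<n} \<rightarrow>\<^sub>E carrier K. \<forall>i<n. co i (lin_comb V n b t) = t i) \<and>
    (\<forall>x\<in>carrier V. lin_comb V n b (\<lambda>i\<in>{..<n}. co i x) = x)"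
    using basis_coordinates[OF mV b] by (elim exE)
  then have co: "\<And>i. i < n \<Longrightarrow> linear_form K V (co i)"
      "\<And>x. x \<in> carrier V \<Longrightarrow> lin_comb V n b (\<lambda>i\<in>{..<n}. co i x) = x"
    by blast+
  define good where "good e \<longleftrightarrow> linear_map K V V e \<and> (\<forall>x\<in>carrier V. x \<ominus>\<^bsub>V\<^esub> e x \<in> N)" for e
  define ker where "ker e = {x \<in> N. e x = \<zero>\<^bsub>V\<^esub>}" for e
  have "good (\<lambda>x. x)"
    using N(2) V.smult_l_null subgroup.one_closed[OF submodule.axioms(1)[OF assms(4)]]
    by (auto simp: good_def linear_map_def V.minus_eq V.r_neg)
  moreover have "card (ker e) \<le> card N" for e
    by (rule card_mono[OF finN]) (auto simp: ker_def)
  ultimately obtain e where e: "good e" "\<And>e'. good e' \<Longrightarrow> card (ker e') \<le> card (ker e)"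
    using ex_has_greatest_nat[of good "\<lambda>x. x" "\<lambda>e. card (ker e)" "Suc (card N)"]
    by (metis le_imp_less_Suc)
  have le: "linear_map K V V e" and eN: "\<And>x. x \<in> carrier V \<Longrightarrow> x \<ominus>\<^bsub>V\<^esub> e x \<in> N"
    using e(1) by (auto simp: good_def)
  have eV: "e x \<in> carrier V" if "x \<in> carrier V" for x by (rule linear_map_closed[OF le that])
  have "e p = \<zero>\<^bsub>V\<^esub>" if p: "p \<in> N" for p
  proof (rule ccontr)
    assume ne: "e p \<noteq> \<zero>\<^bsub>V\<^esub>"
    have pV: "p \<in> carrier V" using p N(1) by blast
    let ?m = "e p"
    have mV': "?m \<in> carrier V" by (rule eV[OF pV])
    have "p \<ominus>\<^bsub>V\<^esub> (p \<ominus>\<^bsub>V\<^esub> ?m) = ?m"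
      using pV mV' by (simp add: V.minus_eq V.minus_add V.r_neg2)
    moreover have "p \<ominus>\<^bsub>V\<^esub> (p \<ominus>\<^bsub>V\<^esub> ?m) \<in> N"
      using eN[OF pV] p N(3,5) by (simp add: V.minus_eq)
    ultimately have mN: "?m \<in> N" by simp
    have "\<exists>i<n. co i ?m \<noteq> \<zero>\<^bsub>K\<^esub>"
    proof (rule ccontr)
      assume "\<not> ?thesis"
      then have "(\<lambda>i\<in>{..<n}. co i ?m) = (\<lambda>i\<in>{..<n}. co i \<zero>\<^bsub>V\<^esub>)"
        using linear_form_zero[OF mV co(1)] by auto
      then show False using co(2)[OF mV'] co(2)[OF V.zero_closed] ne by simp
    qed
    then obtain i where i: "i < n" "co i ?m \<noteq> \<zero>\<^bsub>K\<^esub>" by blast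
    let ?c = "inv\<^bsub>K\<^esub> (co i ?m)"
    have coK: "co i x \<in> carrier K" if "x \<in> carrier V" for x
      by (rule linear_form_closed[OF co(1)[OF i(1)] that])
    have c: "?c \<in> carrier K" "?c \<otimes>\<^bsub>K\<^esub> co i ?m = \<one>\<^bsub>K\<^esub>"
      using i coK[OF mV'] by (auto simp: K.field_Units)
    \<comment> \<open>This form is -1 at \<open>p\<close> and vanishes wherever \<open>e\<close>
      does. Adding \<open>l x\<close> times \<open>?m\<close> therefore makes \<open>p\<close> a new
      element of the kernel and loses none; as \<open>?m\<close> lies in \<open>N\<close>, the map
      stays congruent to the identity.\<close>
    define l where "l x = \<ominus>\<^bsub>K\<^esub> (?c \<otimes>\<^bsub>K\<^esub> co i (e x))" for x
    have lK: "l x \<in> carrier K" if "x \<in> carrier V" for x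
      using that c coK eV by (simp add: l_def)
    have ladd: "l (x \<oplus>\<^bsub>V\<^esub> y) = l x \<oplus>\<^bsub>K\<^esub> l y" if "x \<in> carrier V" "y \<in> carrier V" for x y
      using that c coK eV
      by (simp add: l_def linear_map_add[OF le] linear_form_add[OF co(1)[OF i(1)]] K.r_distr K.minus_add)
    have lsm: "l (a \<odot>\<^bsub>V\<^esub> x) = a \<otimes>\<^bsub>K\<^esub> l x" if "a \<in> carrier K" "x \<in> carrier V" for a x
      using that c coK eV
      by (simp add: l_def linear_map_smult[OF le] linear_form_smult[OF co(1)[OF i(1)]] K.r_minus K.m_lcomm)
    define e' where "e' x = e x \<oplus>\<^bsub>V\<^esub> l x \<odot>\<^bsub>V\<^esub> ?m" for x
    have le': "linear_map K V V e'"
      unfolding linear_map_def e'_def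
      using eV lK mV'
      by (auto simp: linear_map_add[OF le] linear_map_smult[OF le] ladd lsm V.smult_l_distr
          V.smult_r_distr V.smult_assoc1 V.a_ac)
    have "good e'" unfolding good_def
    proof (intro conjI ballI le')
      fix x assume x: "x \<in> carrier V"
      have "x \<ominus>\<^bsub>V\<^esub> e' x = (x \<ominus>\<^bsub>V\<^esub> e x) \<oplus>\<^bsub>V\<^esub> \<ominus>\<^bsub>V\<^esub> (l x \<odot>\<^bsub>V\<^esub> ?m)"
        using x eV lK mV' by (simp add: e'_def V.minus_eq V.minus_add V.a_ac)
      then show "x \<ominus>\<^bsub>V\<^esub> e' x \<in> N"
        using eN[OF x] N(3-5) lK[OF x] mN by simp
    qed
    moreover have "ker e \<subset> ker e'"
    proof -
      have "p \<in> ker e'" "p \<notin> ker e"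
        using p ne c mV' coK[OF mV']
        by (auto simp: ker_def e'_def l_def V.smult_l_minus V.r_neg)
      moreover have "ker e \<subseteq> ker e'"
      proof
        fix x assume x: "x \<in> ker e"
        then have "x \<in> N" "e x = \<zero>\<^bsub>V\<^esub>" by (auto simp: ker_def)
        moreover from this have "l x = \<zero>\<^bsub>K\<^esub>"
          using c linear_form_zero[OF mV co(1)[OF i(1)]] by (simp add: l_def)
        ultimately show "x \<in> ker e'" using mV' by (simp add: ker_def e'_def)
      qed
      ultimately show ?thesis by blast
    qed
    then have "card (ker e) < card (ker e')"
      using finN by (intro psubset_card_mono) (auto simp: ker_def)
    ultimately show False using e(2) by fastforce
  qed
  then show ?thesis using le eN by blast
qed

section \<open>The injectivity argument\<close>

primrec iter_diff ::
    "('k, 'm) ring_scheme \<Rightarrow> ('k, 'v) module \<Rightarrow> 'v list \<Rightarrow> ('v \<Rightarrow> 'k) \<Rightarrow> 'v \<Rightarrow> 'k" where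
  "iter_diff K H [] g x = g x"
| "iter_diff K H (s # L) g x = iter_diff K H L g (x \<oplus>\<^bsub>H\<^esub> s) \<ominus>\<^bsub>K\<^esub> iter_diff K H L g x"

text \<open>The truncated subtraction carries information: index 0 forces the zero function, so a
  list at least as long as the bound annihilates \<open>g\<close>.\<close>

lemma iter_diff_poly_lt:
  assumes "module K H" "set L \<subseteq> carrier H" "poly_lt K H n g"
  shows "poly_lt K H (n - length L) (iter_diff K H L g)"
  using assms(2)
proof (induction L)
  case Nil
  have "iter_diff K H [] g = g" by auto
  then show ?case using assms(3) by simp
next
  case (Cons s L)
  have "poly_lt K H (n - length L - 1) (\<lambda>x. iter_diff K H L g (x \<oplus>\<^bsub>H\<^esub> s) \<ominus>\<^bsub>K\<^esub> iter_diff K H L g x)"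
    using Cons by (intro poly_lt_diff[OF assms(1)]) auto
  then show ?case by (rule poly_lt_cong[OF poly_lt_mono]) simp_all
qed

lemma iter_diff_cong:
  assumes "module K H" "set L \<subseteq> carrier H" "x \<in> carrier H"
    "\<And>y. y \<in> carrier H \<Longrightarrow> g y = g' y"
  shows "iter_diff K H L g x = iter_diff K H L g' x"
proof -
  interpret H: module K H by fact
  show ?thesis using assms(2,3)
    by (induction L arbitrary: x) (simp_all add: assms(4))
qed

text \<open>An affine map carries differences to differences along its linear part
  \<open>\<sigma>\<close>. It is applied to
  \<open>\<phi> \<mapsto> copair U W V \<phi> \<psi>\<close>, whose linear part, composition with
  \<open>dsum_fst\<close>, is the same for every \<open>\<psi>\<close>.\<close>

lemma iter_diff_affine:
  assumes "module K H" "set L \<subseteq> carrier H" "x \<in> carrier H"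
    "\<And>y s. y \<in> carrier H \<Longrightarrow> s \<in> carrier H \<Longrightarrow> T (y \<oplus>\<^bsub>H\<^esub> s) = T y \<oplus>\<^bsub>H'\<^esub> \<sigma> s"
  shows "iter_diff K H L (\<lambda>y. g (T y)) x = iter_diff K H' (map \<sigma> L) g (T x)"
proof -
  interpret H: module K H by fact
  show ?thesis using assms(2,3)
    by (induction L arbitrary: x) (simp_all add: assms(4))
qed

text \<open>An iterated difference is a signed sum of values at fixed points of \<open>H\<close>, so
  as a function of the parameter it keeps the degree bound of the values.\<close>

lemma poly_lt_iter_diff_param:
  assumes "module K H" "module K V" "set L \<subseteq> carrier H" "\<phi> \<in> carrier H"
    "\<And>\<psi>. \<psi> \<in> carrier H \<Longrightarrow> poly_lt K V n (\<lambda>x. F x \<psi>)"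
  shows "poly_lt K V n (\<lambda>x. iter_diff K H L (F x) \<phi>)"
proof -
  interpret H: module K H by fact
  show ?thesis using assms(3,4)
  proof (induction L arbitrary: \<phi>)
    case Nil
    then show ?case by (simp add: assms(5))
  next
    case (Cons s L)
    then show ?case by (simp add: poly_lt_minus[OF assms(2)])
  qed
qed

text \<open>The head of the list is the outermost difference; its vanishing in direction x - y at
  the point y compares the remaining difference at x and y.\<close>

lemma iter_diff_base_independent:
  assumes "module K H" "set L \<subseteq> carrier H" "x \<in> carrier H" "y \<in> carrier H"
    "\<And>z. z \<in> carrier H \<Longrightarrow> g z \<in> carrier K"
    "\<And>s z. s \<in> carrier H \<Longrightarrow> z \<in> carrier H \<Longrightarrow> iter_diff K H (s # L) g z = \<zero>\<^bsub>K\<^esub>"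
  shows "iter_diff K H L g x = iter_diff K H L g y"
proof -
  interpret H: module K H by fact
  have cl: "iter_diff K H L g z \<in> carrier K" if "z \<in> carrier H" for z
    using assms(2) that by (induction L arbitrary: z) (simp_all add: assms(5))
  let ?d = "x \<ominus>\<^bsub>H\<^esub> y"
  have d: "?d \<in> carrier H" "y \<oplus>\<^bsub>H\<^esub> ?d = x"
    using assms(3,4) by (simp_all add: H.minus_eq H.a_comm[of x] H.r_neg2 H.r_neg1)
  have "iter_diff K H L g x \<ominus>\<^bsub>K\<^esub> iter_diff K H L g y = \<zero>\<^bsub>K\<^esub>"
    using assms(6)[OF d(1) assms(4)] unfolding iter_diff.simps d(2) .
  then show ?thesis by (rule H.R.minus_eq_zeroD[OF cl[OF assms(3)] cl[OF assms(4)]])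
qed

text \<open>By Lagrange's theorem the multiples of 1 form an additive subgroup whose order exceeds 1
  and divides a prime, so they exhaust K. This turns additive closure into closure under
  scalars.\<close>

lemma prime_field_additively_generated:
  assumes "field K" "finite (carrier K)" "prime (card (carrier K))" "a \<in> carrier K"
    "\<zero>\<^bsub>K\<^esub> \<in> B" "\<And>b. b \<in> B \<Longrightarrow> b \<oplus>\<^bsub>K\<^esub> \<one>\<^bsub>K\<^esub> \<in> B"
  shows "a \<in> B"
proof -
  interpret K: field K by fact
  let ?G = "add_monoid K"
  have G: "group ?G" by (rule K.a_group)
  then have M: "monoid ?G" by (simp add: group_def)
  define C where "C = range (\<lambda>n::nat. \<one>\<^bsub>K\<^esub> [^]\<^bsub>?G\<^esub> n)"
  have CK: "C \<subseteq> carrier K" using monoid.nat_pow_closed[OF M, of "\<one>\<^bsub>K\<^esub>"] by (auto simp: C_def)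
  have finC: "finite C" using CK assms(2) by (rule finite_subset)
  have zero: "\<zero>\<^bsub>K\<^esub> \<in> C" unfolding C_def by (rule range_eqI[of _ _ 0]) simp
  have one: "\<one>\<^bsub>K\<^esub> \<in> C" unfolding C_def by (rule range_eqI[of _ _ 1]) simp
  have add: "x \<oplus>\<^bsub>K\<^esub> y \<in> C" if "x \<in> C" "y \<in> C" for x y
  proof -
    obtain m n :: nat where "x = \<one>\<^bsub>K\<^esub> [^]\<^bsub>?G\<^esub> m" "y = \<one>\<^bsub>K\<^esub> [^]\<^bsub>?G\<^esub> n"
      using \<open>x \<in> C\<close> \<open>y \<in> C\<close> by (auto simp: C_def)
    then have "x \<oplus>\<^bsub>K\<^esub> y = \<one>\<^bsub>K\<^esub> [^]\<^bsub>?G\<^esub> (m + n)"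
      using monoid.nat_pow_mult[OF M, of "\<one>\<^bsub>K\<^esub>" m n] by simp
    then show ?thesis by (simp add: C_def)
  qed
  have neg: "\<ominus>\<^bsub>K\<^esub> x \<in> C" if x: "x \<in> C" for x
  proof -
    \<comment> \<open>A finite set closed under addition is permuted by translation by
      \<open>x\<close>, so the translation reaches 0.\<close>
    have "inj_on (\<lambda>y. x \<oplus>\<^bsub>K\<^esub> y) C"
      using x CK G by (intro inj_onI) (simp add: subset_iff)
    then have "(\<lambda>y. x \<oplus>\<^bsub>K\<^esub> y) ` C = C"
      using finC add[OF x] by (intro endo_inj_surj) auto
    then obtain y where y: "y \<in> C" "x \<oplus>\<^bsub>K\<^esub> y = \<zero>\<^bsub>K\<^esub>" using zero by (metis imageE)
    then have "\<ominus>\<^bsub>K\<^esub> x = y"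
      using y K.a_comm[OF subsetD[OF CK x] subsetD[OF CK y(1)]] subsetD[OF CK x] subsetD[OF CK y(1)]
      by (intro K.minus_equality) simp_all
    then show ?thesis using y by simp
  qed
  have "subgroup C ?G"
    using CK zero one add neg by (intro group.subgroupI[OF G]) (auto simp flip: a_inv_def)
  then have "card C dvd card (carrier K)"
    using group.lagrange[OF G, of C] by (metis order_def dvd_triv_right monoid_record_simps(1))
  moreover have "card C \<noteq> 1"
    using zero one by (auto simp: card_1_singleton_iff)
  ultimately have "card C = card (carrier K)"
    using assms(3) by (auto simp: prime_nat_iff)
  then have "C = carrier K" using assms(2) CK by (intro card_subset_eq)
  then obtain n :: nat where n: "a = \<one>\<^bsub>K\<^esub> [^]\<^bsub>?G\<^esub> n" using assms(4) by (auto simp: C_def)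
  have "\<one>\<^bsub>K\<^esub> [^]\<^bsub>?G\<^esub> m \<in> B" for m :: nat
    by (induction m) (simp_all add: assms(5,6))
  then show ?thesis using n by simp
qed

text \<open>What the injectivity argument takes from the containment of R in P_{>d-1} is recorded as
  \<open>R_zero\<close>. \<open>D\<close> is any bound on the degree of P; it limits the number of
  differences that can be nonzero.\<close>

locale embedding =
  fixes K :: "('k, 'm) ring_scheme"
    and P :: "('k, 'a, 'b) rep"
    and D :: int
    and R X :: "('k, 'a, 'b) family"
  assumes field: "field K" and finite: "finite (carrier K)"
    and prime_card: "prime (card (carrier K))"
    and functorial: "is_functor K P" and degree: "rep_le K P D"
    and R_subrep: "is_subrep K P R"
    and irreducible: "irreducible_rep K (sub_rep P R)"
    and X_subset: "is_subset K P X"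
    and R_zero: "\<And>W r. W \<in> Vec K \<Longrightarrow> r \<in> R W \<Longrightarrow>
      mor P W W (\<lambda>x\<in>carrier W. \<zero>\<^bsub>W\<^esub>) r = \<zero>\<^bsub>obj P W\<^esub>"
begin

lemma obj_Vec: "V \<in> Vec K \<Longrightarrow> obj P V \<in> Vec K"
  using functorial by (simp add: is_functor_def)

lemma obj_module: "V \<in> Vec K \<Longrightarrow> module K (obj P V)"
  using obj_Vec by (rule Vec_module)

lemma mor_Hom:
  "V \<in> Vec K \<Longrightarrow> W \<in> Vec K \<Longrightarrow> \<phi> \<in> Hom K V W \<Longrightarrow> mor P V W \<phi> \<in> Hom K (obj P V) (obj P W)"
  using functorial by (simp add: is_functor_def)

lemma mor_id: "V \<in> Vec K \<Longrightarrow> x \<in> carrier (obj P V) \<Longrightarrow> mor P V V (\<lambda>x\<in>carrier V. x) x = x"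
  using functorial by (simp add: is_functor_def)

lemma mor_compose:
  assumes "U \<in> Vec K" "V \<in> Vec K" "W \<in> Vec K" "\<phi> \<in> Hom K U V" "\<psi> \<in> Hom K V W"
    "x \<in> carrier (obj P U)"
  shows "mor P U W (compose (carrier U) \<psi> \<phi>) x = mor P V W \<psi> (mor P U V \<phi> x)"
proof -
  have "mor P U W (compose (carrier U) \<psi> \<phi>) =
      compose (carrier (obj P U)) (mor P V W \<psi>) (mor P U V \<phi>)"
    using functorial assms unfolding is_functor_def by blast
  then show ?thesis using assms(6) by (simp add: compose_eq)
qed

lemma X_carrier: "V \<in> Vec K \<Longrightarrow> x \<in> X V \<Longrightarrow> x \<in> carrier (obj P V)"
  using X_subset unfolding is_subset_def by blast

lemma X_mor: "V \<in> Vec K \<Longrightarrow> W \<in> Vec K \<Longrightarrow> \<phi> \<in> Hom K V W \<Longrightarrow> x \<in> X V \<Longrightarrow> mor P V W \<phi> x \<in> X W"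
  using X_subset unfolding is_subset_def by blast

lemma R_submodule: "V \<in> Vec K \<Longrightarrow> submodule (R V) K (obj P V)"
  using R_subrep unfolding is_subrep_def by blast

lemma R_carrier: "V \<in> Vec K \<Longrightarrow> x \<in> R V \<Longrightarrow> x \<in> carrier (obj P V)"
  using R_subrep unfolding is_subrep_def is_subset_def by blast

lemma R_mor: "V \<in> Vec K \<Longrightarrow> W \<in> Vec K \<Longrightarrow> \<phi> \<in> Hom K V W \<Longrightarrow> x \<in> R V \<Longrightarrow> mor P V W \<phi> x \<in> R W"
  using R_subrep unfolding is_subrep_def is_subset_def by blast

lemma R_add: "V \<in> Vec K \<Longrightarrow> x \<in> R V \<Longrightarrow> y \<in> R V \<Longrightarrow> x \<oplus>\<^bsub>obj P V\<^esub> y \<in> R V"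
  using module.submoduleE(5)[OF obj_module R_submodule] by blast

lemma R_zero_mem: "V \<in> Vec K \<Longrightarrow> \<zero>\<^bsub>obj P V\<^esub> \<in> R V"
  using subgroup.one_closed[OF submodule.axioms(1)[OF R_submodule]] by simp

text \<open>The zero map from W to U factors through the zero endomorphism of W, to which
  \<open>R_zero\<close> applies.\<close>

lemma R_zero_mor:
  assumes "W \<in> Vec K" "U \<in> Vec K" "r \<in> R W"
  shows "mor P W U (\<lambda>x\<in>carrier W. \<zero>\<^bsub>U\<^esub>) r = \<zero>\<^bsub>obj P U\<^esub>"
proof -
  note m = Vec_module[OF assms(1)] Vec_module[OF assms(2)]
  interpret W: module K W by (rule m)
  have 1: "(\<lambda>x\<in>carrier W. \<zero>\<^bsub>U\<^esub>) \<in> Hom K W U" "(\<lambda>x\<in>carrier W. \<zero>\<^bsub>W\<^esub>) \<in> Hom K W W"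
    by (rule zero_in_Hom; rule m)+
  have "(\<lambda>x\<in>carrier W. \<zero>\<^bsub>U\<^esub>) = compose (carrier W) (\<lambda>x\<in>carrier W. \<zero>\<^bsub>U\<^esub>) (\<lambda>x\<in>carrier W. \<zero>\<^bsub>W\<^esub>)"
    by (auto simp: compose_def)
  then have "mor P W U (\<lambda>x\<in>carrier W. \<zero>\<^bsub>U\<^esub>) r =
      mor P W U (\<lambda>x\<in>carrier W. \<zero>\<^bsub>U\<^esub>) (mor P W W (\<lambda>x\<in>carrier W. \<zero>\<^bsub>W\<^esub>) r)"
    using mor_compose[OF assms(1,1,2) 1(2,1) R_carrier[OF assms(1,3)]] by simp
  also have "\<dots> = \<zero>\<^bsub>obj P U\<^esub>"
    unfolding R_zero[OF assms(1,3)]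
    by (rule linear_map_zero[OF obj_module obj_module Hom_linear_map[OF mor_Hom]]; fact assms 1)
  finally show ?thesis .
qed

text \<open>Evaluation at \<open>x\<close> followed by \<open>l\<close> turns the operator-valued
  polynomial of \<open>map_le\<close> into a scalar one, with coefficients
  \<open>l (w j x)\<close>.\<close>

lemma poly_lt_mor:
  assumes "U \<in> Vec K" "V \<in> Vec K" "x \<in> carrier (obj P U)" "linear_form K (obj P V) l"
  shows "poly_lt K (hom_space K U V) (nat (D + 1)) (\<lambda>\<phi>. l (mor P U V \<phi> x))"
proof -
  interpret PU: module K "obj P U" by (rule obj_module[OF assms(1)])
  interpret PV: module K "obj P V" by (rule obj_module[OF assms(2)])
  let ?H = "hom_space K U V" and ?M = "hom_space K (obj P U) (obj P V)"
  have mH: "module K ?H" by (intro module_hom_space Vec_module assms)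
  have "mor P U V \<in> map_le K ?H ?M D"
    using degree assms(1,2) unfolding rep_le_def by blast
  then obtain r f w where fw: "\<forall>j<(r::nat). f j \<in> fun_le K ?H D \<and> w j \<in> carrier ?M"
    "\<forall>\<phi>\<in>carrier ?H. mor P U V \<phi> = (\<Oplus>\<^bsub>?M\<^esub>j\<in>{..<r}. f j \<phi> \<odot>\<^bsub>?M\<^esub> w j)"
    unfolding map_le_def by blast
  have fK: "poly_lt K ?H (nat (D + 1)) (f j)" if "j < r" for j
    by (rule fun_le_poly_lt[OF mH]) (use fw that in blast)
  have wH: "w j \<in> Hom K (obj P U) (obj P V)" if "j < r" for j
    using fw that by (simp add: hom_space_simps)
  have wx: "w j x \<in> carrier (obj P V)" if "j < r" for j
    by (rule HomD(1)[OF wH[OF that] assms(3)])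
  have lw: "l (w j x) \<in> carrier K" if "j < r" for j
    by (rule linear_form_closed[OF assms(4) wx[OF that]])
  have "poly_lt K ?H (nat (D + 1)) (\<lambda>\<phi>. \<Oplus>\<^bsub>K\<^esub>j\<in>{..<r}. l (w j x) \<otimes>\<^bsub>K\<^esub> f j \<phi>)"
    by (rule poly_lt_sum[OF mH]) (use lw fK in \<open>auto intro!: poly_lt_smult[OF mH]\<close>)
  then show ?thesis
  proof (rule poly_lt_cong)
    fix \<phi> assume p: "\<phi> \<in> carrier ?H"
    have fp: "f j \<phi> \<in> carrier K" if "j < r" for j
      by (rule poly_lt_closed[OF mH fK[OF that] p])
    have "mor P U V \<phi> x = (\<Oplus>\<^bsub>?M\<^esub>j\<in>{..<r}. f j \<phi> \<odot>\<^bsub>?M\<^esub> w j) x"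
      using fw(2) p by simp
    also have "\<dots> = (\<Oplus>\<^bsub>obj P V\<^esub>j\<in>{..<r}. (f j \<phi> \<odot>\<^bsub>?M\<^esub> w j) x)"
      by (rule hom_space_finsum[OF PU.module_axioms PV.module_axioms _ _ assms(3)])
        (use smult_in_Hom[OF PU.module_axioms PV.module_axioms wH fp] in \<open>auto simp: hom_space_simps(4)\<close>)
    also have "\<dots> = (\<Oplus>\<^bsub>obj P V\<^esub>j\<in>{..<r}. f j \<phi> \<odot>\<^bsub>obj P V\<^esub> w j x)"
      by (rule PV.finsum_cong') (use fp wx assms(3) in \<open>auto simp: hom_space_simps(4)\<close>)
    finally have "l (mor P U V \<phi> x) = (\<Oplus>\<^bsub>K\<^esub>j\<in>{..<r}. l (f j \<phi> \<odot>\<^bsub>obj P V\<^esub> w j x))"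
      using linear_form_finsum[OF PV.module_axioms assms(4), of "{..<r}" "\<lambda>j. f j \<phi> \<odot>\<^bsub>obj P V\<^esub> w j x"] fp wx
      by (simp add: Pi_iff)
    also have "\<dots> = (\<Oplus>\<^bsub>K\<^esub>j\<in>{..<r}. l (w j x) \<otimes>\<^bsub>K\<^esub> f j \<phi>)"
      by (rule PU.R.finsum_cong')
        (use fp wx lw in \<open>auto simp: linear_form_smult[OF assms(4)] PU.R.m_comm\<close>)
    finally show "l (mor P U V \<phi> x) = (\<Oplus>\<^bsub>K\<^esub>j\<in>{..<r}. l (w j x) \<otimes>\<^bsub>K\<^esub> f j \<phi>)" .
  qed
qed

text \<open>The value f_s(P(\<phi>)x) of the overview, read in two ways: as a polynomial in
  \<open>\<phi>\<close> it bounds k, as a polynomial in \<open>x\<close> it bounds the degree of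
  h.\<close>

definition translate_diff ::
    "('k, 'a elem) module \<Rightarrow> ('b \<Rightarrow> 'k) \<Rightarrow> ('k, 'a elem) module \<Rightarrow> 'b \<Rightarrow> 'b \<Rightarrow> ('a elem \<Rightarrow> 'a elem) \<Rightarrow> 'k"
  where
  "translate_diff V f U s x \<phi> =
     f (mor P U V \<phi> x \<oplus>\<^bsub>obj P V\<^esub> s) \<ominus>\<^bsub>K\<^esub> f (mor P U V \<phi> x)"

text \<open>The point is uniformity: the bound involves \<open>n\<close> and \<open>D\<close>, but
  neither U nor x nor s.\<close>

lemma translate_diff_poly_lt_Hom:
  assumes "U \<in> Vec K" "V \<in> Vec K" "x \<in> carrier (obj P U)" "s \<in> carrier (obj P V)"
    "poly_lt K (obj P V) n f"
  shows "poly_lt K (hom_space K U V) (n * Suc (nat (D + 1))) (translate_diff V f U s x)"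
proof -
  have "poly_lt K (obj P V) n (\<lambda>y. f (y \<oplus>\<^bsub>obj P V\<^esub> s) \<ominus>\<^bsub>K\<^esub> f y)"
    by (rule poly_lt_minus[OF obj_module[OF assms(2)] poly_lt_shift[OF obj_module[OF assms(2)]]]) fact+
  then have "poly_lt K (hom_space K U V) (n * Suc (nat (D + 1)))
      (\<lambda>\<phi>. f (mor P U V \<phi> x \<oplus>\<^bsub>obj P V\<^esub> s) \<ominus>\<^bsub>K\<^esub> f (mor P U V \<phi> x))"
  proof (rule poly_lt_comp[rotated 2])
    show "module K (hom_space K U V)" "module K (obj P V)"
      using assms by (auto intro: module_hom_space Vec_module obj_module)
    show "mor P U V \<phi> x \<in> carrier (obj P V)" if "\<phi> \<in> carrier (hom_space K U V)" for \<phi>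
      using that assms HomD(1)[OF mor_Hom] by (simp add: hom_space_simps)
    show "poly_lt K (hom_space K U V) (Suc (nat (D + 1))) (\<lambda>\<phi>. l (mor P U V \<phi> x))"
      if "linear_form K (obj P V) l" for l
      by (rule poly_lt_mono[OF poly_lt_mor[OF assms(1-3) that]]) simp
  qed
  then show ?thesis by (rule poly_lt_cong) (simp add: translate_diff_def)
qed

text \<open>P(\<phi>) is linear, so the degree lost by the difference of \<open>f\<close> stays lost
  after composition. This loss is the drop in degree from f to h.\<close>

lemma translate_diff_poly_lt_obj:
  assumes "U \<in> Vec K" "V \<in> Vec K" "\<phi> \<in> Hom K U V" "s \<in> carrier (obj P V)"
    "poly_lt K (obj P V) (Suc n) f"
  shows "poly_lt K (obj P U) n (\<lambda>x. translate_diff V f U s x \<phi>)"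
proof -
  have "poly_lt K (obj P V) n (\<lambda>y. f (y \<oplus>\<^bsub>obj P V\<^esub> s) \<ominus>\<^bsub>K\<^esub> f y)"
    using poly_lt_diff[OF obj_module[OF assms(2)] assms(5,4)] by simp
  then show ?thesis
    unfolding translate_diff_def
    by (rule poly_lt_comp_linear[OF _ Hom_linear_map[OF mor_Hom[OF assms(1-3)]]])
qed

text \<open>
  The elements \<open>t\<close> of \<open>R(U)\<close> such that \<open>T\<close> is invariant under translation by all \<open>P(\<chi>)t\<close> form a
  subrepresentation; closure under scalars is where the primality of the field is used.
\<close>

lemma R_generated:
  assumes "W \<in> Vec K" "r \<in> R W" "r \<noteq> \<zero>\<^bsub>obj P W\<^esub>" "V \<in> Vec K" "s \<in> R V" "s1 \<in> R V"
    "\<And>\<psi> s1. \<psi> \<in> Hom K W V \<Longrightarrow> s1 \<in> R V \<Longrightarrow> T (s1 \<oplus>\<^bsub>obj P V\<^esub> mor P W V \<psi> r) = T s1"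
  shows "T (s1 \<oplus>\<^bsub>obj P V\<^esub> s) = T s1"
proof -
  define A where "A W' = {s \<in> R W'. \<forall>\<chi>\<in>Hom K W' V. \<forall>s1\<in>R V.
      T (s1 \<oplus>\<^bsub>obj P V\<^esub> mor P W' V \<chi> s) = T s1}" for W' :: "('k, 'a elem) module"
  interpret PV: module K "obj P V" by (rule obj_module[OF assms(4)])
  have "is_subrep K (sub_rep P R) A"
    unfolding is_subrep_def is_subset_def
  proof (intro conjI ballI)
    fix W' :: "('k, 'a elem) module" assume W': "W' \<in> Vec K"
    show "A W' \<subseteq> carrier (obj (sub_rep P R) W')" by (auto simp: A_def sub_rep_def)
    interpret PW: module K "obj P W'" by (rule obj_module[OF W'])
    let ?M = "obj (sub_rep P R) W'"
    have M: "?M = (obj P W')\<lparr>carrier := R W'\<rparr>" by (simp add: sub_rep_def)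
    interpret M: module K ?M
      unfolding M by (rule submodule.submodule_is_module[OF R_submodule[OF W'] PW.module_axioms])
    note lin = Hom_linear_map[OF mor_Hom[OF W' assms(4)]]
    have zero: "\<zero>\<^bsub>obj P W'\<^esub> \<in> A W'"
      using R_zero_mem[OF W'] linear_map_zero[OF PW.module_axioms PV.module_axioms lin]
        R_carrier[OF assms(4)]
      by (auto simp: A_def)
    have add: "a \<oplus>\<^bsub>obj P W'\<^esub> b \<in> A W'" if "a \<in> A W'" "b \<in> A W'" for a b
    proof -
      have ab: "a \<in> R W'" "b \<in> R W'" using that by (auto simp: A_def)
      have "T (s1 \<oplus>\<^bsub>obj P V\<^esub> mor P W' V \<chi> (a \<oplus>\<^bsub>obj P W'\<^esub> b)) = T s1"
        if c: "\<chi> \<in> Hom K W' V" and s1: "s1 \<in> R V" for \<chi> s1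
      proof -
        have R: "mor P W' V \<chi> a \<in> R V" "mor P W' V \<chi> b \<in> R V" using R_mor[OF W' assms(4) c] ab by auto
        have "s1 \<oplus>\<^bsub>obj P V\<^esub> mor P W' V \<chi> (a \<oplus>\<^bsub>obj P W'\<^esub> b) =
            (s1 \<oplus>\<^bsub>obj P V\<^esub> mor P W' V \<chi> a) \<oplus>\<^bsub>obj P V\<^esub> mor P W' V \<chi> b"
          using linear_map_add[OF lin[OF c]] ab R s1 R_carrier[OF W'] R_carrier[OF assms(4)]
          by (simp add: PV.a_assoc)
        then show ?thesis
          using \<open>a \<in> A W'\<close> \<open>b \<in> A W'\<close> R_add[OF assms(4) s1 R(1)] c s1 by (simp add: A_def)
      qed
      then show ?thesis using ab R_add[OF W'] by (simp add: A_def)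
    qed
    have smult: "a \<odot>\<^bsub>obj P W'\<^esub> x \<in> A W'" if a: "a \<in> carrier K" and x: "x \<in> A W'" for a x
    proof -
      have xc: "x \<in> carrier (obj P W')" using x R_carrier[OF W'] by (simp add: A_def)
      \<comment> \<open>Since (b + 1)x = bx + x, the admissible scalars contain 0 and are closed
        under adding 1.\<close>
      have "a \<in> {a \<in> carrier K. a \<odot>\<^bsub>obj P W'\<^esub> x \<in> A W'}"
      proof (rule prime_field_additively_generated[OF field finite prime_card a])
        show "\<zero>\<^bsub>K\<^esub> \<in> {a \<in> carrier K. a \<odot>\<^bsub>obj P W'\<^esub> x \<in> A W'}"
          using zero xc by simp
        show "b \<oplus>\<^bsub>K\<^esub> \<one>\<^bsub>K\<^esub> \<in> {a \<in> carrier K. a \<odot>\<^bsub>obj P W'\<^esub> x \<in> A W'}"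
          if "b \<in> {a \<in> carrier K. a \<odot>\<^bsub>obj P W'\<^esub> x \<in> A W'}" for b
          using that x xc by (simp add: PW.smult_l_distr add)
      qed
      then show ?thesis by simp
    qed
    show "submodule (A W') K ?M"
    proof (rule M.submoduleI)
      show "A W' \<subseteq> carrier ?M" by (auto simp: A_def M)
      show "\<zero>\<^bsub>?M\<^esub> \<in> A W'" using zero by (simp add: M)
      show "a \<oplus>\<^bsub>?M\<^esub> b \<in> A W'" if "a \<in> A W'" "b \<in> A W'" for a b using add[OF that] by (simp add: M)
      show sm: "a \<odot>\<^bsub>?M\<^esub> x \<in> A W'" if "a \<in> carrier K" "x \<in> A W'" for a x
        using smult[OF that] by (simp add: M)
      show "\<ominus>\<^bsub>?M\<^esub> a \<in> A W'" if "a \<in> A W'" for a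
      proof -
        have "a \<in> carrier ?M" using that by (simp add: A_def M)
        then have "\<ominus>\<^bsub>?M\<^esub> a = (\<ominus>\<^bsub>K\<^esub> \<one>\<^bsub>K\<^esub>) \<odot>\<^bsub>?M\<^esub> a" by (simp add: M.smult_l_minus)
        then show ?thesis using sm[OF _ that, of "\<ominus>\<^bsub>K\<^esub> \<one>\<^bsub>K\<^esub>"] by simp
      qed
    qed
  next
    fix W1 W2 :: "('k, 'a elem) module" and \<phi> assume W: "W1 \<in> Vec K" "W2 \<in> Vec K" "\<phi> \<in> Hom K W1 W2"
    show "mor (sub_rep P R) W1 W2 \<phi> ` A W1 \<subseteq> A W2"
    proof
      fix y assume "y \<in> mor (sub_rep P R) W1 W2 \<phi> ` A W1"
      then obtain x where x: "x \<in> A W1" "y = mor P W1 W2 \<phi> x"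
        by (auto simp: sub_rep_def A_def)
      have xR: "x \<in> R W1" using x by (simp add: A_def)
      have "mor P W2 V \<chi> y = mor P W1 V (compose (carrier W1) \<chi> \<phi>) x"
        "compose (carrier W1) \<chi> \<phi> \<in> Hom K W1 V"
        if "\<chi> \<in> Hom K W2 V" for \<chi>
        using mor_compose[OF W(1,2) assms(4) W(3) that R_carrier[OF W(1) xR]]
          compose_in_Hom[OF Vec_module[OF W(1)] W(3) that] x(2) by simp_all
      then show "y \<in> A W2"
        using x R_mor[OF W xR] by (simp add: A_def)
    qed
  qed
  moreover have "r \<in> A W" using assms by (simp add: A_def)
  then have "\<not> (\<forall>V\<in>Vec K. A V = {\<zero>\<^bsub>obj (sub_rep P R) V\<^esub>})"
    using assms(1,3) by (auto simp: sub_rep_def)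
  ultimately have "\<forall>V\<in>Vec K. A V = carrier (obj (sub_rep P R) V)"
    using irreducible unfolding irreducible_rep_def by blast
  then have "s \<in> A V" using assms(4,5) by (simp add: sub_rep_def)
  \<comment> \<open>Membership in \<open>A V\<close> is used for \<chi> the identity of V.\<close>
  then have "T (s1 \<oplus>\<^bsub>obj P V\<^esub> mor P V V (\<lambda>x\<in>carrier V. x) s) = T s1"
    using id_in_Hom[OF Vec_module[OF assms(4)]] assms(6) by (simp add: A_def)
  then show ?thesis using mor_id[OF assms(4) R_carrier[OF assms(4,5)]] by simp
qed

section \<open>Injectivity on the localized shift\<close>

lemma copair_add:
  assumes "U \<in> Vec K" "W \<in> Vec K" "V \<in> Vec K" "\<phi> \<in> Hom K U V" "\<phi>' \<in> Hom K U V" "\<psi> \<in> Hom K W V"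
  shows "copair U W V (\<phi> \<oplus>\<^bsub>hom_space K U V\<^esub> \<phi>') \<psi> =
    copair U W V \<phi> \<psi> \<oplus>\<^bsub>hom_space K (dsum U W) V\<^esub> compose (carrier (dsum U W)) \<phi>' (dsum_fst U W)"
proof -
  interpret V: module K V by (rule Vec_module[OF assms(3)])
  show ?thesis
    unfolding hom_space_simps copair_def compose_def dsum_fst_def
    by (rule restrict_ext)
      (use HomD(1)[OF assms(4)] HomD(1)[OF assms(5)] HomD(1)[OF assms(6)] in
        \<open>auto elim!: dsum_cases simp: dsum_simps V.a_ac\<close>)
qed

text \<open>The degree of \<open>f\<close> is at most \<open>E\<close> and that of \<open>h\<close>
  is below \<open>E\<close>. The points \<open>q\<close> and \<open>s0\<close> provide the first
  nonzero difference, the empty one, from which the maximum is sought.\<close>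

lemma embedding_lemma:
  assumes V: "V \<in> Vec K" and f: "poly_lt K (obj P V) (Suc E) f"
    and fX: "\<And>x. x \<in> X V \<Longrightarrow> f x = \<zero>\<^bsub>K\<^esub>"
    and q: "q \<in> X V" and s0: "s0 \<in> R V" "f (q \<oplus>\<^bsub>obj P V\<^esub> s0) \<noteq> \<zero>\<^bsub>K\<^esub>"
  shows "\<exists>U h. U \<in> Vec K \<and> poly_lt K (obj P U) E h \<and> (\<exists>x\<in>X U. h x \<noteq> \<zero>\<^bsub>K\<^esub>) \<and>
    (\<forall>W\<in>Vec K. inj_on (quot_proj (obj (shift_rep U P) W) (shift_embed U P R W))
       (localized_family K U P h X W))"
proof -
  note mV = Vec_module[OF V]
  interpret PV: module K "obj P V" by (rule obj_module[OF V])
  let ?H = "\<lambda>U. hom_space K U V"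
  note mH = module_hom_space[OF Vec_module mV]
  have fK: "f y \<in> carrier K" if "y \<in> carrier (obj P V)" for y
    by (rule poly_lt_closed[OF PV.module_axioms f that])
  define good where "good n \<longleftrightarrow> (\<exists>U x s L \<phi>. U \<in> Vec K \<and> x \<in> X U \<and> s \<in> R V \<and> length L = n \<and>
      set L \<subseteq> Hom K U V \<and> \<phi> \<in> Hom K U V \<and>
      iter_diff K (?H U) L (translate_diff V f U s x) \<phi> \<noteq> \<zero>\<^bsub>K\<^esub>)" for n
  have good0: "good 0"
  proof -
    have qV: "q \<in> carrier (obj P V)" "s0 \<in> carrier (obj P V)"
      using X_carrier[OF V q] R_carrier[OF V s0(1)] .
    \<comment> \<open>No differences, U = V and the identity map; the subtracted term f(q) vanishes
      because q lies in X(V).\<close>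
    have "translate_diff V f V s0 q (\<lambda>x\<in>carrier V. x) = f (q \<oplus>\<^bsub>obj P V\<^esub> s0)"
      using fX[OF q] fK qV mor_id[OF V qV(1)] by (simp add: translate_diff_def PV.R.minus_eq)
    then show ?thesis
      unfolding good_def using V q s0 id_in_Hom[OF mV]
      by (intro exI[of _ V] exI[of _ q] exI[of _ s0] exI[of _ "[]"] exI[of _ "\<lambda>x\<in>carrier V. x"]) simp
  qed
  have bound: "n \<le> Suc E * Suc (nat (D + 1))" if "good n" for n
  proof (rule ccontr)
    assume n: "\<not> n \<le> Suc E * Suc (nat (D + 1))"
    obtain U x s L \<phi> where U: "U \<in> Vec K" "x \<in> X U" "s \<in> R V" "length L = n"
      "set L \<subseteq> Hom K U V" "\<phi> \<in> Hom K U V"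
      "iter_diff K (?H U) L (translate_diff V f U s x) \<phi> \<noteq> \<zero>\<^bsub>K\<^esub>"
      using \<open>good n\<close> unfolding good_def by blast
    have "poly_lt K (?H U) (Suc E * Suc (nat (D + 1))) (translate_diff V f U s x)"
      by (rule translate_diff_poly_lt_Hom[OF U(1) V X_carrier[OF U(1,2)] R_carrier[OF V U(3)] f])
    from iter_diff_poly_lt[OF mH[OF U(1)] _ this, of L]
    have "poly_lt K (?H U) 0 (iter_diff K (?H U) L (translate_diff V f U s x))"
      using U(4,5) n by (simp add: hom_space_simps)
    from poly_lt_0[OF mH[OF U(1)] this, of \<phi>] show False
      using U(6,7) by (simp add: hom_space_simps)
  qed
  define k where "k = Greatest good"
  have "good k" unfolding k_def using good0 bound by (rule GreatestI_nat)
  moreover have not_good: "\<not> good (Suc k)"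
    using Greatest_le_nat[of good "Suc k", OF _ bound] unfolding k_def by auto
  ultimately obtain U x0 s L \<phi> where U: "U \<in> Vec K" and x0: "x0 \<in> X U" and s: "s \<in> R V"
    and L: "length L = k" "set L \<subseteq> Hom K U V" and \<phi>: "\<phi> \<in> Hom K U V"
    and nz: "iter_diff K (?H U) L (translate_diff V f U s x0) \<phi> \<noteq> \<zero>\<^bsub>K\<^esub>"
    unfolding good_def by blast
  note mU = Vec_module[OF U]
  interpret PU: module K "obj P U" by (rule obj_module[OF U])
  \<comment> \<open>The translation remains a parameter: the function sought is \<open>h s\<close>,
    but the argument compares \<open>h t\<close> for different t in R(V), with \<open>L\<close> and
    \<open>\<phi>\<close> fixed.\<close>
  define h where "h t z = iter_diff K (?H U) L (translate_diff V f U t z) \<phi>" for t z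
  have "poly_lt K (obj P U) E (h s)"
    unfolding h_def
    by (rule poly_lt_iter_diff_param[OF mH[OF U] PU.module_axioms])
      (use L \<phi> translate_diff_poly_lt_obj[OF U V _ R_carrier[OF V s] f] in \<open>auto simp: hom_space_simps\<close>)
  moreover have "\<exists>x\<in>X U. h s x \<noteq> \<zero>\<^bsub>K\<^esub>" using x0 nz by (auto simp: h_def)
  moreover have "inj_on (quot_proj (obj (shift_rep U P) W) (shift_embed U P R W))
       (localized_family K U P (h s) X W)" if W: "W \<in> Vec K" for W
  proof (rule inj_onI)
    fix p p' assume p: "p \<in> localized_family K U P (h s) X W"
      and p': "p' \<in> localized_family K U P (h s) X W"
      and eq: "quot_proj (obj (shift_rep U P) W) (shift_embed U P R W) p =
        quot_proj (obj (shift_rep U P) W) (shift_embed U P R W) p'"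
    let ?S = "dsum U W"
    note mW = Vec_module[OF W]
    have S: "?S \<in> Vec K" by (rule dsum_Vec[OF field finite U W])
    interpret PS: module K "obj P ?S" by (rule obj_module[OF S])
    interpret PW: module K "obj P W" by (rule obj_module[OF W])
    have inr: "dsum_inr U W \<in> Hom K W ?S" by (rule dsum_inr_Hom[OF mU mW])
    have fst: "dsum_fst U W \<in> Hom K ?S U" by (rule dsum_fst_Hom[OF mU mW])
    have pX: "p \<in> X ?S" "p' \<in> X ?S" and hp: "h s (mor P ?S U (dsum_fst U W) p) \<noteq> \<zero>\<^bsub>K\<^esub>"
      using p p' by (auto simp: localized_family_def shift_family_def)
    have pS: "p \<in> carrier (obj P ?S)" "p' \<in> carrier (obj P ?S)" using pX X_carrier[OF S] by auto
    \<comment> \<open>Because the embedded R contains 0, \<open>p'\<close> belongs to its own coset,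
      hence to that of \<open>p\<close>; this produces \<open>r\<close>.\<close>
    have "\<zero>\<^bsub>obj P ?S\<^esub> \<in> shift_embed U P R W"
      unfolding shift_embed_def
      by (rule image_eqI[of _ _ "\<zero>\<^bsub>obj P W\<^esub>"])
        (simp_all add: R_zero_mem[OF W] linear_map_zero[OF PW.module_axioms PS.module_axioms
           Hom_linear_map[OF mor_Hom[OF W S inr]]])
    then have "p' \<in> quot_proj (obj (shift_rep U P) W) (shift_embed U P R W) p'"
      using pS by (force simp: quot_proj_def shift_rep_def a_r_coset_def')
    then have "p' \<in> quot_proj (obj (shift_rep U P) W) (shift_embed U P R W) p"
      unfolding eq .
    then obtain r where r: "r \<in> R W"
      and p'_eq: "p' = mor P W ?S (dsum_inr U W) r \<oplus>\<^bsub>obj P ?S\<^esub> p"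
      by (auto simp: quot_proj_def shift_rep_def shift_embed_def a_r_coset_def')
    have rW: "r \<in> carrier (obj P W)" by (rule R_carrier[OF W r])
    have irS: "mor P W ?S (dsum_inr U W) r \<in> carrier (obj P ?S)"
      by (rule HomD(1)[OF mor_Hom[OF W S inr] rW])
    define z where "z = mor P ?S U (dsum_fst U W) p"
    have zU: "z \<in> carrier (obj P U)" unfolding z_def by (rule HomD(1)[OF mor_Hom[OF S U fst] pS(1)])
    have z': "mor P ?S U (dsum_fst U W) p' = z"
    proof -
      \<comment> \<open>Including W and then projecting to U is the zero map, and P of it kills
        \<open>r\<close>.\<close>
      have "mor P ?S U (dsum_fst U W) (mor P W ?S (dsum_inr U W) r) = \<zero>\<^bsub>obj P U\<^esub>"
        using mor_compose[OF W S U inr fst rW] R_zero_mor[OF W U r]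
        by (simp add: dsum_fst_inr[OF mU mW])
      then show ?thesis
        unfolding p'_eq HomD(2)[OF mor_Hom[OF S U fst] irS pS(1)] using zU by (simp add: z_def)
    qed
    \<comment> \<open>Here \<open>p1\<close> stands for \<open>p\<close> or \<open>p'\<close>: both
      lie in X(U \<oplus> W) over \<open>z\<close>. The freedom to choose \<open>\<psi>\<close> on
      the right, absent on the left, is what links the two points.\<close>
    have h_eq: "h t z = iter_diff K (?H U) L (\<lambda>\<phi>. translate_diff V f ?S t p1 (copair U W V \<phi> \<psi>)) \<phi>"
      if p1: "p1 \<in> X ?S" "mor P ?S U (dsum_fst U W) p1 = z" and t: "t \<in> R V" and \<psi>: "\<psi> \<in> Hom K W V"
      for p1 t \<psi>
    proof -
      let ?T = "\<lambda>\<psi> \<phi>. copair U W V \<phi> \<psi>" and ?\<sigma> = "\<lambda>\<phi>. compose (carrier ?S) \<phi> (dsum_fst U W)"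
      let ?g = "translate_diff V f ?S t p1"
      let ?o = "\<lambda>x\<in>carrier W. \<zero>\<^bsub>V\<^esub>"
      have o: "?o \<in> Hom K W V" by (rule zero_in_Hom[OF mW mV])
      have p1S: "p1 \<in> carrier (obj P ?S)" by (rule X_carrier[OF S p1(1)])
      have tV: "t \<in> carrier (obj P V)" by (rule R_carrier[OF V t])
      have T: "?T \<chi> \<phi>' \<in> Hom K ?S V" if "\<chi> \<in> Hom K W V" "\<phi>' \<in> Hom K U V" for \<chi> \<phi>'
        by (rule copair_Hom[OF mU mW mV that(2,1)])
      have aff: "iter_diff K (?H U) L (\<lambda>\<phi>. ?g (?T \<chi> \<phi>)) \<phi> = iter_diff K (?H ?S) (map ?\<sigma> L) ?g (?T \<chi> \<phi>)"
        if "\<chi> \<in> Hom K W V" for \<chi>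
        by (rule iter_diff_affine[OF mH[OF U]])
          (use L \<phi> copair_add[OF U W V _ _ that] in \<open>simp_all add: hom_space_simps(1)\<close>)
      \<comment> \<open>The base case \<psi> = 0, where only the component \<open>z\<close> of
        \<open>p1\<close> is seen.\<close>
      have "h t z = iter_diff K (?H U) L (\<lambda>\<phi>. ?g (?T ?o \<phi>)) \<phi>"
        unfolding h_def
      proof (rule iter_diff_cong[OF mH[OF U]])
        fix \<chi> assume "\<chi> \<in> carrier (?H U)"
        then have c: "\<chi> \<in> Hom K U V" by (simp add: hom_space_simps)
        have "mor P ?S V (?T ?o \<chi>) p1 = mor P U V \<chi> z"
          unfolding copair_zero[OF mU mW mV c] mor_compose[OF S U V fst c p1S] p1(2) ..
        then show "translate_diff V f U t z \<chi> = ?g (?T ?o \<chi>)"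
          by (simp add: translate_diff_def)
      qed (use L \<phi> in \<open>simp_all add: hom_space_simps\<close>)
      also have "\<dots> = iter_diff K (?H ?S) (map ?\<sigma> L) ?g (?T ?o \<phi>)" by (rule aff[OF o])
      \<comment> \<open>The base point moves from (\<phi>, 0) to (\<phi>, \<psi>) without effect,
        since one more difference is zero.\<close>
      also have "\<dots> = iter_diff K (?H ?S) (map ?\<sigma> L) ?g (?T \<psi> \<phi>)"
      proof (rule iter_diff_base_independent[OF mH[OF S]])
        show L': "set (map ?\<sigma> L) \<subseteq> carrier (?H ?S)"
          using L compose_in_Hom[OF Vec_module[OF S] fst] by (auto simp: hom_space_simps)
        show "?T ?o \<phi> \<in> carrier (?H ?S)" "?T \<psi> \<phi> \<in> carrier (?H ?S)"
          using T[OF o \<phi>] T[OF \<psi> \<phi>] by (simp_all add: hom_space_simps)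
        show "?g \<chi> \<in> carrier K" if "\<chi> \<in> carrier (?H ?S)" for \<chi>
        proof -
          have "mor P ?S V \<chi> p1 \<in> carrier (obj P V)"
            using HomD(1)[OF mor_Hom[OF S V] p1S] that by (simp add: hom_space_simps)
          then show ?thesis using tV fK by (simp add: translate_diff_def)
        qed
        show "iter_diff K (?H ?S) (\<chi> # map ?\<sigma> L) ?g \<xi> = \<zero>\<^bsub>K\<^esub>"
          if "\<chi> \<in> carrier (?H ?S)" "\<xi> \<in> carrier (?H ?S)" for \<chi> \<xi>
        \<comment> \<open>A nonzero value would be a (k + 1)-fold difference for U \<oplus> W,
          \<open>p1\<close> and \<open>t\<close>, against the choice of k.\<close>
        proof (rule ccontr)
          assume ne: "iter_diff K (?H ?S) (\<chi> # map ?\<sigma> L) ?g \<xi> \<noteq> \<zero>\<^bsub>K\<^esub>"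
          have "length (\<chi> # map ?\<sigma> L) = Suc k" using L by simp
          moreover have "set (\<chi> # map ?\<sigma> L) \<subseteq> Hom K ?S V"
            using L' that by (simp add: hom_space_simps)
          moreover have "\<xi> \<in> Hom K ?S V" using that by (simp add: hom_space_simps)
          ultimately have "good (Suc k)"
            unfolding good_def using S p1(1) t ne by blast
          then show False using not_good by blast
        qed
      qed
      also have "\<dots> = iter_diff K (?H U) L (\<lambda>\<phi>. ?g (?T \<psi> \<phi>)) \<phi>" by (rule aff[OF \<psi>, symmetric])
      finally show ?thesis .
    qed
    show "p = p'"
    proof (rule ccontr)
      assume "p \<noteq> p'"
      then have r0: "r \<noteq> \<zero>\<^bsub>obj P W\<^esub>"
        using p'_eq pS linear_map_zero[OF PW.module_axioms PS.module_axioms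
           Hom_linear_map[OF mor_Hom[OF W S inr]]] by auto
      have "h (s1 \<oplus>\<^bsub>obj P V\<^esub> mor P W V \<psi> r) z = h s1 z" if \<psi>: "\<psi> \<in> Hom K W V" and s1: "s1 \<in> R V" for \<psi> s1
      proof -
        let ?t = "mor P W V \<psi> r"
        have t: "?t \<in> R V" by (rule R_mor[OF W V \<psi> r])
        have tV: "?t \<in> carrier (obj P V)" "s1 \<in> carrier (obj P V)" using R_carrier[OF V] t s1 by auto
        have "h (s1 \<oplus>\<^bsub>obj P V\<^esub> ?t) z =
            iter_diff K (?H U) L (\<lambda>\<phi>. translate_diff V f ?S (s1 \<oplus>\<^bsub>obj P V\<^esub> ?t) p (copair U W V \<phi> \<psi>)) \<phi>"
          by (rule h_eq[OF pX(1) z_def[symmetric] R_add[OF V s1 t] \<psi>])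
        also have "\<dots> = iter_diff K (?H U) L (\<lambda>\<phi>. translate_diff V f ?S s1 p' (copair U W V \<phi> \<psi>)) \<phi>"
        proof (rule iter_diff_cong[OF mH[OF U]])
          fix \<chi> assume "\<chi> \<in> carrier (?H U)"
          then have c: "copair U W V \<chi> \<psi> \<in> Hom K ?S V" "\<chi> \<in> Hom K U V"
            by (simp_all add: hom_space_simps copair_Hom[OF mU mW mV _ \<psi>])
          let ?m = "mor P ?S V (copair U W V \<chi> \<psi>)"
          have m: "?m p \<in> X V" "?m p' \<in> X V" using X_mor[OF S V c(1)] pX by auto
          have mp: "?m p \<in> carrier (obj P V)" by (rule X_carrier[OF V m(1)])
          have "?m (mor P W ?S (dsum_inr U W) r) = ?t"
            using mor_compose[OF W S V inr c(1) rW] by (simp add: copair_inr[OF mU mW mV c(2) \<psi>])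
          then have m': "?m p' = ?t \<oplus>\<^bsub>obj P V\<^esub> ?m p"
            unfolding p'_eq HomD(2)[OF mor_Hom[OF S V c(1)] irS pS(1)] by simp
          \<comment> \<open>The same element of P(V) is reached from \<open>p\<close> with the
            longer translation and from \<open>p'\<close> with the shorter one. The subtracted
            values of \<open>f\<close> vanish, as both images lie in X(V).\<close>
          have "?m p \<oplus>\<^bsub>obj P V\<^esub> (s1 \<oplus>\<^bsub>obj P V\<^esub> ?t) = ?m p' \<oplus>\<^bsub>obj P V\<^esub> s1"
            unfolding m' using mp tV by (simp add: PV.a_ac)
          then show "translate_diff V f ?S (s1 \<oplus>\<^bsub>obj P V\<^esub> ?t) p (copair U W V \<chi> \<psi>) =
              translate_diff V f ?S s1 p' (copair U W V \<chi> \<psi>)"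
            by (simp add: translate_diff_def fX m)
        qed (use L \<phi> in \<open>simp_all add: hom_space_simps\<close>)
        also have "\<dots> = h s1 z" by (rule h_eq[OF pX(2) z' s1 \<psi>, symmetric])
        finally show ?thesis .
      qed
      \<comment> \<open>Invariance is used from the starting point 0; the difference belonging to
        translation by 0 is identically zero.\<close>
      from R_generated[OF W r r0 V s R_zero_mem[OF V], of "\<lambda>t. h t z", OF this]
      have "h s z = h \<zero>\<^bsub>obj P V\<^esub> z"
        using R_carrier[OF V s] by simp
      also have "\<dots> = \<zero>\<^bsub>K\<^esub>"
      proof -
        have "h \<zero>\<^bsub>obj P V\<^esub> z = iter_diff K (?H U) L (\<lambda>_. \<zero>\<^bsub>K\<^esub>) \<phi>"
          unfolding h_def
        proof (rule iter_diff_cong[OF mH[OF U]])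
          fix \<chi> assume "\<chi> \<in> carrier (?H U)"
          then have "mor P U V \<chi> z \<in> carrier (obj P V)"
            using HomD(1)[OF mor_Hom[OF U V] zU] by (simp add: hom_space_simps)
          then show "translate_diff V f U \<zero>\<^bsub>obj P V\<^esub> z \<chi> = \<zero>\<^bsub>K\<^esub>"
            using fK by (simp add: translate_diff_def PV.R.minus_eq PV.R.r_neg)
        qed (use L \<phi> in \<open>simp_all add: hom_space_simps\<close>)
        moreover have "iter_diff K (?H U) L' (\<lambda>_. \<zero>\<^bsub>K\<^esub>) \<chi> = \<zero>\<^bsub>K\<^esub>" for L' \<chi>
          by (induction L' arbitrary: \<chi>) (simp_all add: PV.R.minus_eq)
        ultimately show ?thesis by simp
      qed
      finally show False using hp by (simp add: z_def)
    qed
  qed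
  ultimately show ?thesis using U by blast
qed

end

section \<open>Quotient representations\<close>

text \<open>A \<open>LEAST\<close> over the integers need not be attained; the lower bound
  \<open>m\<close> reduces it to the natural numbers. Degrees of functions and of representations
  are of this form with m = -1.\<close>

lemma least_int_ge:
  fixes Q :: "int \<Rightarrow> bool"
  assumes "m \<le> e" "Q e"
  shows "m \<le> (LEAST e. m \<le> e \<and> Q e) \<and> Q (LEAST e. m \<le> e \<and> Q e) \<and> (LEAST e. m \<le> e \<and> Q e) \<le> e"
proof -
  let ?q = "\<lambda>n. Q (m + int n)"
  define n where "n = (LEAST n. ?q n)"
  have ex: "?q (nat (e - m))" using assms by simp
  have n: "?q n" unfolding n_def by (rule LeastI[of ?q, OF ex])
  have least: "m + int n \<le> i" if "m \<le> i" "Q i" for i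
  proof -
    have "?q (nat (i - m))" using that by simp
    then have "n \<le> nat (i - m)" unfolding n_def by (rule Least_le)
    then show ?thesis using that by linarith
  qed
  have "(LEAST e. m \<le> e \<and> Q e) = m + int n"
    by (rule Least_equality) (use n least in auto)
  then show ?thesis using n least[OF assms] by simp
qed

lemma fun_le_mono: "f \<in> fun_le K V e \<Longrightarrow> e \<le> e' \<Longrightarrow> f \<in> fun_le K V e'"
  unfolding fun_le_def by (fastforce intro: order_trans)

lemma map_le_mono: "F \<in> map_le K V W e \<Longrightarrow> e \<le> e' \<Longrightarrow> F \<in> map_le K V W e'"
  unfolding map_le_def using fun_le_mono by blast

lemma rep_le_mono: "rep_le K P e \<Longrightarrow> e \<le> e' \<Longrightarrow> rep_le K P e'"
  unfolding rep_le_def using map_le_mono by blast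

text \<open>\<open>function_poly_lt\<close> provides some degree bound, so the minimum that defines
  the degree exists.\<close>

lemma fun_le_fun_degree:
  assumes "field K" "finite (carrier K)" "V \<in> Vec K" "f \<in> carrier (fun_ring K V)"
  shows "f \<in> fun_le K V (fun_degree K V f)"
proof -
  obtain n b where b: "is_basis K V n b" using assms(3) by (auto simp: Vec_def)
  have f: "f x \<in> carrier K" if "x \<in> carrier V" for x
    using assms(4) that by (auto simp: fun_ring_def)
  have "\<exists>m. poly_lt K V m f"
    by (rule function_poly_lt[OF assms(1,2) Vec_module[OF assms(3)] b Vec_finite[OF assms(2,3)]]) (rule f)
  then obtain m where m: "poly_lt K V m f" ..
  have "restrict f (carrier V) \<in> fun_le K V (int m - 1)"
    by (rule poly_lt_fun_le[OF assms(1) Vec_module[OF assms(3)] _ m]) (use b in blast)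
  moreover have "restrict f (carrier V) = f"
    using assms(4) by (simp add: fun_ring_def PiE_restrict)
  ultimately have "f \<in> fun_le K V (int m - 1)" by simp
  with least_int_ge[of "-1" "int m - 1" "\<lambda>e. f \<in> fun_le K V e"]
  show "f \<in> fun_le K V (fun_degree K V f)"
    by (simp add: fun_degree_def)
qed

lemma fun_degree_le: "f \<in> fun_le K V e \<Longrightarrow> -1 \<le> e \<Longrightarrow> fun_degree K V f \<le> e"
  using least_int_ge[of "-1" e "\<lambda>e. f \<in> fun_le K V e"] by (simp add: fun_degree_def)

section \<open>Cosets and quotient spaces\<close>

lemma submodule_abelian_subgroup:
  assumes "module K V" "submodule N K V"
  shows "abelian_subgroup N V"
proof -
  interpret V: module K V by fact
  show ?thesis
    by (rule abelian_subgroupI3)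
      (use submodule.axioms(1)[OF assms(2)] V.abelian_group_axioms in \<open>auto simp: additive_subgroup_def\<close>)
qed

lemma quot_proj_eq_iff:
  assumes "module K V" "submodule N K V" "x \<in> carrier V" "y \<in> carrier V"
  shows "quot_proj V N x = quot_proj V N y \<longleftrightarrow> x \<ominus>\<^bsub>V\<^esub> y \<in> N"
proof -
  interpret N: abelian_subgroup N V by (rule submodule_abelian_subgroup[OF assms(1,2)])
  have "x \<ominus>\<^bsub>V\<^esub> y \<in> N \<longleftrightarrow> x \<in> N +>\<^bsub>V\<^esub> y"
    using N.a_rcos_module[OF assms(4,3)] by (simp add: N.minus_eq)
  also have "\<dots> \<longleftrightarrow> N +>\<^bsub>V\<^esub> x = N +>\<^bsub>V\<^esub> y"
    using N.a_repr_independence'[OF _ assms(4)] N.a_rcos_self[OF assms(3)] by metis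
  finally show ?thesis by (simp add: quot_proj_def)
qed

lemma quot_proj_memD:
  assumes "module K V" "submodule N K V" "x \<in> carrier V" "y \<in> quot_proj V N x"
  shows "y \<in> carrier V" "y \<ominus>\<^bsub>V\<^esub> x \<in> N"
proof -
  interpret N: abelian_subgroup N V by (rule submodule_abelian_subgroup[OF assms(1,2)])
  show "y \<in> carrier V"
    using assms(3,4) unfolding quot_proj_def by (rule N.a_elemrcos_carrier)
  then show "y \<ominus>\<^bsub>V\<^esub> x \<in> N"
    using N.a_rcos_module[OF assms(3), of y] assms(4) by (simp add: N.minus_eq quot_proj_def)
qed

lemma quot_proj_self:
  assumes "module K V" "submodule N K V" "x \<in> carrier V"
  shows "x \<in> quot_proj V N x"
proof -
  interpret N: abelian_subgroup N V by (rule submodule_abelian_subgroup[OF assms(1,2)])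
  show ?thesis using N.a_rcos_self[OF assms(3)] by (simp add: quot_proj_def)
qed

text \<open>The operations on quotients are written as unions over a coset. As \<open>T\<close>
  respects the submodules, all members contribute the same coset, and the union collapses.\<close>

lemma UN_quot_proj:
  assumes "module K V" "submodule N K V" "x \<in> carrier V" "module K W" "submodule N' K W"
    "linear_map K V W T" "T ` N \<subseteq> N'"
  shows "(\<Union>p\<in>quot_proj V N x. quot_proj W N' (T p)) = quot_proj W N' (T x)"
proof -
  have "quot_proj W N' (T p) = quot_proj W N' (T x)" if "p \<in> quot_proj V N x" for p
  proof -
    note p = quot_proj_memD[OF assms(1-3) that]
    have "T p \<ominus>\<^bsub>W\<^esub> T x \<in> N'"
      using assms(7) p linear_map_diff[OF assms(1,4,6) p(1) assms(3)] by auto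
    then show ?thesis
      using quot_proj_eq_iff[OF assms(4,5)] linear_map_closed[OF assms(6)] p(1) assms(3) by blast
  qed
  then show ?thesis using quot_proj_self[OF assms(1-3)] by blast
qed

lemma quot_space_simps:
  assumes "module K V" "submodule N K V"
  shows "carrier (quot_space V N) = quot_proj V N ` carrier V"
    "\<zero>\<^bsub>quot_space V N\<^esub> = quot_proj V N \<zero>\<^bsub>V\<^esub>"
    "x \<in> carrier V \<Longrightarrow> y \<in> carrier V \<Longrightarrow>
      quot_proj V N x \<oplus>\<^bsub>quot_space V N\<^esub> quot_proj V N y = quot_proj V N (x \<oplus>\<^bsub>V\<^esub> y)"
    "a \<in> carrier K \<Longrightarrow> x \<in> carrier V \<Longrightarrow>
      a \<odot>\<^bsub>quot_space V N\<^esub> quot_proj V N x = quot_proj V N (a \<odot>\<^bsub>V\<^esub> x)"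
proof -
  interpret V: module K V by fact
  interpret N: abelian_subgroup N V by (rule submodule_abelian_subgroup[OF assms])
  show "carrier (quot_space V N) = quot_proj V N ` carrier V"
    by (auto simp: quot_space_def quot_proj_def A_RCOSETS_def')
  show "\<zero>\<^bsub>quot_space V N\<^esub> = quot_proj V N \<zero>\<^bsub>V\<^esub>"
    using N.a_subset by (simp add: quot_space_def quot_proj_def)
  show "quot_proj V N x \<oplus>\<^bsub>quot_space V N\<^esub> quot_proj V N y = quot_proj V N (x \<oplus>\<^bsub>V\<^esub> y)"
    if "x \<in> carrier V" "y \<in> carrier V"
    using N.a_rcos_sum[OF that] by (simp add: quot_space_def quot_proj_def)
  show "a \<odot>\<^bsub>quot_space V N\<^esub> quot_proj V N x = quot_proj V N (a \<odot>\<^bsub>V\<^esub> x)"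
    if "a \<in> carrier K" "x \<in> carrier V"
  proof -
    have "linear_map K V V (\<lambda>x. a \<odot>\<^bsub>V\<^esub> x)"
      using that(1) by (auto simp: linear_map_def V.smult_r_distr V.smult_assoc1[symmetric] V.R.m_comm)
    moreover have "(\<lambda>x. a \<odot>\<^bsub>V\<^esub> x) ` N \<subseteq> N" using V.submoduleE(4)[OF assms(2) that(1)] by auto
    ultimately show ?thesis
      using UN_quot_proj[OF assms that(2) assms] by (simp add: quot_space_def)
  qed
qed

lemma module_quot_space:
  assumes "module K V" "submodule N K V"
  shows "module K (quot_space V N)"
proof -
  interpret V: module K V by fact
  note q = quot_space_simps[OF assms]
  show ?thesis
  proof (rule moduleI)
    show "cring K" by (rule V.R.is_cring)
    show "abelian_group (quot_space V N)"
    proof (rule abelian_groupI)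
      fix A assume "A \<in> carrier (quot_space V N)"
      then obtain x where x: "x \<in> carrier V" "A = quot_proj V N x" by (auto simp: q)
      then show "\<exists>B\<in>carrier (quot_space V N). B \<oplus>\<^bsub>quot_space V N\<^esub> A = \<zero>\<^bsub>quot_space V N\<^esub>"
        by (intro bexI[of _ "quot_proj V N (\<ominus>\<^bsub>V\<^esub> x)"]) (auto simp: q V.l_neg)
    qed (auto simp: q V.a_ac)
  qed (auto simp: q V.smult_l_distr V.smult_r_distr V.smult_assoc1)
qed

lemma linear_map_quot_proj:
  assumes "module K V" "submodule N K V"
  shows "linear_map K V (quot_space V N) (quot_proj V N)"
  using quot_space_simps[OF assms] by (simp add: linear_map_def)

lemma linear_map_from_quot:
  assumes "module K V" "submodule N K V"
    "\<And>x. x \<in> carrier V \<Longrightarrow> G (quot_proj V N x) = T x" "linear_map K V W T"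
  shows "linear_map K (quot_space V N) W G"
proof -
  interpret V: module K V by fact
  show ?thesis
    using assms(3,4) by (auto simp: linear_map_def quot_space_simps[OF assms(1,2)])
qed

lemma linear_map_compose:
  "linear_map K U V S \<Longrightarrow> linear_map K V W T \<Longrightarrow> linear_map K U W (\<lambda>x. T (S x))"
  by (simp add: linear_map_def)

lemma fun_le_closed: "f \<in> fun_le K V e \<Longrightarrow> x \<in> carrier V \<Longrightarrow> f x \<in> carrier K"
  by (auto simp: fun_le_def fun_ring_def)

section \<open>Degrees of quotient representations\<close>

lemma is_subrepD:
  assumes "is_subrep K P N" "V \<in> Vec K" "W \<in> Vec K" "\<phi> \<in> Hom K V W"
  shows "submodule (N V) K (obj P V)" "mor P V W \<phi> ` N V \<subseteq> N W"
  using assms by (auto simp: is_subrep_def is_subset_def)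

lemma is_functorD:
  assumes "is_functor K P" "V \<in> Vec K" "W \<in> Vec K" "\<phi> \<in> Hom K V W"
  shows "obj P V \<in> Vec K" "module K (obj P V)" "mor P V W \<phi> \<in> Hom K (obj P V) (obj P W)"
    "linear_map K (obj P V) (obj P W) (mor P V W \<phi>)"
  using assms by (auto simp: is_functor_def intro: Vec_module Hom_linear_map)

lemma quot_rep_mor:
  assumes "is_functor K P" "is_subrep K P N" "U \<in> Vec K" "V \<in> Vec K" "\<phi> \<in> Hom K U V"
  shows "mor (quot_rep P N) U V \<phi> \<in>
      Hom K (quot_space (obj P U) (N U)) (quot_space (obj P V) (N V))"
    "x \<in> carrier (obj P U) \<Longrightarrow>
      mor (quot_rep P N) U V \<phi> (quot_proj (obj P U) (N U) x) =
        quot_proj (obj P V) (N V) (mor P U V \<phi> x)"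
proof -
  note mU = Vec_module[OF assms(3)] and mV = Vec_module[OF assms(4)]
  note FU = is_functorD[OF assms(1,3,3) id_in_Hom[OF mU]]
  note FV = is_functorD[OF assms(1,4,4) id_in_Hom[OF mV]]
  note F = is_functorD[OF assms(1,3-5)]
  note SU = is_subrepD[OF assms(2,3,3) id_in_Hom[OF mU]]
  note SV = is_subrepD[OF assms(2,4,4) id_in_Hom[OF mV]]
  note S = is_subrepD[OF assms(2-5)]
  have ev: "(\<Union>p\<in>quot_proj (obj P U) (N U) x. quot_proj (obj P V) (N V) (mor P U V \<phi> p)) =
      quot_proj (obj P V) (N V) (mor P U V \<phi> x)" if "x \<in> carrier (obj P U)" for x
    by (rule UN_quot_proj[OF FU(2) SU(1) that FV(2) SV(1) F(4) S(2)])
  then show *: "mor (quot_rep P N) U V \<phi> (quot_proj (obj P U) (N U) x) =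
        quot_proj (obj P V) (N V) (mor P U V \<phi> x)" if "x \<in> carrier (obj P U)" for x
    using that by (simp add: quot_rep_def quot_space_simps(1)[OF FU(2) SU(1)])
  have "linear_map K (quot_space (obj P U) (N U)) (quot_space (obj P V) (N V))
      (mor (quot_rep P N) U V \<phi>)"
    by (rule linear_map_from_quot[OF FU(2) SU(1) *
        linear_map_compose[OF F(4) linear_map_quot_proj[OF FV(2) SV(1)]]])
  from restrict_in_Hom[OF module_quot_space[OF FU(2) SU(1)] this]
  show "mor (quot_rep P N) U V \<phi> \<in>
      Hom K (quot_space (obj P U) (N U)) (quot_space (obj P V) (N V))"
    by (simp add: quot_rep_def)
qed

text \<open>
  Modulo \<open>N\<close>, \<open>P(\<phi>)\<close> is the sum of the \<open>f j \<phi> * T j\<close>. If the \<open>T j\<close> respect \<open>N\<close>, this says that the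
  degree of \<open>P/N\<close> is at most \<open>e\<close>, without mentioning cosets.
\<close>

definition mor_decomposition ::
    "('k, 'm) ring_scheme \<Rightarrow> ('k, 'a, 'b) rep \<Rightarrow> ('k, 'a, 'b) family \<Rightarrow> int \<Rightarrow>
     ('k, 'a elem) module \<Rightarrow> ('k, 'a elem) module \<Rightarrow> nat \<Rightarrow>
     (nat \<Rightarrow> ('a elem \<Rightarrow> 'a elem) \<Rightarrow> 'k) \<Rightarrow> (nat \<Rightarrow> 'b \<Rightarrow> 'b) \<Rightarrow> bool" where
  "mor_decomposition K P N e U V r f T \<longleftrightarrow>
     (\<forall>j<r. f j \<in> fun_le K (hom_space K U V) e \<and> linear_map K (obj P U) (obj P V) (T j)) \<and>
     (\<forall>\<phi>\<in>Hom K U V. \<forall>x\<in>carrier (obj P U).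
        mor P U V \<phi> x \<ominus>\<^bsub>obj P V\<^esub> (\<Oplus>\<^bsub>obj P V\<^esub>j\<in>{..<r}. f j \<phi> \<odot>\<^bsub>obj P V\<^esub> T j x) \<in> N V)"

text \<open>Maps \<open>T j\<close> that respect N descend to the quotients, where the error in N(V)
  disappears.\<close>

lemma quot_mor_map_leI:
  assumes "is_functor K P" "is_subrep K P N" "U \<in> Vec K" "V \<in> Vec K"
    "mor_decomposition K P N e U V r f T" "\<And>j. j < r \<Longrightarrow> T j ` N U \<subseteq> N V"
  shows "mor (quot_rep P N) U V \<in>
    map_le K (hom_space K U V) (hom_space K (obj (quot_rep P N) U) (obj (quot_rep P N) V)) e"
proof -
  note mU = Vec_module[OF assms(3)] and mV = Vec_module[OF assms(4)]
  note FU = is_functorD[OF assms(1,3,3) id_in_Hom[OF mU]]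
  note FV = is_functorD[OF assms(1,4,4) id_in_Hom[OF mV]]
  note SU = is_subrepD[OF assms(2,3,3) id_in_Hom[OF mU]]
  note SV = is_subrepD[OF assms(2,4,4) id_in_Hom[OF mV]]
  interpret PV: module K "obj P V" by (rule FV(2))
  let ?QU = "quot_space (obj P U) (N U)" and ?QV = "quot_space (obj P V) (N V)"
  let ?qU = "quot_proj (obj P U) (N U)" and ?qV = "quot_proj (obj P V) (N V)"
  note mQU = module_quot_space[OF FU(2) SU(1)] and mQV = module_quot_space[OF FV(2) SV(1)]
  interpret QV: module K ?QV by (rule mQV)
  let ?H = "hom_space K ?QU ?QV"
  interpret H: module K ?H by (rule module_hom_space[OF mQU mQV])
  have f: "\<And>j. j < r \<Longrightarrow> f j \<in> fun_le K (hom_space K U V) e"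
    and T: "\<And>j. j < r \<Longrightarrow> linear_map K (obj P U) (obj P V) (T j)"
    and dec: "\<And>\<phi> x. \<phi> \<in> Hom K U V \<Longrightarrow> x \<in> carrier (obj P U) \<Longrightarrow>
        mor P U V \<phi> x \<ominus>\<^bsub>obj P V\<^esub> (\<Oplus>\<^bsub>obj P V\<^esub>j\<in>{..<r}. f j \<phi> \<odot>\<^bsub>obj P V\<^esub> T j x) \<in> N V"
    using assms(5) by (simp_all add: mor_decomposition_def)
  define w where "w j = (\<lambda>A\<in>carrier ?QU. \<Union>p\<in>A. ?qV (T j p))" for j
  have w_eq: "w j (?qU x) = ?qV (T j x)" if "j < r" "x \<in> carrier (obj P U)" for j x
    using UN_quot_proj[OF FU(2) SU(1) that(2) FV(2) SV(1) T[OF that(1)] assms(6)[OF that(1)]] that(2)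
    by (simp add: w_def quot_space_simps(1)[OF FU(2) SU(1)])
  have w_Hom: "w j \<in> Hom K ?QU ?QV" if j: "j < r" for j
  proof -
    have "linear_map K ?QU ?QV (w j)"
      by (rule linear_map_from_quot[OF FU(2) SU(1) w_eq[OF j]
          linear_map_compose[OF T[OF j] linear_map_quot_proj[OF FV(2) SV(1)]]])
    from restrict_in_Hom[OF mQU this] show ?thesis by (simp add: w_def)
  qed
  have fw: "f j \<phi> \<odot>\<^bsub>?H\<^esub> w j \<in> Hom K ?QU ?QV" if "\<phi> \<in> Hom K U V" "j < r" for \<phi> j
    using H.smult_closed[of "f j \<phi>" "w j"] fun_le_closed[OF f[OF that(2)], of \<phi>] w_Hom[OF that(2)] that(1)
    by (simp add: hom_space_simps(1))
  have "mor (quot_rep P N) U V \<phi> = (\<Oplus>\<^bsub>?H\<^esub>j\<in>{..<r}. f j \<phi> \<odot>\<^bsub>?H\<^esub> w j)" if p: "\<phi> \<in> Hom K U V" for \<phi>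
  proof (rule Hom_eqI)
    show "mor (quot_rep P N) U V \<phi> \<in> Hom K ?QU ?QV" by (rule quot_rep_mor(1)[OF assms(1-4) p])
    show "(\<Oplus>\<^bsub>?H\<^esub>j\<in>{..<r}. f j \<phi> \<odot>\<^bsub>?H\<^esub> w j) \<in> Hom K ?QU ?QV"
      using H.finsum_closed[of "\<lambda>j. f j \<phi> \<odot>\<^bsub>?H\<^esub> w j" "{..<r}"] fw[OF p]
      by (simp add: hom_space_simps(1) Pi_iff)
    fix A assume A: "A \<in> carrier ?QU"
    then obtain x where x: "x \<in> carrier (obj P U)" "A = ?qU x"
      by (auto simp: quot_space_simps(1)[OF FU(2) SU(1)])
    have fK: "f j \<phi> \<in> carrier K" if "j < r" for j
      by (rule fun_le_closed[OF f[OF that]]) (simp add: hom_space_simps(1) p)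
    have Tx: "T j x \<in> carrier (obj P V)" if "j < r" for j
      by (rule linear_map_closed[OF T[OF that] x(1)])
    have "(\<Oplus>\<^bsub>?H\<^esub>j\<in>{..<r}. f j \<phi> \<odot>\<^bsub>?H\<^esub> w j) A = (\<Oplus>\<^bsub>?QV\<^esub>j\<in>{..<r}. (f j \<phi> \<odot>\<^bsub>?H\<^esub> w j) A)"
      by (rule hom_space_finsum[OF mQU mQV _ _ A]) (use fw[OF p] in auto)
    also have "\<dots> = (\<Oplus>\<^bsub>?QV\<^esub>j\<in>{..<r}. ?qV (f j \<phi> \<odot>\<^bsub>obj P V\<^esub> T j x))"
    proof (rule QV.finsum_cong'[OF refl])
      show "(\<lambda>j. ?qV (f j \<phi> \<odot>\<^bsub>obj P V\<^esub> T j x)) \<in> {..<r} \<rightarrow> carrier ?QV"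
        using fK Tx by (auto simp: quot_space_simps(1)[OF FV(2) SV(1)])
      show "(f j \<phi> \<odot>\<^bsub>?H\<^esub> w j) A = ?qV (f j \<phi> \<odot>\<^bsub>obj P V\<^esub> T j x)" if "j \<in> {..<r}" for j
        using A x fK Tx that w_eq
        by (simp add: hom_space_simps(4) quot_space_simps(4)[OF FV(2) SV(1)])
    qed
    also have "\<dots> = ?qV (\<Oplus>\<^bsub>obj P V\<^esub>j\<in>{..<r}. f j \<phi> \<odot>\<^bsub>obj P V\<^esub> T j x)"
      by (rule linear_map_finsum[OF FV(2) mQV linear_map_quot_proj[OF FV(2) SV(1)], symmetric])
        (use fK Tx in auto)
    also have "\<dots> = ?qV (mor P U V \<phi> x)"
    proof -
      have "mor P U V \<phi> x \<in> carrier (obj P V)"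
        by (rule HomD(1)[OF is_functorD(3)[OF assms(1,3,4) p] x(1)])
      moreover have "(\<Oplus>\<^bsub>obj P V\<^esub>j\<in>{..<r}. f j \<phi> \<odot>\<^bsub>obj P V\<^esub> T j x) \<in> carrier (obj P V)"
        by (rule PV.finsum_closed) (use fK Tx in auto)
      ultimately show ?thesis
        using quot_proj_eq_iff[OF FV(2) SV(1)] dec[OF p x(1)] by metis
    qed
    finally show "mor (quot_rep P N) U V \<phi> A = (\<Oplus>\<^bsub>?H\<^esub>j\<in>{..<r}. f j \<phi> \<odot>\<^bsub>?H\<^esub> w j) A"
      using quot_rep_mor(2)[OF assms(1-4) p x(1)] x(2) by simp
  qed
  then show ?thesis
    unfolding map_le_def
    using quot_rep_mor(1)[OF assms(1-4)] f w_Hom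
    by (auto simp: hom_space_simps(1) quot_rep_def intro!: exI[of _ r] exI[of _ f] exI[of _ w])
qed

text \<open>The coefficient maps between quotients are lifted through a linear section of P(V)
  \<rightarrow> P(V)/N(V). The lifts kill N(U) altogether; this, unlike merely respecting N, is
  inherited by smaller subrepresentations.\<close>

lemma quot_mor_map_leD:
  assumes "field K" "finite (carrier K)" "is_functor K P" "is_subrep K P N" "U \<in> Vec K" "V \<in> Vec K"
    "mor (quot_rep P N) U V \<in>
      map_le K (hom_space K U V) (hom_space K (obj (quot_rep P N) U) (obj (quot_rep P N) V)) e"
  shows "\<exists>r f T. mor_decomposition K P N e U V r f T \<and> (\<forall>j<r. \<forall>x\<in>N U. T j x = \<zero>\<^bsub>obj P V\<^esub>)"
proof -
  note mU = Vec_module[OF assms(5)] and mV = Vec_module[OF assms(6)]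
  note FU = is_functorD[OF assms(3,5,5) id_in_Hom[OF mU]]
  note FV = is_functorD[OF assms(3,6,6) id_in_Hom[OF mV]]
  note SU = is_subrepD[OF assms(4,5,5) id_in_Hom[OF mU]]
  note SV = is_subrepD[OF assms(4,6,6) id_in_Hom[OF mV]]
  interpret PU: module K "obj P U" by (rule FU(2))
  interpret PV: module K "obj P V" by (rule FV(2))
  let ?QU = "quot_space (obj P U) (N U)" and ?QV = "quot_space (obj P V) (N V)"
  let ?qU = "quot_proj (obj P U) (N U)" and ?qV = "quot_proj (obj P V) (N V)"
  note mQU = module_quot_space[OF FU(2) SU(1)] and mQV = module_quot_space[OF FV(2) SV(1)]
  interpret QV: module K ?QV by (rule mQV)
  let ?H = "hom_space K ?QU ?QV"
  obtain r f w where fw: "\<forall>j<(r::nat). f j \<in> fun_le K (hom_space K U V) e \<and> w j \<in> carrier ?H"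
    "\<forall>\<phi>\<in>carrier (hom_space K U V). mor (quot_rep P N) U V \<phi> = (\<Oplus>\<^bsub>?H\<^esub>j\<in>{..<r}. f j \<phi> \<odot>\<^bsub>?H\<^esub> w j)"
    using assms(7) unfolding map_le_def quot_rep_def by auto
  have wH: "w j \<in> Hom K ?QU ?QV" if "j < r" for j using fw that by (simp add: hom_space_simps)
  obtain c where c: "linear_map K (obj P V) (obj P V) c" "\<forall>x\<in>N V. c x = \<zero>\<^bsub>obj P V\<^esub>"
      "\<forall>x\<in>carrier (obj P V). x \<ominus>\<^bsub>obj P V\<^esub> c x \<in> N V"
    using complement_projection[OF assms(1,2) FV(1) SV(1)] by blast
  have cV: "c x \<in> carrier (obj P V)" if "x \<in> carrier (obj P V)" for x
    by (rule linear_map_closed[OF c(1) that])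
  \<comment> \<open>Since \<open>c\<close> kills N(V), the chosen representative does not matter;
    since \<open>c\<close> is the identity modulo N(V), \<open>lift\<close> is a section.\<close>
  define lift where "lift A = c (SOME y. y \<in> carrier (obj P V) \<and> ?qV y = A)" for A
  have lift: "lift (?qV y) = c y" if y: "y \<in> carrier (obj P V)" for y
  proof -
    define y0 where "y0 = (SOME y'. y' \<in> carrier (obj P V) \<and> ?qV y' = ?qV y)"
    have "y0 \<in> carrier (obj P V) \<and> ?qV y0 = ?qV y"
      unfolding y0_def by (rule someI[of _ y]) (simp add: y)
    then have y0: "y0 \<in> carrier (obj P V)" "y0 \<ominus>\<^bsub>obj P V\<^esub> y \<in> N V"
      using quot_proj_eq_iff[OF FV(2) SV(1) _ y] by blast+
    have "c y0 \<ominus>\<^bsub>obj P V\<^esub> c y = \<zero>\<^bsub>obj P V\<^esub>"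
      using c(2) y0 linear_map_diff[OF FV(2,2) c(1) y0(1) y] by auto
    then have "c y0 = c y" by (rule PV.minus_eq_zeroD[OF cV[OF y0(1)] cV[OF y]])
    then show ?thesis by (simp add: lift_def y0_def)
  qed
  have lift_lin: "linear_map K ?QV (obj P V) lift"
    by (rule linear_map_from_quot[OF FV(2) SV(1) lift c(1)])
  define T where "T j x = lift (w j (?qU x))" for j x
  have T: "linear_map K (obj P U) (obj P V) (T j)" if "j < r" for j
    unfolding T_def
    by (rule linear_map_compose[OF linear_map_compose[OF linear_map_quot_proj[OF FU(2) SU(1)]
        Hom_linear_map[OF wH[OF that]]] lift_lin])
  have T0: "T j x = \<zero>\<^bsub>obj P V\<^esub>" if "j < r" "x \<in> N U" for j x
  proof -
    have xU: "x \<in> carrier (obj P U)" using that(2) PU.submoduleE(1)[OF SU(1)] by blast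
    have "?qU x = ?qU \<zero>\<^bsub>obj P U\<^esub>"
      using quot_proj_eq_iff[OF FU(2) SU(1) xU PU.zero_closed] that(2) xU
        PU.minus_equality[of "\<zero>\<^bsub>obj P U\<^esub>" "\<zero>\<^bsub>obj P U\<^esub>"] by (simp add: PU.minus_eq)
    then have "T j x = T j \<zero>\<^bsub>obj P U\<^esub>" by (simp add: T_def)
    also have "\<dots> = \<zero>\<^bsub>obj P V\<^esub>" by (rule linear_map_zero[OF FU(2) FV(2) T[OF that(1)]])
    finally show ?thesis .
  qed
  have "mor P U V \<phi> x \<ominus>\<^bsub>obj P V\<^esub> (\<Oplus>\<^bsub>obj P V\<^esub>j\<in>{..<r}. f j \<phi> \<odot>\<^bsub>obj P V\<^esub> T j x) \<in> N V"
    if p: "\<phi> \<in> Hom K U V" and x: "x \<in> carrier (obj P U)" for \<phi> x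
  proof -
    have qx: "?qU x \<in> carrier ?QU" using x by (auto simp: quot_space_simps(1)[OF FU(2) SU(1)])
    have fK: "f j \<phi> \<in> carrier K" if "j < r" for j
      using fw(1) that p by (auto intro!: fun_le_closed[of "f j"] simp: hom_space_simps(1))
    have wx: "w j (?qU x) \<in> carrier ?QV" if "j < r" for j by (rule HomD(1)[OF wH[OF that] qx])
    have mx: "mor P U V \<phi> x \<in> carrier (obj P V)"
      by (rule HomD(1)[OF is_functorD(3)[OF assms(3,5,6) p] x])
    have "?qV (mor P U V \<phi> x) = (\<Oplus>\<^bsub>?H\<^esub>j\<in>{..<r}. f j \<phi> \<odot>\<^bsub>?H\<^esub> w j) (?qU x)"
      using quot_rep_mor(2)[OF assms(3-6) p x] fw(2) p by (simp add: hom_space_simps(1))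
    also have "\<dots> = (\<Oplus>\<^bsub>?QV\<^esub>j\<in>{..<r}. (f j \<phi> \<odot>\<^bsub>?H\<^esub> w j) (?qU x))"
      by (rule hom_space_finsum[OF mQU mQV _ _ qx])
        (use smult_in_Hom[OF mQU mQV wH fK] in \<open>auto simp: hom_space_simps(4)\<close>)
    also have "\<dots> = (\<Oplus>\<^bsub>?QV\<^esub>j\<in>{..<r}. f j \<phi> \<odot>\<^bsub>?QV\<^esub> w j (?qU x))"
      by (rule QV.finsum_cong') (use fK wx qx in \<open>auto simp: hom_space_simps(4)\<close>)
    finally have "lift (?qV (mor P U V \<phi> x)) = lift (\<Oplus>\<^bsub>?QV\<^esub>j\<in>{..<r}. f j \<phi> \<odot>\<^bsub>?QV\<^esub> w j (?qU x))"
      by simp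
    also have "\<dots> = (\<Oplus>\<^bsub>obj P V\<^esub>j\<in>{..<r}. lift (f j \<phi> \<odot>\<^bsub>?QV\<^esub> w j (?qU x)))"
      by (rule linear_map_finsum[OF mQV FV(2) lift_lin]) (use fK wx in auto)
    also have "\<dots> = (\<Oplus>\<^bsub>obj P V\<^esub>j\<in>{..<r}. f j \<phi> \<odot>\<^bsub>obj P V\<^esub> T j x)"
      by (rule PV.finsum_cong')
        (use fK wx linear_map_closed[OF T x] in \<open>auto simp: linear_map_smult[OF lift_lin] T_def\<close>)
    finally show ?thesis using lift[OF mx] c(3) mx by auto
  qed
  then have "mor_decomposition K P N e U V r f T"
    using fw(1) T by (simp add: mor_decomposition_def)
  then show ?thesis using T0 by blast
qed

lemma rep_le_quot_repI:
  assumes "is_functor K P" "is_subrep K P N"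
    "\<And>U V. U \<in> Vec K \<Longrightarrow> V \<in> Vec K \<Longrightarrow>
      \<exists>r f T. mor_decomposition K P N e U V r f T \<and> (\<forall>j<r. T j ` N U \<subseteq> N V)"
  shows "rep_le K (quot_rep P N) e"
  unfolding rep_le_def
proof (intro ballI)
  fix U V :: "('a, 'c elem) module" assume UV: "U \<in> Vec K" "V \<in> Vec K"
  obtain r f T where "mor_decomposition K P N e U V r f T" "\<forall>j<r. T j ` N U \<subseteq> N V"
    using assms(3)[OF UV] by blast
  then show "mor (quot_rep P N) U V \<in>
      map_le K (hom_space K U V) (hom_space K (obj (quot_rep P N) U) (obj (quot_rep P N) V)) e"
    by (intro quot_mor_map_leI[OF assms(1,2) UV]) auto
qed

text \<open>The coefficient maps \<open>w j\<close> of P need not respect N, although every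
  P(\<phi>) does. Composing them with a projection \<open>c\<close> along N(U) makes them kill N(U),
  at the price of an error P(\<phi>)(x - c x), which lies in N(V).\<close>

lemma rep_le_quot_rep:
  assumes "field K" "finite (carrier K)" "is_functor K P" "rep_le K P e" "is_subrep K P N"
  shows "rep_le K (quot_rep P N) e"
proof (rule rep_le_quot_repI[OF assms(3,5)])
  fix U V :: "('a, 'c elem) module" assume U: "U \<in> Vec K" and V: "V \<in> Vec K"
  note mU = Vec_module[OF U] and mV = Vec_module[OF V]
  note FU = is_functorD[OF assms(3) U U id_in_Hom[OF mU]]
  note FV = is_functorD[OF assms(3) V V id_in_Hom[OF mV]]
  note SU = is_subrepD[OF assms(5) U U id_in_Hom[OF mU]]
  interpret PU: module K "obj P U" by (rule FU(2))
  interpret PV: module K "obj P V" by (rule FV(2))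
  let ?H = "hom_space K (obj P U) (obj P V)"
  have "mor P U V \<in> map_le K (hom_space K U V) ?H e"
    using assms(4) U V by (simp add: rep_le_def)
  then obtain r f w where fw: "\<forall>j<(r::nat). f j \<in> fun_le K (hom_space K U V) e \<and> w j \<in> carrier ?H"
    "\<forall>\<phi>\<in>carrier (hom_space K U V). mor P U V \<phi> = (\<Oplus>\<^bsub>?H\<^esub>j\<in>{..<r}. f j \<phi> \<odot>\<^bsub>?H\<^esub> w j)"
    unfolding map_le_def by auto
  have wH: "w j \<in> Hom K (obj P U) (obj P V)" if "j < r" for j
    using fw that by (simp add: hom_space_simps)
  obtain c where c: "linear_map K (obj P U) (obj P U) c" "\<forall>x\<in>N U. c x = \<zero>\<^bsub>obj P U\<^esub>"
      "\<forall>x\<in>carrier (obj P U). x \<ominus>\<^bsub>obj P U\<^esub> c x \<in> N U"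
    using complement_projection[OF assms(1,2) FU(1) SU(1)] by blast
  have T: "linear_map K (obj P U) (obj P V) (\<lambda>x. w j (c x))" if "j < r" for j
    by (rule linear_map_compose[OF c(1) Hom_linear_map[OF wH[OF that]]])
  have "mor P U V \<phi> x \<ominus>\<^bsub>obj P V\<^esub> (\<Oplus>\<^bsub>obj P V\<^esub>j\<in>{..<r}. f j \<phi> \<odot>\<^bsub>obj P V\<^esub> w j (c x)) \<in> N V"
    if p: "\<phi> \<in> Hom K U V" and x: "x \<in> carrier (obj P U)" for \<phi> x
  proof -
    have cx: "c x \<in> carrier (obj P U)" by (rule linear_map_closed[OF c(1) x])
    have fK: "f j \<phi> \<in> carrier K" if "j < r" for j
      using fw(1) that p by (auto intro!: fun_le_closed[of "f j"] simp: hom_space_simps(1))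
    have "mor P U V \<phi> (c x) = (\<Oplus>\<^bsub>?H\<^esub>j\<in>{..<r}. f j \<phi> \<odot>\<^bsub>?H\<^esub> w j) (c x)"
      using fw(2) p by (simp add: hom_space_simps(1))
    also have "\<dots> = (\<Oplus>\<^bsub>obj P V\<^esub>j\<in>{..<r}. (f j \<phi> \<odot>\<^bsub>?H\<^esub> w j) (c x))"
      by (rule hom_space_finsum[OF FU(2) FV(2) _ _ cx])
        (use smult_in_Hom[OF FU(2) FV(2) wH fK] in \<open>auto simp: hom_space_simps(4)\<close>)
    also have "\<dots> = (\<Oplus>\<^bsub>obj P V\<^esub>j\<in>{..<r}. f j \<phi> \<odot>\<^bsub>obj P V\<^esub> w j (c x))"
      by (rule PV.finsum_cong')
        (use fK cx HomD(1)[OF wH _] in \<open>auto simp: hom_space_simps(4)\<close>)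
    finally have "mor P U V \<phi> x \<ominus>\<^bsub>obj P V\<^esub> (\<Oplus>\<^bsub>obj P V\<^esub>j\<in>{..<r}. f j \<phi> \<odot>\<^bsub>obj P V\<^esub> w j (c x)) =
        mor P U V \<phi> (x \<ominus>\<^bsub>obj P U\<^esub> c x)"
      using linear_map_diff[OF FU(2) FV(2) is_functorD(4)[OF assms(3) U V p] x cx] by simp
    then show ?thesis using c(3) x is_subrepD(2)[OF assms(5) U V p] by auto
  qed
  then have "mor_decomposition K P N e U V r f (\<lambda>j x. w j (c x))"
    using fw(1) T by (simp add: mor_decomposition_def)
  moreover have "(\<lambda>x. w j (c x)) ` N U \<subseteq> N V" if "j < r" for j
  proof -
    have "w j \<zero>\<^bsub>obj P U\<^esub> = \<zero>\<^bsub>obj P V\<^esub>"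
      by (rule linear_map_zero[OF FU(2) FV(2) Hom_linear_map[OF wH[OF that]]])
    moreover have "\<zero>\<^bsub>obj P V\<^esub> \<in> N V"
      using subgroup.one_closed[OF submodule.axioms(1)[OF is_subrepD(1)[OF assms(5) V V id_in_Hom[OF mV]]]]
      by simp
    ultimately show ?thesis using c(2) by auto
  qed
  ultimately show "\<exists>r f T. mor_decomposition K P N e U V r f T \<and> (\<forall>j<r. T j ` N U \<subseteq> N V)"
    by blast
qed

lemma subrep_of_subrep:
  assumes "is_functor K P" "is_subrep K P Q" "is_subrep K (sub_rep P Q) R"
  shows "is_subrep K P R" "V \<in> Vec K \<Longrightarrow> R V \<subseteq> Q V"
proof -
  show sub: "R V \<subseteq> Q V" if "V \<in> Vec K" for V
    using assms(3) that by (auto simp: is_subrep_def is_subset_def sub_rep_def)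
  show "is_subrep K P R"
    unfolding is_subrep_def is_subset_def
  proof (intro conjI ballI)
    fix V :: "('a, 'c elem) module" assume V: "V \<in> Vec K"
    note mV = Vec_module[OF V]
    note F = is_functorD[OF assms(1) V V id_in_Hom[OF mV]]
    note S = is_subrepD[OF assms(2) V V id_in_Hom[OF mV]]
    interpret PV: module K "obj P V" by (rule F(2))
    let ?M = "(obj P V)\<lparr>carrier := Q V\<rparr>"
    interpret M: module K ?M by (rule submodule.submodule_is_module[OF S(1) F(2)])
    have R: "submodule (R V) K ?M" using assms(3) V by (auto simp: is_subrep_def sub_rep_def)
    show RV: "R V \<subseteq> carrier (obj P V)" using sub[OF V] PV.submoduleE(1)[OF S(1)] by blast
    have sm: "a \<odot>\<^bsub>obj P V\<^esub> x \<in> R V" if "a \<in> carrier K" "x \<in> R V" for a x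
      using M.submoduleE(4)[OF R that] by simp
    show "submodule (R V) K (obj P V)"
    proof (rule PV.submoduleI[OF RV])
      show "\<zero>\<^bsub>obj P V\<^esub> \<in> R V" using subgroup.one_closed[OF submodule.axioms(1)[OF R]] by simp
      show "x \<oplus>\<^bsub>obj P V\<^esub> y \<in> R V" if "x \<in> R V" "y \<in> R V" for x y using M.submoduleE(5)[OF R that] by simp
      show "\<ominus>\<^bsub>obj P V\<^esub> x \<in> R V" if "x \<in> R V" for x
        using sm[OF _ that, of "\<ominus>\<^bsub>K\<^esub> \<one>\<^bsub>K\<^esub>"] that RV by (auto simp: PV.smult_l_minus)
    qed (rule sm)
  next
    fix V W :: "('a, 'c elem) module" and \<phi> assume W: "V \<in> Vec K" "W \<in> Vec K" "\<phi> \<in> Hom K V W"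
    have "mor (sub_rep P Q) V W \<phi> ` R V \<subseteq> R W"
      using assms(3) W unfolding is_subrep_def is_subset_def by blast
    then show "mor P V W \<phi> ` R V \<subseteq> R W" using sub[OF W(1)] by (force simp: sub_rep_def)
  qed
qed

text \<open>
  The kernel of \<open>P(0)\<close> in \<open>Q\<close> is a subrepresentation, and dividing by it instead of \<open>Q\<close> only adds
  a constant part, so by minimality it is all of \<open>Q\<close>.
\<close>

lemma gt_part_zero:
  assumes "field K" "finite (carrier K)" "poly_rep K P" "d > 0" "is_gt_part K P (d - 1) Q"
    "W \<in> Vec K" "x \<in> Q W"
  shows "mor P W W (\<lambda>v\<in>carrier W. \<zero>\<^bsub>W\<^esub>) x = \<zero>\<^bsub>obj P W\<^esub>"
proof -
  have func: "is_functor K P" using assms(3) by (simp add: poly_rep_def)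
  obtain D where D: "rep_le K P D" using assms(3) by (auto simp: poly_rep_def)
  have Q: "is_subrep K P Q" and Qdeg: "rep_degree K (quot_rep P Q) \<le> d - 1"
    and Qmin: "\<And>Q'. is_subrep K P Q' \<Longrightarrow> rep_degree K (quot_rep P Q') \<le> d - 1 \<Longrightarrow>
      (\<forall>V\<in>Vec K. Q' V \<subseteq> Q V) \<Longrightarrow> (\<forall>V\<in>Vec K. Q' V = Q V)"
    using assms(5) by (auto simp: is_gt_part_def)
  \<comment> \<open>\<open>rep_degree\<close> is a minimum over the integers from -1 on; a bound in
    that range shows that it is attained.\<close>
  have "rep_le K (quot_rep P Q) (max D (-1))"
    by (rule rep_le_quot_rep[OF assms(1,2) func rep_le_mono[OF D] Q]) simp
  from least_int_ge[of "-1" "max D (-1)" "rep_le K (quot_rep P Q)", OF _ this]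
  have "rep_le K (quot_rep P Q) (rep_degree K (quot_rep P Q))"
    unfolding rep_degree_def by simp
  then have Qle: "rep_le K (quot_rep P Q) (d - 1)" using Qdeg by (rule rep_le_mono)
  let ?o = "\<lambda>V W. \<lambda>v\<in>carrier V. \<zero>\<^bsub>W\<^esub>"
  \<comment> \<open>Not the projection to P/R of the overview, but P(0): idempotent and natural in
    V, it projects P onto its constant part.\<close>
  define \<pi> where "\<pi> V = mor P V V (?o V V)" for V
  have o: "?o V W \<in> Hom K V W" if "V \<in> Vec K" "W \<in> Vec K" for V W
    by (rule zero_in_Hom[OF Vec_module[OF that(1)] Vec_module[OF that(2)]])
  have F: "module K (obj P V)" if "V \<in> Vec K" for V
    by (rule is_functorD(2)[OF func that that o[OF that that]])
  have S: "submodule (Q V) K (obj P V)" if "V \<in> Vec K" for V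
    by (rule is_subrepD(1)[OF Q that that o[OF that that]])
  have QP: "x \<in> carrier (obj P V)" if "V \<in> Vec K" "x \<in> Q V" for V x
    using module.submoduleE(1)[OF F S, OF that(1,1)] that(2) by blast
  have comp: "mor P V' V'' \<psi> (mor P V V' \<phi> x) = mor P V V'' (compose (carrier V) \<psi> \<phi>) x"
    if "V \<in> Vec K" "V' \<in> Vec K" "V'' \<in> Vec K" "\<phi> \<in> Hom K V V'" "\<psi> \<in> Hom K V' V''"
      "x \<in> carrier (obj P V)" for V V' V'' \<phi> \<psi> x
    using func that unfolding is_functor_def by (simp add: compose_eq)
  have comp_o1: "compose (carrier V) (?o V' V'') \<phi> = ?o V V''" if "\<phi> \<in> Hom K V V'" for V V' V'' :: "('a, 'c elem) module" and \<phi>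
    using HomD(1)[OF that] by (auto simp: compose_def)
  have comp_o2: "compose (carrier V) \<psi> (?o V V') = ?o V V''"
    if "V \<in> Vec K" "V' \<in> Vec K" "V'' \<in> Vec K" "\<psi> \<in> Hom K V' V''" for V V' V'' :: "('a, 'c elem) module" and \<psi>
    using linear_map_zero[OF Vec_module[OF that(2)] Vec_module[OF that(3)] Hom_linear_map[OF that(4)]]
    by (auto simp: compose_def)
  have \<pi>_lin: "linear_map K (obj P V) (obj P V) (\<pi> V)" if "V \<in> Vec K" for V
    unfolding \<pi>_def by (rule is_functorD(4)[OF func that that o[OF that that]])
  have \<pi>_mor: "\<pi> V (mor P U V \<phi> x) = mor P U V (?o U V) x"
    if "U \<in> Vec K" "V \<in> Vec K" "\<phi> \<in> Hom K U V" "x \<in> carrier (obj P U)" for U V \<phi> x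
    using comp[OF that(1,2,2,3) o[OF that(2,2)] that(4)] comp_o1[OF that(3)] by (simp add: \<pi>_def)
  have mor_\<pi>: "mor P U V \<phi> (\<pi> U x) = mor P U V (?o U V) x"
    if "U \<in> Vec K" "V \<in> Vec K" "\<phi> \<in> Hom K U V" "x \<in> carrier (obj P U)" for U V \<phi> x
    using comp[OF that(1,1,2) o[OF that(1,1)] that(3,4)] comp_o2[OF that(1,1,2,3)] by (simp add: \<pi>_def)
  have \<pi>_idem: "\<pi> V (\<pi> V x) = \<pi> V x" if "V \<in> Vec K" "x \<in> carrier (obj P V)" for V x
    using \<pi>_mor[OF that(1,1) o[OF that(1,1)] that(2)] by (simp add: \<pi>_def)
  have Q\<pi>Q: "\<pi> V x \<in> Q V" if "V \<in> Vec K" "x \<in> Q V" for V x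
    using is_subrepD(2)[OF Q that(1,1) o[OF that(1,1)]] that(2) by (auto simp: \<pi>_def)
  define B where "B V = {x \<in> Q V. \<pi> V x = \<zero>\<^bsub>obj P V\<^esub>}" for V
  have B: "is_subrep K P B"
    unfolding is_subrep_def is_subset_def
  proof (intro conjI ballI)
    fix V :: "('a, 'c elem) module" assume V: "V \<in> Vec K"
    interpret PV: module K "obj P V" by (rule F[OF V])
    note QE = PV.submoduleE[OF S[OF V]]
    show BP: "B V \<subseteq> carrier (obj P V)" using QP[OF V] by (auto simp: B_def)
    show "submodule (B V) K (obj P V)"
    proof (rule PV.submoduleI[OF BP])
      show "\<zero>\<^bsub>obj P V\<^esub> \<in> B V"
        using subgroup.one_closed[OF submodule.axioms(1)[OF S[OF V]]]
          linear_map_zero[OF F[OF V] F[OF V] \<pi>_lin[OF V]] by (simp add: B_def)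
      show "\<ominus>\<^bsub>obj P V\<^esub> x \<in> B V" if "x \<in> B V" for x
        using that QE(3) QP[OF V] linear_map_neg[OF F[OF V] F[OF V] \<pi>_lin[OF V], of x]
          PV.minus_equality[of "\<zero>\<^bsub>obj P V\<^esub>" "\<zero>\<^bsub>obj P V\<^esub>"]
        by (simp add: B_def)
      show "x \<oplus>\<^bsub>obj P V\<^esub> y \<in> B V" if "x \<in> B V" "y \<in> B V" for x y
        using that QE(5) QP[OF V] linear_map_add[OF \<pi>_lin[OF V], of x y] by (simp add: B_def)
      show "a \<odot>\<^bsub>obj P V\<^esub> x \<in> B V" if "a \<in> carrier K" "x \<in> B V" for a x
        using that QE(4) QP[OF V] linear_map_smult[OF \<pi>_lin[OF V], of a x] by (simp add: B_def)
    qed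
  next
    fix U V :: "('a, 'c elem) module" and \<phi> assume UV: "U \<in> Vec K" "V \<in> Vec K" "\<phi> \<in> Hom K U V"
    show "mor P U V \<phi> ` B U \<subseteq> B V"
    proof
      fix y assume "y \<in> mor P U V \<phi> ` B U"
      then obtain x where x: "x \<in> Q U" "\<pi> U x = \<zero>\<^bsub>obj P U\<^esub>" "y = mor P U V \<phi> x" by (auto simp: B_def)
      have "\<pi> V y = mor P U V \<phi> (\<pi> U x)"
        using \<pi>_mor[OF UV QP[OF UV(1) x(1)]] mor_\<pi>[OF UV QP[OF UV(1) x(1)]] x(3) by simp
      also have "\<dots> = \<zero>\<^bsub>obj P V\<^esub>"
        unfolding x(2) by (rule linear_map_zero[OF F[OF UV(1)] F[OF UV(2)] is_functorD(4)[OF func UV]])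
      finally show "y \<in> B V" using x is_subrepD(2)[OF Q UV] by (auto simp: B_def)
    qed
  qed
  have diffB: "x \<ominus>\<^bsub>obj P V\<^esub> \<pi> V x \<in> B V" if "V \<in> Vec K" "x \<in> Q V" for V x
  proof -
    interpret PV: module K "obj P V" by (rule F[OF that(1)])
    note c = QP[OF that] QP[OF that(1) Q\<pi>Q[OF that]]
    have "x \<ominus>\<^bsub>obj P V\<^esub> \<pi> V x \<in> Q V"
      using that Q\<pi>Q[OF that] PV.submoduleE(3,5)[OF S[OF that(1)]] by (simp add: PV.minus_eq)
    moreover have "\<pi> V (x \<ominus>\<^bsub>obj P V\<^esub> \<pi> V x) = \<zero>\<^bsub>obj P V\<^esub>"
      using linear_map_diff[OF F[OF that(1)] F[OF that(1)] \<pi>_lin[OF that(1)] c]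
        \<pi>_idem[OF that(1) c(1)] c by (simp add: PV.minus_eq PV.r_neg)
    ultimately show ?thesis by (simp add: B_def)
  qed
  have "rep_le K (quot_rep P B) (d - 1)"
  proof (rule rep_le_quot_repI[OF func B])
    fix U V :: "('a, 'c elem) module" assume U: "U \<in> Vec K" and V: "V \<in> Vec K"
    interpret PU: module K "obj P U" by (rule F[OF U])
    interpret PV: module K "obj P V" by (rule F[OF V])
    have "mor (quot_rep P Q) U V \<in> map_le K (hom_space K U V)
        (hom_space K (obj (quot_rep P Q) U) (obj (quot_rep P Q) V)) (d - 1)"
      using Qle U V unfolding rep_le_def by blast
    from quot_mor_map_leD[OF assms(1,2) func Q U V this]
    obtain r f T where dec: "mor_decomposition K P Q (d - 1) U V r f T"
      and T0: "\<forall>j<r. \<forall>x\<in>Q U. T j x = \<zero>\<^bsub>obj P V\<^esub>" by blast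
    have f: "f j \<in> fun_le K (hom_space K U V) (d - 1)" "linear_map K (obj P U) (obj P V) (T j)"
      if "j < r" for j using dec that by (simp_all add: mor_decomposition_def)
    have dec': "mor P U V \<phi> x \<ominus>\<^bsub>obj P V\<^esub> (\<Oplus>\<^bsub>obj P V\<^esub>j\<in>{..<r}. f j \<phi> \<odot>\<^bsub>obj P V\<^esub> T j x) \<in> Q V"
      if "\<phi> \<in> Hom K U V" "x \<in> carrier (obj P U)" for \<phi> x
      using dec that by (simp add: mor_decomposition_def)
    \<comment> \<open>By \<open>diffB\<close> this complementary projection takes Q(V) into B(V),
      and so turns errors in Q into errors in B.\<close>
    define \<kappa> where "\<kappa> y = y \<ominus>\<^bsub>obj P V\<^esub> \<pi> V y" for y
    have \<pi>c: "\<pi> V y \<in> carrier (obj P V)" if "y \<in> carrier (obj P V)" for y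
      by (rule linear_map_closed[OF \<pi>_lin[OF V] that])
    have \<kappa>_lin: "linear_map K (obj P V) (obj P V) \<kappa>"
      unfolding linear_map_def \<kappa>_def
      using \<pi>c by (auto simp: linear_map_add[OF \<pi>_lin[OF V]] linear_map_smult[OF \<pi>_lin[OF V]]
          PV.minus_eq PV.minus_add PV.a_ac PV.smult_r_distr PV.smult_r_minus)
    \<comment> \<open>The coefficient of the additional summand P(0). It has degree 0, which is at
      most d - 1 because d > 0.\<close>
    define one where "one = (\<lambda>\<phi>\<in>carrier (hom_space K U V). \<one>\<^bsub>K\<^esub>)"
    have one: "one \<in> fun_le K (hom_space K U V) (d - 1)"
    proof -
      have H: "hom_space K U V \<in> Vec K" by (rule hom_space_Vec[OF assms(1,2) U V])
      have "poly_lt K (hom_space K U V) (Suc (nat (d - 1))) (\<lambda>_. \<one>\<^bsub>K\<^esub>)"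
        by (rule poly_lt.const[of "\<one>\<^bsub>K\<^esub>"]) simp_all
      from poly_lt_fun_le[OF assms(1) Vec_module[OF H] _ this] H
      show ?thesis using assms(4) by (simp add: one_def Vec_def)
    qed
    let ?f = "\<lambda>j. if j < r then f j else one"
    let ?T = "\<lambda>j. if j < r then (\<lambda>x. \<kappa> (T j x)) else mor P U V (?o U V)"
    have "mor_decomposition K P B (d - 1) U V (Suc r) ?f ?T"
      unfolding mor_decomposition_def
    proof (intro conjI allI impI ballI)
      fix j assume "j < Suc r"
      show "?f j \<in> fun_le K (hom_space K U V) (d - 1)" using f one by simp
      show "linear_map K (obj P U) (obj P V) (?T j)"
        using linear_map_compose[OF f(2) \<kappa>_lin] is_functorD(4)[OF func U V o[OF U V]] by simp
    next
      fix \<phi> x assume p: "\<phi> \<in> Hom K U V" and x: "x \<in> carrier (obj P U)"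
      have fK: "f j \<phi> \<in> carrier K" if "j < r" for j
        by (rule fun_le_closed[OF f(1)[OF that]]) (simp add: hom_space_simps(1) p)
      have Tx: "T j x \<in> carrier (obj P V)" if "j < r" for j
        by (rule linear_map_closed[OF f(2)[OF that] x])
      have \<kappa>T: "\<kappa> (T j x) \<in> carrier (obj P V)" if "j < r" for j
        by (rule linear_map_closed[OF \<kappa>_lin Tx[OF that]])
      let ?s = "\<Oplus>\<^bsub>obj P V\<^esub>j\<in>{..<r}. f j \<phi> \<odot>\<^bsub>obj P V\<^esub> T j x" and ?m = "mor P U V \<phi> x"
      have s: "?s \<in> carrier (obj P V)" by (rule PV.finsum_closed) (use fK Tx in auto)
      have m: "?m \<in> carrier (obj P V)" by (rule linear_map_closed[OF is_functorD(4)[OF func U V p] x])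
      have ox: "mor P U V (?o U V) x = \<pi> V ?m" using \<pi>_mor[OF U V p x] by simp
      have "(\<Oplus>\<^bsub>obj P V\<^esub>j\<in>{..<Suc r}. ?f j \<phi> \<odot>\<^bsub>obj P V\<^esub> ?T j x) =
          one \<phi> \<odot>\<^bsub>obj P V\<^esub> \<pi> V ?m \<oplus>\<^bsub>obj P V\<^esub> (\<Oplus>\<^bsub>obj P V\<^esub>j\<in>{..<r}. ?f j \<phi> \<odot>\<^bsub>obj P V\<^esub> ?T j x)"
        unfolding lessThan_Suc
        using PV.finsum_insert[of "{..<r}" r "\<lambda>j. ?f j \<phi> \<odot>\<^bsub>obj P V\<^esub> ?T j x"] fK \<kappa>T ox \<pi>c[OF m] p
        by (auto simp: one_def hom_space_simps(1))
      also have "(\<Oplus>\<^bsub>obj P V\<^esub>j\<in>{..<r}. ?f j \<phi> \<odot>\<^bsub>obj P V\<^esub> ?T j x) =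
          (\<Oplus>\<^bsub>obj P V\<^esub>j\<in>{..<r}. \<kappa> (f j \<phi> \<odot>\<^bsub>obj P V\<^esub> T j x))"
        by (rule PV.finsum_cong') (use fK Tx \<kappa>T in \<open>auto simp: linear_map_smult[OF \<kappa>_lin]\<close>)
      also have "\<dots> = \<kappa> ?s"
        by (rule linear_map_finsum[OF F[OF V] F[OF V] \<kappa>_lin, symmetric]) (use fK Tx in auto)
      finally have "(\<Oplus>\<^bsub>obj P V\<^esub>j\<in>{..<Suc r}. ?f j \<phi> \<odot>\<^bsub>obj P V\<^esub> ?T j x) = \<pi> V ?m \<oplus>\<^bsub>obj P V\<^esub> \<kappa> ?s"
        using p \<pi>c[OF m] by (simp add: one_def hom_space_simps(1))
      then have "?m \<ominus>\<^bsub>obj P V\<^esub> (\<Oplus>\<^bsub>obj P V\<^esub>j\<in>{..<Suc r}. ?f j \<phi> \<odot>\<^bsub>obj P V\<^esub> ?T j x) =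
          ?m \<ominus>\<^bsub>obj P V\<^esub> (\<pi> V ?m \<oplus>\<^bsub>obj P V\<^esub> \<kappa> ?s)" by simp
      \<comment> \<open>The added constant part turns \<open>?m\<close> into
        \<open>\<kappa> ?m\<close>, so the new error is \<open>\<kappa>\<close> of the old one,
        which lay in Q(V).\<close>
      also have "\<dots> = \<kappa> ?m \<ominus>\<^bsub>obj P V\<^esub> \<kappa> ?s"
        using m \<pi>c[OF m] linear_map_closed[OF \<kappa>_lin s]
        by (simp add: \<kappa>_def PV.minus_eq PV.minus_add PV.a_assoc)
      also have "\<dots> = \<kappa> (?m \<ominus>\<^bsub>obj P V\<^esub> ?s)"
        using linear_map_diff[OF F[OF V] F[OF V] \<kappa>_lin m s] by simp
      finally show "?m \<ominus>\<^bsub>obj P V\<^esub> (\<Oplus>\<^bsub>obj P V\<^esub>j\<in>{..<Suc r}. ?f j \<phi> \<odot>\<^bsub>obj P V\<^esub> ?T j x) \<in> B V"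
        using diffB[OF V dec'[OF p x]] by (simp add: \<kappa>_def)
    qed
    moreover have "?T j ` B U \<subseteq> B V" if "j < Suc r" for j
    proof -
      have zero: "\<zero>\<^bsub>obj P V\<^esub> \<in> B V"
        using subgroup.one_closed[OF submodule.axioms(1)[OF is_subrepD(1)[OF B V V o[OF V V]]]] by simp
      show ?thesis
      proof (cases "j < r")
        \<comment> \<open>B(U) lies in Q(U), all of which \<open>T j\<close> kills.\<close>
        case True
        then show ?thesis
          using T0 zero linear_map_zero[OF F[OF V] F[OF V] \<kappa>_lin] by (auto simp: B_def)
      next
        case False
        then show ?thesis using is_subrepD(2)[OF B U V o[OF U V]] by simp
      qed
    qed
    ultimately show "\<exists>r f T. mor_decomposition K P B (d - 1) U V r f T \<and> (\<forall>j<r. T j ` B U \<subseteq> B V)"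
      by blast
  qed
  from least_int_ge[of "-1" "d - 1" "rep_le K (quot_rep P B)", OF _ this]
  have "rep_degree K (quot_rep P B) \<le> d - 1"
    using assms(4) unfolding rep_degree_def by simp
  with Qmin[OF B this] have "B W = Q W" using assms(6) by (auto simp: B_def)
  then show ?thesis using assms(7) by (auto simp: B_def \<pi>_def)
qed

text \<open>K[P'(V)] contains the indicator of the complement of X'(V). A function that vanishes on
  the preimage of X'(V) equals its product with the pullback of this indicator and therefore lies in
  the ideal.\<close>

lemma not_in_pulled_back_ideal:
  assumes "field K" "module K (obj P V)" "f \<in> carrier (fun_ring K (obj P V))"
    "f \<notin> pulled_back_ideal K P R X' V"
    "X' V \<subseteq> carrier (quot_space (obj P V) (R V))"
  shows "\<exists>p\<in>carrier (obj P V). quot_proj (obj P V) (R V) p \<in> X' V \<and> f p \<noteq> \<zero>\<^bsub>K\<^esub>"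
proof (rule ccontr)
  interpret K: field K by fact
  let ?q = "quot_proj (obj P V) (R V)" and ?F = "fun_ring K (obj P V)"
  assume "\<not> ?thesis"
  then have f0: "f p = \<zero>\<^bsub>K\<^esub>" if "p \<in> carrier (obj P V)" "?q p \<in> X' V" for p using that by blast
  have fK: "f p \<in> carrier K" if "p \<in> carrier (obj P V)" for p
    using assms(3) that by (auto simp: fun_ring_def)
  define g where "g = (\<lambda>A\<in>carrier (quot_space (obj P V) (R V)). if A \<in> X' V then \<zero>\<^bsub>K\<^esub> else \<one>\<^bsub>K\<^esub>)"
  let ?g = "\<lambda>p\<in>carrier (obj P V). g (?q p)"
  have qc: "?q p \<in> carrier (quot_space (obj P V) (R V))" if "p \<in> carrier (obj P V)" for p
    using that by (auto simp: quot_space_def quot_proj_def A_RCOSETS_def')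
  show False
  proof -
    have g: "g \<in> vanishing_ideal K (obj (quot_rep P R) V) (X' V)"
      using assms(5) by (auto simp: vanishing_ideal_def fun_ring_def quot_rep_def g_def)
    have gF: "?g \<in> carrier ?F" using qc by (auto simp: fun_ring_def g_def)
    have "f = f \<otimes>\<^bsub>?F\<^esub> ?g"
    proof
      fix p show "f p = (f \<otimes>\<^bsub>?F\<^esub> ?g) p"
      proof (cases "p \<in> carrier (obj P V)")
        case True
        then show ?thesis using f0 fK[OF True] qc by (simp add: fun_ring_def g_def)
      next
        case False
        then show ?thesis using assms(3) by (simp add: fun_ring_def PiE_iff extensional_def)
      qed
    qed
    moreover have "f \<otimes>\<^bsub>?F\<^esub> ?g \<in> I" if "ideal I ?F" 
      "(\<lambda>g. \<lambda>p\<in>carrier (obj P V). g (?q p)) ` vanishing_ideal K (obj (quot_rep P R) V) (X' V) \<subseteq> I" for I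
      by (rule ideal.I_l_closed[OF that(1) _ assms(3)]) (use that(2) g in blast)
    ultimately have "f \<in> pulled_back_ideal K P R X' V"
      unfolding pulled_back_ideal_def genideal_def by auto
    then show False using assms(4) by simp
  qed
qed

theorem theorem4p6p1:
  fixes K :: "('k, 'm) ring_scheme"
    and P :: "('k, 'a, 'b) rep"
    and d :: int
    and P_top R X :: "('k, 'a, 'b) family"
    and X' :: "('k, 'a, 'b set) family"
    and V :: "('k, 'a elem) module"
    and f :: "'b \<Rightarrow> 'k"
  assumes "field K" and "finite (carrier K)" and "prime (card (carrier K))"
    and "poly_rep K P" and "rep_degree K P = d" and "d > 0"
    and "is_gt_part K P (d - 1) P_top"
    and "is_subrep K (sub_rep P P_top) R"
    and "irreducible_rep K (sub_rep P R)"
    and "is_subset K P X"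
    and "X' = quot_family P R X"
    and "V \<in> Vec K"
    and "f \<in> vanishing_ideal K (obj P V) (X V) - pulled_back_ideal K P R X' V"
  shows "\<exists>U h. U \<in> Vec K \<and>
      h \<in> carrier (fun_ring K (obj P U)) \<and>
      fun_degree K (obj P U) h < fun_degree K (obj P V) f \<and>
      (\<exists>p\<in>carrier (obj P U). quot_proj (obj P U) (R U) p \<in> X' U \<and> h p \<noteq> \<zero>\<^bsub>K\<^esub>) \<and>
      (\<forall>W\<in>Vec K.
         inj_on (quot_proj (obj (shift_rep U P) W) (shift_embed U P R W))
           (localized_family K U P h X W))"
proof -
  have func: "is_functor K P" using assms(4) by (simp add: poly_rep_def)
  obtain D where D: "rep_le K P D" using assms(4) by (auto simp: poly_rep_def)
  have Q: "is_subrep K P P_top" using assms(7) by (simp add: is_gt_part_def)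
  note R = subrep_of_subrep[OF func Q assms(8)]
  interpret embedding K P D R X
  proof (rule embedding.intro)
    show "field K" "finite (carrier K)" "prime (card (carrier K))" "is_functor K P" "rep_le K P D"
      "is_subrep K P R" "irreducible_rep K (sub_rep P R)" "is_subset K P X"
      by (fact assms func D R(1))+
    fix W :: "('k, 'a elem) module" and r assume W: "W \<in> Vec K" "r \<in> R W"
    show "mor P W W (\<lambda>x\<in>carrier W. \<zero>\<^bsub>W\<^esub>) r = \<zero>\<^bsub>obj P W\<^esub>"
      by (rule gt_part_zero[OF assms(1,2,4,6,7) W(1)]) (use R(2)[OF W(1)] W(2) in blast)
  qed
  note V = assms(12)
  interpret PV: module K "obj P V" by (rule obj_module[OF V])
  have f: "f \<in> carrier (fun_ring K (obj P V))" and fX: "\<And>x. x \<in> X V \<Longrightarrow> f x = \<zero>\<^bsub>K\<^esub>"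
    and fI: "f \<notin> pulled_back_ideal K P R X' V"
    using assms(13) by (auto simp: vanishing_ideal_def)
  have X': "X' V \<subseteq> carrier (quot_space (obj P V) (R V))"
    using X_carrier[OF V]
    by (auto simp: assms(11) quot_family_def quot_space_simps(1)[OF PV.module_axioms R_submodule[OF V]])
  obtain p where p: "p \<in> carrier (obj P V)" "quot_proj (obj P V) (R V) p \<in> X' V" "f p \<noteq> \<zero>\<^bsub>K\<^esub>"
    using not_in_pulled_back_ideal[OF assms(1) PV.module_axioms f fI X'] by blast
  then obtain q where q: "q \<in> X V" "quot_proj (obj P V) (R V) p = quot_proj (obj P V) (R V) q"
    by (auto simp: assms(11) quot_family_def)
  have qP: "q \<in> carrier (obj P V)" by (rule X_carrier[OF V q(1)])
  let ?s = "p \<ominus>\<^bsub>obj P V\<^esub> q"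
  have s: "?s \<in> R V" using quot_proj_eq_iff[OF PV.module_axioms R_submodule[OF V] p(1) qP] q(2) by simp
  have "q \<oplus>\<^bsub>obj P V\<^esub> ?s = p"
    using p(1) qP by (simp add: PV.minus_eq PV.a_comm[of p] PV.r_neg2 PV.r_neg1)
  then have fs: "f (q \<oplus>\<^bsub>obj P V\<^esub> ?s) \<noteq> \<zero>\<^bsub>K\<^esub>" using p(3) by simp
  define e where "e = fun_degree K (obj P V) f"
  have "f \<in> fun_le K (obj P V) e"
    unfolding e_def by (rule fun_le_fun_degree[OF assms(1,2) obj_Vec[OF V] f])
  then have poly: "poly_lt K (obj P V) (nat (e + 1)) f"
    by (rule fun_le_poly_lt[OF PV.module_axioms])
  \<comment> \<open>Being nonzero at \<open>p\<close>, f does not have degree -1, so the strict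
    index has the form \<open>Suc E\<close> with E the degree of f.\<close>
  have "nat (e + 1) \<noteq> 0" using poly_lt_0[OF PV.module_axioms, of f p] poly p by auto
  then have e: "nat (e + 1) = Suc (nat e)" "e \<ge> 0" by linarith+
  obtain U h where U: "U \<in> Vec K" and h: "poly_lt K (obj P U) (nat e) h"
    and hX: "\<exists>x\<in>X U. h x \<noteq> \<zero>\<^bsub>K\<^esub>"
    and inj: "\<forall>W\<in>Vec K. inj_on (quot_proj (obj (shift_rep U P) W) (shift_embed U P R W))
       (localized_family K U P h X W)"
    using embedding_lemma[OF V poly[unfolded e(1)] fX q(1) s fs] by blast
  interpret PU: module K "obj P U" by (rule obj_module[OF U])
  \<comment> \<open>Elements of \<open>fun_ring\<close> are extensional, whereas \<open>h\<close> is
    controlled on the carrier only.\<close>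
  define h' where "h' = restrict h (carrier (obj P U))"
  have h': "h' \<in> carrier (fun_ring K (obj P U))"
    using poly_lt_closed[OF PU.module_axioms h] by (auto simp: h'_def fun_ring_def)
  have "h' \<in> fun_le K (obj P U) (int (nat e) - 1)"
    unfolding h'_def
    by (rule poly_lt_fun_le[OF assms(1) PU.module_axioms _ h]) (use obj_Vec[OF U] in \<open>simp add: Vec_def\<close>)
  \<comment> \<open>As e \<ge> 0, the bound e - 1 is at least -1 and hence admissible in
    \<open>fun_degree\<close>.\<close>
  then have deg: "fun_degree K (obj P U) h' < e"
    using fun_degree_le[of h' K "obj P U" "e - 1"] e(2) by simp
  have nz: "\<exists>p\<in>carrier (obj P U). quot_proj (obj P U) (R U) p \<in> X' U \<and> h' p \<noteq> \<zero>\<^bsub>K\<^esub>"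
    using hX X_carrier[OF U] by (auto simp: h'_def assms(11) quot_family_def)
  \<comment> \<open>The localization evaluates \<open>h\<close> at points of P(U) only, where the
    restriction changes nothing.\<close>
  have "localized_family K U P h' X W = localized_family K U P h X W" if W: "W \<in> Vec K" for W
  proof -
    have S: "dsum U W \<in> Vec K" by (rule dsum_Vec[OF assms(1,2) U W])
    have "mor P (dsum U W) U (dsum_fst U W) x \<in> carrier (obj P U)" if "x \<in> X (dsum U W)" for x
      by (rule HomD(1)[OF mor_Hom[OF S U dsum_fst_Hom[OF Vec_module[OF U] Vec_module[OF W]]]
          X_carrier[OF S that]])
    then show ?thesis by (auto simp: localized_family_def shift_family_def h'_def)
  qed
  then show ?thesis
    using U h' deg nz inj unfolding e_def by (intro exI[of _ U] exI[of _ h']) simp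
qed

end
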